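(* For all $k\geq 4$ and all $n\geq 0$, $|\operatorname{Av}_n(A_{k,k})|=|\operatorname{Av}_n(B_{k,k})|$. In particular, for all odd $k\geq 5$, the generating function $\sum_{n\geq 0}|\operatorname{Av}_n(B_{k,k})|z^n$ is not algebraic.
   Context: A permutation $p=p_1\cdots p_n$ contains a pattern $q=q_1\cdots q_k$ if there are indices $i_1<\cdots<i_k$ with $p_{i_r}<p_{i_s}$ iff $q_r<q_s$; otherwise $p$ avoids $q$. $\operatorname{Av}_n(S)$ is the set of permutations of length $n$ avoiding every pattern in the set $S$. $A_{k,k}$ is the set of the $k-1$ permutations of length $k$ whose first $k-1$ entries are increasing and whose last entry is less than $k$. $B_{k,k}$ is the set of the $k-1$ permutations of length $k$ whose first $k-1$ entries form a pattern order-isomorphic to $213\cdots(k-1)$ and whose last entry is less than $k$; e.g. $B_{5,5}=\{21354,21453,31452,32451\}$. A power series $A(z)$ is algebraic if there are polynomials $P_0(z),\dots,P_d(z)$, not all identically zero, with $\sum_{j=0}^d P_j(z)A(z)^j=0$. *)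

theory Defs
  imports
    "HOL-Combinatorics.Multiset_Permutations"
    "HOL-Computational_Algebra.Polynomial_FPS"
    Complex_Main
begin

text \<open>
  Permutations of length \<open>n\<close> are written in one-line notation, as the lists in
  \<^term>\<open>permutations_of_set {1..n}\<close>, and indexed from 0.
\<close>

definition contains_pattern :: "nat list \<Rightarrow> nat list \<Rightarrow> bool" where
  "contains_pattern p q \<longleftrightarrow>
     (\<exists>i :: nat \<Rightarrow> nat. strict_mono_on {..<length q} i \<and>
        (\<forall>r < length q. i r < length p) \<and>
        (\<forall>r < length q. \<forall>s < length q. p ! i r < p ! i s \<longleftrightarrow> q ! r < q ! s))"

definition Av :: "nat \<Rightarrow> nat list set \<Rightarrow> nat list set" where
  "Av n S = {p \<in> permutations_of_set {1..n}. \<forall>q \<in> S. \<not> contains_pattern p q}"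

definition order_isomorphic :: "nat list \<Rightarrow> nat list \<Rightarrow> bool" where
  "order_isomorphic xs ys \<longleftrightarrow> length xs = length ys \<and>
     (\<forall>r < length xs. \<forall>s < length xs. xs ! r < xs ! s \<longleftrightarrow> ys ! r < ys ! s)"

text \<open>
  The sets \<open>A\<^sub>k\<^sub>,\<^sub>k\<close> and \<open>B\<^sub>k\<^sub>,\<^sub>k\<close>; only \<open>k \<ge> 4\<close> is meaningful here. The list
  \<^term>\<open>2 # 1 # [3..<k]\<close> is the permutation \<open>2 1 3 \<dots> (k-1)\<close>.
\<close>

definition A_patterns :: "nat \<Rightarrow> nat list set" where
  "A_patterns k = {q \<in> permutations_of_set {1..k}. sorted_wrt (<) (butlast q) \<and> last q < k}"

definition B_patterns :: "nat \<Rightarrow> nat list set" where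
  "B_patterns k = {q \<in> permutations_of_set {1..k}.
     order_isomorphic (butlast q) (2 # 1 # [3..<k]) \<and> last q < k}"

text \<open>
  Algebraicity over the field of rational functions with complex coefficients. For a series with
  rational coefficients this agrees with algebraicity over the rational functions over \<open>\<rat>\<close>.
\<close>

definition algebraic_fps :: "complex fps \<Rightarrow> bool" where
  "algebraic_fps A \<longleftrightarrow>
     (\<exists>(d :: nat) (P :: nat \<Rightarrow> complex poly).
        (\<exists>j\<le>d. P j \<noteq> 0) \<and> (\<Sum>j\<le>d. fps_of_poly (P j) * A ^ j) = 0)"

end

theory Submission
  imports
    Defs
    "HOL-Library.Sublist"
    "HOL-Analysis.Analysis"
    "HOL-Real_Asymp.Real_Asymp"
begin

text \<open>
  Equality of the two counts: the positions and values that can be completed by the last \<open>k - 2\<close>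
  letters of a pattern form a Ferrers board. Avoiding \<open>A\<close> means that the part of the permutation
  inside the board avoids 12, avoiding \<open>B\<close> that it avoids 21. Exchanging two entries inside the
  board does not change the board, and among the permutations that share the board and the entries
  outside it exactly one avoids 12 and exactly one avoids 21 inside.

  Non-algebraicity: put \<open>d = k - 2\<close>. A permutation avoiding \<open>A\<close> is a word without increasing
  subsequences of length \<open>d + 1\<close> followed by an increasing rest, so its count lies between
  \<open>b (n - d)\<close> and \<open>b n\<close>, where \<open>b n\<close> counts the words with distinct letters in \<open>{1..n}\<close> without
  increasing subsequences of length \<open>d + 1\<close>. Building such words letter by letter gives a recursion
  whose plane waves are products of partial sums of \<open>d\<close> complex variables; a reflection argument over
  the \<open>N\<close>-th roots of unity, for large \<open>N\<close>, yields that \<open>b n\<close> is the mean over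
  \<open>w\<close> of \<open>(1 + \<bar>w\<^sub>1 + \<dots> + w\<^sub>d\<bar>\<^sup>2)\<^sup>n \<Prod>\<^bsub>i<j\<^esub> \<bar>w\<^sub>i - w\<^sub>j\<bar>\<^sup>2 / d!\<close>. Laplace's method bounds this above and below by
  constant multiples of \<open>\<beta>\<^sup>n / n\<^sup>r\<close> with \<open>\<beta> = d\<^sup>2 + 1\<close> and \<open>r = (d\<^sup>2 - 1) / 2\<close>. For odd \<open>d\<close> the
  exponent \<open>r\<close> is a positive integer, which forces a logarithmic singularity at \<open>1 / \<beta>\<close>.
\<close>


section \<open>Ferrers boards and the equality of the counts\<close>

text \<open>Roots of unity stand in for integrals over the torus: averaging a polynomial in
  \<open>1 / a\<close> of degree below \<open>N\<close> returns its constant coefficient exactly, so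
  every identity holds for each finite \<open>N > n + d\<close> and no limit in \<open>N\<close> is
  taken. The weight is the product of \<open>1 - w_j / w_i\<close> over \<open>i < j\<close>:
  exchanging neighbouring letters then cancels the boundary terms, and its own mean is 1, which
  starts the recursion. The exponent \<open>r\<close> counts scales. Near the maximum, where
  \<open>d\<close> letters coincide and the base is \<open>d^2 + 1\<close>, the letters cluster at
  distance about \<open>1 / sqrt n\<close>. The \<open>d choose 2\<close> squared differences
  contribute \<open>n ^ -(d choose 2)\<close>, the \<open>d - 1\<close> relative angles contribute
  \<open>n ^ -((d - 1) / 2)\<close>, and the common rotation costs nothing. Bounds up to constant
  factors suffice for the last step: once the exponent has been lowered to 1, the series grows like
  a logarithm at \<open>1 / \<beta>\<close>, unbounded but slower than every power of
  \<open>1 / (1 - \<beta> z)\<close>, and no algebraic equation permits this. For even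
  \<open>d\<close> the exponent would be half of an odd integer, which does occur for algebraic
  series.\<close>

definition occurs_at :: "(nat \<Rightarrow> nat) \<Rightarrow> nat \<Rightarrow> nat list \<Rightarrow> bool" where
  "occurs_at i k p \<longleftrightarrow> strict_mono_on {..<k} i \<and> (\<forall>r<k. i r < length p)"

lemma occurs_atD: "occurs_at i k p \<Longrightarrow> r < s \<Longrightarrow> s < k \<Longrightarrow> i r < i s"
  unfolding occurs_at_def by (meson lessThan_iff order_less_trans strict_mono_onD)

text \<open>Common form of both pattern sets, with \<open>b\<close> equal to \<open>[1..<k]\<close>
  for A and to \<open>2 # 1 # [3..<k]\<close> for B, so that containment is analysed once.\<close>

definition patterns_over :: "nat list \<Rightarrow> nat \<Rightarrow> nat list set" where
  "patterns_over b k = {q \<in> permutations_of_set {1..k}. order_isomorphic (butlast q) b \<and> last q < k}"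

lemma B_patterns_eq: "B_patterns k = patterns_over (2 # 1 # [3..<k]) k"
  by (simp add: B_patterns_def patterns_over_def)

lemma A_patterns_eq: "k \<ge> 1 \<Longrightarrow> A_patterns k = patterns_over [1..<k] k"
proof -
  assume k: "k \<ge> 1"
  have "sorted_wrt (<) (butlast q) \<longleftrightarrow> order_isomorphic (butlast q) [1..<k]"
    if "q \<in> permutations_of_set {1..k}" for q
  proof -
    have l: "length (butlast q) = k - 1"
      using that by (auto simp: permutations_of_set_def distinct_card[symmetric])
    show ?thesis
    proof
      assume "sorted_wrt (<) (butlast q)"
      then have lt: "butlast q ! r < butlast q ! s" if "r < s" "s < k - 1" for r s
        using that l by (simp add: sorted_wrt_iff_nth_less)
      have "butlast q ! r < butlast q ! s \<longleftrightarrow> r < s" if "r < k - 1" "s < k - 1" for r s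
        using lt[of r s] lt[of s r] that by (cases r s rule: linorder_cases) auto
      then show "order_isomorphic (butlast q) [1..<k]"
        using l by (simp add: order_isomorphic_def)
    next
      assume "order_isomorphic (butlast q) [1..<k]"
      then show "sorted_wrt (<) (butlast q)"
        using l by (simp add: order_isomorphic_def sorted_wrt_iff_nth_less)
    qed
  qed
  then show ?thesis by (auto simp: A_patterns_def patterns_over_def)
qed

text \<open>Each letter is replaced by its rank.\<close>

lemma standardization:
  fixes xs :: "nat list"
  assumes "distinct xs"
  obtains q where "q \<in> permutations_of_set {1..length xs}" "order_isomorphic q xs"
proof
  define f where "f x = card {y \<in> set xs. y \<le> x}" for x
  define q where "q = map f xs"
  have less: "f x < f y" if "x < y" "y \<in> set xs" for x y
    proof -
    have "{z \<in> set xs. z \<le> x} \<subset> {z \<in> set xs. z \<le> y}"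
    proof (rule psubsetI)
      show "{z \<in> set xs. z \<le> x} \<noteq> {z \<in> set xs. z \<le> y}"
        using that by (metis (mono_tags, lifting) le_refl leD mem_Collect_eq)
    qed (use that in auto)
    then show ?thesis unfolding f_def by (intro psubset_card_mono) auto
  qed
  have iso: "f x < f y \<longleftrightarrow> x < y" if "x \<in> set xs" "y \<in> set xs" for x y
    using less[of x y] less[of y x] that by (cases x y rule: linorder_cases) auto
  show "order_isomorphic q xs"
    unfolding order_isomorphic_def q_def by (auto simp: iso)
  have inj: "inj_on f (set xs)"
    using iso by (intro inj_onI) (metis less_irrefl linorder_neqE_nat)
  have "f ` set xs \<subseteq> {1..length xs}"
  proof (clarsimp, intro conjI)
    fix x assume "x \<in> set xs"
    then have "0 < f x" unfolding f_def by (auto simp: card_gt_0_iff)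
    then show "Suc 0 \<le> f x" by simp
    show "f x \<le> length xs" unfolding f_def
      by (rule order_trans[OF card_mono[of "set xs"] card_length]) auto
  qed
  moreover have "card (f ` set xs) = length xs"
    using inj assms by (simp add: card_image distinct_card)
  ultimately have "f ` set xs = {1..length xs}"
    by (intro card_subset_eq) auto
  then show "q \<in> permutations_of_set {1..length xs}"
    using inj assms by (auto simp: permutations_of_set_def q_def distinct_map)
qed

text \<open>Since \<open>b\<close> has its maximum at the end, \<open>last q < k\<close> forces the
  value \<open>k\<close> to position \<open>k - 2\<close>, and the condition on the last letter
  becomes a final descent. Every height of the last letter below the maximum occurs in the set, so
  nothing beyond this descent remains.\<close>

lemma contains_patterns_over:
  assumes p: "distinct p" and k: "k \<ge> 2" and b: "length b = k - 1"
    and max: "\<And>r. r < k - 2 \<Longrightarrow> b ! r < b ! (k - 2)"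
  shows "(\<exists>q\<in>patterns_over b k. contains_pattern p q) \<longleftrightarrow>
    (\<exists>i. occurs_at i k p \<and> (\<forall>r<k-1. \<forall>s<k-1. p ! i r < p ! i s \<longleftrightarrow> b ! r < b ! s) \<and>
       p ! i (k - 1) < p ! i (k - 2))" (is "?L \<longleftrightarrow> ?R")
proof
  assume ?L
  then obtain q i where q: "q \<in> permutations_of_set {1..k}" and iso: "order_isomorphic (butlast q) b"
    and last: "last q < k" and i: "strict_mono_on {..<length q} i" "\<forall>r<length q. i r < length p"
    and pq: "\<And>r s. r < length q \<Longrightarrow> s < length q \<Longrightarrow> p ! i r < p ! i s \<longleftrightarrow> q ! r < q ! s"
    unfolding patterns_over_def contains_pattern_def by auto
  have lq: "length q = k" and dq: "distinct q" and sq: "set q = {1..k}"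
    using q by (auto simp: permutations_of_set_def distinct_card[symmetric])
  have qb: "q ! r < q ! s \<longleftrightarrow> b ! r < b ! s" if "r < k - 1" "s < k - 1" for r s
    using iso that lq b unfolding order_isomorphic_def by (simp add: nth_butlast)
  have lastq: "last q = q ! (k - 1)" using lq k by (metis last_conv_nth list.size(3) not_numeral_le_zero)
  obtain r where r: "r < k" "q ! r = k"
    using sq lq k in_set_conv_nth[of k q] by auto
  have "r = k - 2"
  proof (rule ccontr)
    assume "r \<noteq> k - 2"
    moreover have "r \<noteq> k - 1" using r last lastq by auto
    ultimately have "r < k - 2" using r by auto
    then have "k < q ! (k - 2)" using max[of r] qb[of r "k - 2"] r k by auto
    moreover have "q ! (k - 2) \<in> {1..k}" using sq lq k nth_mem[of "k - 2" q] by auto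
    ultimately show False by auto
  qed
  then have "q ! (k - 1) < q ! (k - 2)" using last lastq r by simp
  then have "p ! i (k - 1) < p ! i (k - 2)" using pq[of "k - 1" "k - 2"] lq k by simp
  then show ?R using i lq pq qb unfolding occurs_at_def by (intro exI[of _ i]) auto
next
  assume ?R
  then obtain i where i: "occurs_at i k p"
    and pb: "\<And>r s. r < k - 1 \<Longrightarrow> s < k - 1 \<Longrightarrow> p ! i r < p ! i s \<longleftrightarrow> b ! r < b ! s"
    and pl: "p ! i (k - 1) < p ! i (k - 2)"
    by auto
  define xs where "xs = map (\<lambda>r. p ! i r) [0..<k]"
  have inj: "inj_on i {..<k}" using i unfolding occurs_at_def by (simp add: strict_mono_on_imp_inj_on)
  have "inj_on (\<lambda>r. p ! i r) {..<k}"
    using p i inj by (intro inj_onI) (auto simp: occurs_at_def nth_eq_iff_index_eq dest: inj_onD)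
  then have "distinct xs" by (simp add: xs_def distinct_map atLeast0LessThan)
  from standardization[OF this] obtain q where
    q: "q \<in> permutations_of_set {1..length xs}" "order_isomorphic q xs" by blast
  have lq: "length q = k" using q by (simp add: order_isomorphic_def xs_def)
  have qp: "q ! r < q ! s \<longleftrightarrow> p ! i r < p ! i s" if "r < k" "s < k" for r s
    using q lq that by (simp add: order_isomorphic_def xs_def)
  have "contains_pattern p q"
    unfolding contains_pattern_def using i lq qp unfolding occurs_at_def by (intro exI[of _ i]) auto
  moreover have "last q < k"
  proof -
    have "last q = q ! (k - 1)" using lq k by (metis last_conv_nth list.size(3) not_numeral_le_zero)
    also have "\<dots> < q ! (k - 2)" using qp[of "k - 1" "k - 2"] pl k by simp
    also have "q ! (k - 2) \<le> k" using q(1) lq k nth_mem[of "k - 2" q]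
      by (auto simp: permutations_of_set_def xs_def)
    finally show ?thesis .
  qed
  moreover have "order_isomorphic (butlast q) b"
    using qp pb lq b unfolding order_isomorphic_def by (simp add: nth_butlast)
  moreover have "q \<in> permutations_of_set {1..k}" using q by (simp add: xs_def)
  ultimately show ?L unfolding patterns_over_def by auto
qed

text \<open>
  The pairs \<open>(a, v)\<close> that can be completed by the last \<open>k - 2\<close> letters of a forbidden pattern
  placed to their upper right. They form a Ferrers board, and avoiding \<^term>\<open>A_patterns k\<close>
  (\<^term>\<open>B_patterns k\<close>) means avoiding 12 (21) inside this board.
\<close>

definition board :: "nat \<Rightarrow> nat list \<Rightarrow> nat \<Rightarrow> nat \<Rightarrow> bool" where
  "board k p a v \<longleftrightarrow> (\<exists>c. (\<forall>r s. 2 \<le> r \<longrightarrow> r < s \<longrightarrow> s < k \<longrightarrow> c r < c s) \<and>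
     (\<forall>r. 2 \<le> r \<longrightarrow> r < k \<longrightarrow> c r < length p) \<and> a < c 2 \<and> v < p ! c 2 \<and>
     (\<forall>r s. 2 \<le> r \<longrightarrow> r < s \<longrightarrow> s < k - 1 \<longrightarrow> p ! c r < p ! c s) \<and>
     p ! c (k - 1) < p ! c (k - 2))"

lemma board_mono: "board k p a v \<Longrightarrow> a' \<le> a \<Longrightarrow> v' \<le> v \<Longrightarrow> board k p a' v'"
  unfolding board_def using le_less_trans[of a' a] le_less_trans[of v' v] by blast

lemma nth_B_base: "k \<ge> 4 \<Longrightarrow> r < k - 1 \<Longrightarrow>
    (2 # 1 # [3..<k]) ! r = (if r = 0 then 2 else if r = 1 then 1 else r + 1)"
  by (auto simp: nth_Cons split: nat.split)

text \<open>The completing positions in \<open>board\<close> are indexed from 2 so that the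
  embedding of the whole pattern is itself the witness.\<close>

lemma board_of_occurrence:
  assumes k: "k \<ge> 4" and i: "occurs_at i k p"
    and "\<And>r s. 2 \<le> r \<Longrightarrow> r < s \<Longrightarrow> s < k - 1 \<Longrightarrow> p ! i r < p ! i s"
    and "p ! i (k - 1) < p ! i (k - 2)" "p ! i 0 < p ! i 2" "p ! i 1 < p ! i 2"
  shows "board k p (i 1) (max (p ! i 0) (p ! i 1))" "i 0 < i 1" "i 1 < length p"
proof -
  show "i 0 < i 1" "i 1 < length p" using i k occurs_atD[OF i, of 0 1] by (auto simp: occurs_at_def)
  show "board k p (i 1) (max (p ! i 0) (p ! i 1))"
    unfolding board_def using assms occurs_atD[OF i] by (intro exI[of _ i]) (auto simp: occurs_at_def)
qed

lemma boardE:
  assumes k: "k \<ge> 4" and b: "board k p y (max (p ! x) (p ! y))" and xy: "x < y" "y < length p"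
  obtains i where "occurs_at i k p" "i 0 = x" "i 1 = y"
    "\<And>r s. 2 \<le> r \<Longrightarrow> r < s \<Longrightarrow> s < k - 1 \<Longrightarrow> p ! i r < p ! i s"
    "\<And>r. 2 \<le> r \<Longrightarrow> r < k - 1 \<Longrightarrow> p ! x < p ! i r \<and> p ! y < p ! i r"
    "p ! i (k - 1) < p ! i (k - 2)"
proof -
  from b obtain c where c: "\<And>r s. 2 \<le> r \<Longrightarrow> r < s \<Longrightarrow> s < k \<Longrightarrow> c r < c s"
    "\<And>r. 2 \<le> r \<Longrightarrow> r < k \<Longrightarrow> c r < length p" "y < c 2" "max (p ! x) (p ! y) < p ! c 2"
    "\<And>r s. 2 \<le> r \<Longrightarrow> r < s \<Longrightarrow> s < k - 1 \<Longrightarrow> p ! c r < p ! c s"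
    "p ! c (k - 1) < p ! c (k - 2)"
    unfolding board_def by blast
  define i where "i = c(0 := x, 1 := y)"
  have ic: "i r = c r" if "2 \<le> r" for r using that by (simp add: i_def)
  have i01: "i 0 = x" "i 1 = y" by (simp_all add: i_def)
  have y: "y < c r" if "2 \<le> r" "r < k" for r
    using c(1)[of 2 r] c(3) that by (cases "r = 2") auto
  have lt: "i r < i s" if "r < s" "s < k" for r s
  proof -
    consider "r = 0" "s = 1" | "r = 0" "2 \<le> s" | "r = 1" "2 \<le> s" | "2 \<le> r" "2 \<le> s"
      using \<open>r < s\<close> by linarith
    then show ?thesis
      using that y[of s] xy c(1)[of r s] by cases (auto simp: i01 ic i01[unfolded One_nat_def])
  qed
  have "occurs_at i k p"
    unfolding occurs_at_def
  proof (intro conjI allI impI)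
    show "strict_mono_on {..<k} i" using lt by (auto intro: strict_mono_onI)
    fix r assume "r < k"
    then show "i r < length p"
      using c(2)[of r] xy by (cases "2 \<le> r") (auto simp: i_def)
  qed
  moreover have "p ! x < p ! i r \<and> p ! y < p ! i r" if "2 \<le> r" "r < k - 1" for r
    using c(5)[of 2 r] c(4) that by (cases "r = 2") (auto simp: ic)
  ultimately show thesis
    using that[of i] c(5,6) i01 k by (auto simp: ic)
qed

text \<open>A 12 at positions \<open>x < y\<close> has upper right corner \<open>(y, p ! y)\<close>,
  and a completion of the corner completes both letters.\<close>

lemma contains_A_patterns_iff:
  assumes k: "k \<ge> 4" and p: "distinct p"
  shows "(\<exists>q\<in>A_patterns k. contains_pattern p q) \<longleftrightarrow>
    (\<exists>x y. x < y \<and> y < length p \<and> p ! x < p ! y \<and> board k p y (p ! y))"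
proof -
  have "(\<exists>q\<in>A_patterns k. contains_pattern p q) \<longleftrightarrow>
    (\<exists>i. occurs_at i k p \<and> (\<forall>r<k-1. \<forall>s<k-1. p ! i r < p ! i s \<longleftrightarrow> [1..<k] ! r < [1..<k] ! s) \<and>
       p ! i (k - 1) < p ! i (k - 2))"
    using contains_patterns_over[of p k "[1..<k]"] A_patterns_eq[of k] k p by simp
  also have "\<dots> \<longleftrightarrow> (\<exists>x y. x < y \<and> y < length p \<and> p ! x < p ! y \<and> board k p y (p ! y))"
  proof (intro iffI; elim exE conjE)
    fix i assume i: "occurs_at i k p"
      and pi: "\<forall>r<k-1. \<forall>s<k-1. p ! i r < p ! i s \<longleftrightarrow> [1..<k] ! r < [1..<k] ! s"
      and l: "p ! i (k - 1) < p ! i (k - 2)"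
    have "p ! i r < p ! i s" if "r < s" "s < k - 1" for r s using that pi k by auto
    note * = this
    have 2: "p ! i 0 < p ! i 1" "p ! i 0 < p ! i 2" "p ! i 1 < p ! i 2"
      using *[of 0 1] *[of 0 2] *[of 1 2] k by auto
    with board_of_occurrence[OF k i * l]
    show "\<exists>x y. x < y \<and> y < length p \<and> p ! x < p ! y \<and> board k p y (p ! y)"
      by (intro exI[of _ "i 0"] exI[of _ "i 1"]) (auto simp: max_def split: if_splits)
  next
    fix x y assume xy: "x < y" "y < length p" "p ! x < p ! y" "board k p y (p ! y)"
    then have "board k p y (max (p ! x) (p ! y))" by (simp add: max_def)
    from boardE[OF k this xy(1,2)] obtain i where i: "occurs_at i k p" "i 0 = x" "i 1 = y"
      "\<And>r s. 2 \<le> r \<Longrightarrow> r < s \<Longrightarrow> s < k - 1 \<Longrightarrow> p ! i r < p ! i s"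
      "\<And>r. 2 \<le> r \<Longrightarrow> r < k - 1 \<Longrightarrow> p ! x < p ! i r \<and> p ! y < p ! i r"
      "p ! i (k - 1) < p ! i (k - 2)" by blast
    have lt: "p ! i r < p ! i s" if "r < s" "s < k - 1" for r s
    proof -
      consider "r = 0" "s = 1" | "r = 0" "2 \<le> s" | "r = 1" "2 \<le> s" | "2 \<le> r" "2 \<le> s"
        using \<open>r < s\<close> by linarith
      then show ?thesis
        using that i xy(3) i(3)[unfolded One_nat_def] by cases auto
    qed
    have "p ! i r < p ! i s \<longleftrightarrow> [1..<k] ! r < [1..<k] ! s" if "r < k - 1" "s < k - 1" for r s
      using lt[of r s] lt[of s r] that by (cases r s rule: linorder_cases) auto
    then show "\<exists>i. occurs_at i k p \<and>
        (\<forall>r<k-1. \<forall>s<k-1. p ! i r < p ! i s \<longleftrightarrow> [1..<k] ! r < [1..<k] ! s) \<and>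
        p ! i (k - 1) < p ! i (k - 2)"
      using i by blast
  qed
  finally show ?thesis .
qed

text \<open>For a 21 the corner combines the position of the second letter with the value of the
  first, hence \<open>(y, p ! x)\<close>.\<close>

lemma contains_B_patterns_iff:
  assumes k: "k \<ge> 4" and p: "distinct p"
  shows "(\<exists>q\<in>B_patterns k. contains_pattern p q) \<longleftrightarrow>
    (\<exists>x y. x < y \<and> y < length p \<and> p ! y < p ! x \<and> board k p y (p ! x))"
proof -
  let ?b = "2 # 1 # [3..<k]"
  have bb: "?b ! r < ?b ! s \<longleftrightarrow> (r = 1 \<and> s = 0) \<or> (r < s \<and> 2 \<le> s)" if "r < k - 1" "s < k - 1" for r s
    unfolding nth_B_base[OF k that(1)] nth_B_base[OF k that(2)] by auto
  have "(\<exists>q\<in>B_patterns k. contains_pattern p q) \<longleftrightarrow>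
    (\<exists>i. occurs_at i k p \<and> (\<forall>r<k-1. \<forall>s<k-1. p ! i r < p ! i s \<longleftrightarrow> ?b ! r < ?b ! s) \<and>
       p ! i (k - 1) < p ! i (k - 2))"
    unfolding B_patterns_eq
  proof (rule contains_patterns_over[OF p])
    fix r assume "r < k - 2"
    then show "?b ! r < ?b ! (k - 2)" using bb[of r "k - 2"] k by simp
  qed (use k in auto)
  also have "\<dots> \<longleftrightarrow> (\<exists>x y. x < y \<and> y < length p \<and> p ! y < p ! x \<and> board k p y (p ! x))"
  proof (intro iffI; elim exE conjE)
    fix i assume i: "occurs_at i k p"
      and pi: "\<forall>r<k-1. \<forall>s<k-1. p ! i r < p ! i s \<longleftrightarrow> ?b ! r < ?b ! s"
      and l: "p ! i (k - 1) < p ! i (k - 2)"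
    have pi': "p ! i r < p ! i s \<longleftrightarrow> (r = 1 \<and> s = 0) \<or> (r < s \<and> 2 \<le> s)"
      if "r < k - 1" "s < k - 1" for r s
      using pi bb that by blast
    have 2: "p ! i 1 < p ! i 0" "p ! i 0 < p ! i 2" "p ! i 1 < p ! i 2"
      using pi'[of 1 0] pi'[of 0 2] pi'[of 1 2] k by auto
    have *: "p ! i r < p ! i s" if "2 \<le> r" "r < s" "s < k - 1" for r s
      using pi' that by auto
    from 2 board_of_occurrence[OF k i * l]
    show "\<exists>x y. x < y \<and> y < length p \<and> p ! y < p ! x \<and> board k p y (p ! x)"
      by (intro exI[of _ "i 0"] exI[of _ "i 1"]) (auto simp: max_def split: if_splits)
  next
    fix x y assume xy: "x < y" "y < length p" "p ! y < p ! x" "board k p y (p ! x)"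
    then have "board k p y (max (p ! x) (p ! y))" by (simp add: max_def)
    from boardE[OF k this xy(1,2)] obtain i where i: "occurs_at i k p" "i 0 = x" "i 1 = y"
      "\<And>r s. 2 \<le> r \<Longrightarrow> r < s \<Longrightarrow> s < k - 1 \<Longrightarrow> p ! i r < p ! i s"
      "\<And>r. 2 \<le> r \<Longrightarrow> r < k - 1 \<Longrightarrow> p ! x < p ! i r \<and> p ! y < p ! i r"
      "p ! i (k - 1) < p ! i (k - 2)" by blast
    define L where "L r s \<longleftrightarrow> (r = 1 \<and> s = 0) \<or> (r < s \<and> 2 \<le> s)" for r s :: nat
    have lt: "p ! i r < p ! i s" if "L r s" "r < k - 1" "s < k - 1" for r s
    proof -
      consider "r = 1" "s = 0" | "r = 0" "2 \<le> s" | "r = 1" "2 \<le> s" | "r < s" "2 \<le> r" "2 \<le> s"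
        using \<open>L r s\<close> unfolding L_def by linarith
      then show ?thesis
        using that i xy(3) i(3)[unfolded One_nat_def] by cases auto
    qed
    have tot: "L r s \<or> L s r \<or> r = s" for r s unfolding L_def by auto
    have "p ! i r < p ! i s \<longleftrightarrow> ?b ! r < ?b ! s" if "r < k - 1" "s < k - 1" for r s
      unfolding bb[OF that] L_def[symmetric]
      using lt[of r s] lt[of s r] that tot[of r s] by auto
    then show "\<exists>i. occurs_at i k p \<and>
        (\<forall>r<k-1. \<forall>s<k-1. p ! i r < p ! i s \<longleftrightarrow> ?b ! r < ?b ! s) \<and>
        p ! i (k - 1) < p ! i (k - 2)"
      using i by blast
  qed
  finally show ?thesis .
qed

text \<open>If the first letter of a completion is on the board, its own completion also completes
  \<open>(a, v)\<close> and starts further right. Moving right in this way must stop.\<close>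

lemma board_outsideE:
  assumes "board k p a v" and k: "k \<ge> 4"
  obtains c where "\<And>r s. 2 \<le> r \<Longrightarrow> r < s \<Longrightarrow> s < k \<Longrightarrow> c r < c s"
    "\<And>r. 2 \<le> r \<Longrightarrow> r < k \<Longrightarrow> c r < length p" "a < c 2" "v < p ! c 2"
    "\<And>r s. 2 \<le> r \<Longrightarrow> r < s \<Longrightarrow> s < k - 1 \<Longrightarrow> p ! c r < p ! c s"
    "p ! c (k - 1) < p ! c (k - 2)" "\<not> board k p (c 2) (p ! c 2)"
proof -
  define W where "W a v c \<longleftrightarrow> (\<forall>r s. 2 \<le> r \<longrightarrow> r < s \<longrightarrow> s < k \<longrightarrow> c r < c s) \<and>
     (\<forall>r. 2 \<le> r \<longrightarrow> r < k \<longrightarrow> c r < length p) \<and> a < c 2 \<and> v < p ! c 2 \<and>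
     (\<forall>r s. 2 \<le> r \<longrightarrow> r < s \<longrightarrow> s < k - 1 \<longrightarrow> p ! c r < p ! c s) \<and>
     p ! c (k - 1) < p ! c (k - 2)" for a v and c :: "nat \<Rightarrow> nat"
  have board_W: "board k p a v \<longleftrightarrow> (\<exists>c. W a v c)" for a v
    by (simp add: board_def W_def)
  have "\<exists>c. W a v c \<and> \<not> board k p (c 2) (p ! c 2)" if "W a v c" for c
    using that
  proof (induction "length p - c 2" arbitrary: c rule: less_induct)
    case less
    show ?case
    proof (cases "board k p (c 2) (p ! c 2)")
      case True
      then obtain c' where c': "W (c 2) (p ! c 2) c'" using board_W by blast
      have "W a v c'"
        using c' less.prems unfolding W_def by (meson less_trans)
      moreover have "c 2 < c' 2" "c' 2 < length p" using c' k unfolding W_def by auto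
      ultimately show ?thesis using less.hyps[of c'] by (simp add: diff_less_mono2)
    qed (use less.prems in blast)
  qed
  then obtain c where c: "W a v c" "\<not> board k p (c 2) (p ! c 2)"
    using assms(1) board_W by blast
  show thesis by (rule that[of c]) (use c in \<open>auto simp: W_def\<close>)
qed

abbreviation swap_nth :: "nat \<Rightarrow> nat \<Rightarrow> 'a list \<Rightarrow> 'a list" where
  "swap_nth i j p \<equiv> p[i := p ! j, j := p ! i]"

text \<open>A completion that starts off the board stays off it up to its last letter but one, while
  \<open>i\<close> and \<open>j\<close> lie under the corner. So the exchange can touch only the
  final letter.\<close>

lemma board_swap_imp:
  assumes k: "k \<ge> 4" and ij: "i < j" "j < length p"
    and corner: "board k p j (max (p ! i) (p ! j))" and b: "board k p a v"
  shows "board k (swap_nth i j p) a v"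
proof -
  let ?p = "swap_nth i j p"
  let ?M = "max (p ! i) (p ! j)"
  from board_outsideE[OF b k] obtain c where
    c: "\<And>r s. 2 \<le> r \<Longrightarrow> r < s \<Longrightarrow> s < k \<Longrightarrow> c r < c s"
    "\<And>r. 2 \<le> r \<Longrightarrow> r < k \<Longrightarrow> c r < length p" "a < c 2" "v < p ! c 2"
    "\<And>r s. 2 \<le> r \<Longrightarrow> r < s \<Longrightarrow> s < k - 1 \<Longrightarrow> p ! c r < p ! c s"
    "p ! c (k - 1) < p ! c (k - 2)" "\<not> board k p (c 2) (p ! c 2)" by blast
  have out: "\<not> board k p (c r) (p ! c r)" if "2 \<le> r" "r < k - 1" for r
  proof (cases "r = 2")
    case False
    then have "c 2 < c r" "p ! c 2 < p ! c r" using c(1)[of 2 r] c(5)[of 2 r] that by auto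
    then show ?thesis using c(7) board_mono[of k p "c r" "p ! c r" "c 2" "p ! c 2"] by auto
  qed (use c in simp)
  have far: "\<not> (c r \<le> j \<and> p ! c r \<le> ?M)" if "2 \<le> r" "r < k - 1" for r
    using out[OF that] board_mono[OF corner] by blast
  have ne: "c r \<noteq> i \<and> c r \<noteq> j" if "2 \<le> r" "r < k - 1" for r
    using far[OF that] ij by auto
  have same: "?p ! c r = p ! c r" if "2 \<le> r" "r < k - 1" for r
    using ne[OF that] by simp
  \<comment> \<open>If the final letter sits at \<open>i\<close> or \<open>j\<close>, then
    \<open>c (k - 2)\<close> is at most \<open>j\<close> and yet off the board, so its value exceeds
    both exchanged values and the descent survives.\<close>
  have last: "?p ! c (k - 1) < p ! c (k - 2)"
  proof (cases "c (k - 1) = i \<or> c (k - 1) = j")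
    case True
    have "c (k - 2) < c (k - 1)" using c(1)[of "k - 2" "k - 1"] k by simp
    with True ij have "c (k - 2) \<le> j" by auto
    moreover have "2 \<le> k - 2" "k - 2 < k - 1" using k by auto
    ultimately have "?M < p ! c (k - 2)" using far[of "k - 2"] by (metis not_le)
    moreover have "?p ! c (k - 1) \<le> ?M" using True ij by (auto simp: nth_list_update)
    ultimately show ?thesis by (metis le_less_trans)
  qed (use c(6) in simp)
  show ?thesis
    unfolding board_def
    using c(1-5) last same k by (intro exI[of _ c]) auto
qed

lemma swap_nth_swap_nth: "i < length p \<Longrightarrow> j < length p \<Longrightarrow> swap_nth i j (swap_nth i j p) = p"
  by (rule nth_equalityI) (auto simp: nth_list_update)

text \<open>The exchange is an involution and keeps the corner on the board, so the one-sided
  implication also gives the converse.\<close>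

lemma board_swap:
  assumes k: "k \<ge> 4" and ij: "i < j" "j < length p"
    and corner: "board k p j (max (p ! i) (p ! j))"
  shows "board k (swap_nth i j p) = board k p"
proof (intro ext iffI)
  fix a v
  have "board k (swap_nth i j p) j (max (p ! i) (p ! j))"
    by (rule board_swap_imp[OF assms corner])
  then have c': "board k (swap_nth i j p) j (max (swap_nth i j p ! i) (swap_nth i j p ! j))"
    using ij by (simp add: nth_list_update max.commute)
  assume "board k (swap_nth i j p) a v"
  from board_swap_imp[OF k ij(1) _ c' this] ij
  have "board k (swap_nth i j (swap_nth i j p)) a v" by simp
  then show "board k p a v" using ij by (subst (asm) swap_nth_swap_nth) auto
qed (use board_swap_imp[OF assms] in blast)

section \<open>Classes of permutations with a common board\<close>

definition same_board :: "nat \<Rightarrow> nat list \<Rightarrow> nat list \<Rightarrow> bool" where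
  "same_board k p p' \<longleftrightarrow> board k p = board k p' \<and>
     (\<forall>i<length p. p ! i = p' ! i \<or> (board k p i (p ! i) \<and> board k p i (p' ! i)))"

lemma same_board_refl: "same_board k p p"
  by (simp add: same_board_def)

lemma same_board_trans:
  "length p = length q \<Longrightarrow> same_board k p q \<Longrightarrow> same_board k q r \<Longrightarrow> same_board k p r"
  unfolding same_board_def by metis

lemma same_board_sym: "length p = length q \<Longrightarrow> same_board k p q \<Longrightarrow> same_board k q p"
  unfolding same_board_def by metis

lemma same_board_swap:
  assumes k: "k \<ge> 4" and ij: "i < j" "j < length p"
    and corner: "board k p j (max (p ! i) (p ! j))"
  shows "same_board k p (swap_nth i j p)"
proof -
  have "board k p i (p ! i)" "board k p j (p ! j)" "board k p i (p ! j)" "board k p j (p ! i)"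
    using ij by (auto intro!: board_mono[OF corner])
  then show ?thesis
    unfolding same_board_def board_swap[OF assms] using ij by (auto simp: nth_list_update)
qed

text \<open>
  Uniqueness is decided at the rightmost position where two members of a class differ: there one of
  them has a 12 and the other a 21 with the same upper right corner.
\<close>

lemma same_board_differ:
  assumes p: "p \<in> permutations_of_set {1..n}" and q: "q \<in> permutations_of_set {1..n}"
    and pq: "same_board k p q" "p \<noteq> q"
  shows "(\<exists>x y. x < y \<and> y < n \<and> p ! y < p ! x \<and> board k p y (p ! x) \<and>
            (\<exists>z<y. q ! z < q ! y \<and> board k q y (q ! y))) \<or>
         (\<exists>x y. x < y \<and> y < n \<and> q ! y < q ! x \<and> board k q y (q ! x) \<and>
            (\<exists>z<y. p ! z < p ! y \<and> board k p y (p ! y)))"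
proof -
  have l: "length p = n" "length q = n" "distinct p" "distinct q" "set p = {1..n}" "set q = {1..n}"
    using p q by (auto simp: permutations_of_set_def distinct_card[symmetric])
  define D where "D = {i. i < n \<and> p ! i \<noteq> q ! i}"
  have "D \<noteq> {}" using l pq nth_equalityI[of p q] by (auto simp: D_def)
  moreover have "finite D" by (auto simp: D_def)
  ultimately obtain y where y: "y \<in> D" "\<And>i. i \<in> D \<Longrightarrow> i \<le> y"
    using Max_in Max_ge by blast
  have agree: "p ! i = q ! i" if "y < i" "i < n" for i
    using y(2)[of i] that by (force simp: D_def)
  have bd: "board k p = board k q" using pq by (simp add: same_board_def)
  have in_board: "board k p y (p ! y)" "board k p y (q ! y)" and yn: "y < n" and ne: "p ! y \<noteq> q ! y"
    using pq y(1) l by (auto simp: same_board_def D_def)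
  \<comment> \<open>To the right of \<open>y\<close> the lists agree, so the letter that one of them
    has at \<open>y\<close> must occur further left in the other.\<close>
  have *: "\<exists>x<y. r ! x = s ! y"
    if rs: "length r = n" "length s = n" "distinct s" "set r = set s" "r ! y \<noteq> s ! y"
      "\<And>i. y < i \<Longrightarrow> i < n \<Longrightarrow> r ! i = s ! i"
    for r s :: "nat list"
  proof -
    have "s ! y \<in> set r" using rs yn by auto
    then obtain x where x: "x < n" "r ! x = s ! y" using rs(1) in_set_conv_nth[of "s ! y" r] by auto
    have "x \<noteq> y" using x rs by auto
    moreover have "\<not> y < x" using x rs yn nth_eq_iff_index_eq[of s x y] by auto
    ultimately show ?thesis using x by (intro exI[of _ x]) auto
  qed
  obtain x z where "x < y" "p ! x = q ! y" "z < y" "q ! z = p ! y"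
    using *[of p q] *[of q p] l ne agree by metis
  \<comment> \<open>If \<open>p ! y < q ! y\<close>, then \<open>p\<close> has a 21 and
    \<open>q\<close> a 12 ending at \<open>y\<close>, both with corner \<open>(y, q ! y)\<close>;
    otherwise the roles are exchanged.\<close>
  then show ?thesis using ne in_board bd yn by (metis linorder_neqE_nat)
qed

lemma card_eq_of_ex1:
  assumes "finite A" "finite B" "\<And>a. a \<in> A \<Longrightarrow> \<exists>!b. b \<in> B \<and> R a b" "\<And>b. b \<in> B \<Longrightarrow> \<exists>!a. a \<in> A \<and> R a b"
  shows "card A = card B"
proof (rule bij_betw_same_card)
  show "bij_betw (\<lambda>a. THE b. b \<in> B \<and> R a b) A B"
    by (rule bij_betw_byWitness[where f' = "\<lambda>b. THE a. a \<in> A \<and> R a b"])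
      (use assms theI'[OF assms(3)] theI'[OF assms(4)] the1_equality[OF assms(3)]
        the1_equality[OF assms(4)] in \<open>auto simp: image_subset_iff\<close>)
qed

text \<open>A potential for exchanges inside a class: by rearrangement, removing an ascent lowers it
  and removing a descent raises it, so its extremal members are the representatives sought.\<close>

lemma sum_nth_swap_less:
  fixes p :: "nat list"
  assumes "i < j" "j < length p" "p ! i < p ! j"
  shows "(\<Sum>r<length p. r * swap_nth i j p ! r) < (\<Sum>r<length p. r * p ! r)"
proof -
  let ?R = "{..<length p} - {i, j}"
  have split: "{..<length p} = insert i (insert j ?R)" using assms by auto
  have "(\<Sum>r\<in>?R. r * swap_nth i j p ! r) = (\<Sum>r\<in>?R. r * p ! r)" by (rule sum.cong) auto
  moreover have "i * p ! j + j * p ! i < i * p ! i + j * p ! j"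
  proof -
    obtain e f where "j = i + Suc e" "p ! j = p ! i + Suc f"
      using assms by (metis less_imp_Suc_add add_Suc_right)
    then show ?thesis by (simp add: algebra_simps)
  qed
  ultimately show ?thesis
    using assms by (subst (1 2) split) (simp add: nth_list_update)
qed

lemma swap_permutation:
  "p \<in> permutations_of_set A \<Longrightarrow> i < length p \<Longrightarrow> j < length p \<Longrightarrow> swap_nth i j p \<in> permutations_of_set A"
  by (auto simp: permutations_of_set_def distinct_swap set_swap)

lemma Av_A_Av_B_card:
  assumes k: "k \<ge> 4"
  shows "card (Av n (A_patterns k)) = card (Av n (B_patterns k))"
proof -
  let ?P = "permutations_of_set {1..n}"
  define up where "up p \<longleftrightarrow> (\<exists>x y. x < y \<and> y < n \<and> p ! x < p ! y \<and> board k p y (p ! y))" for p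
  define dn where "dn p \<longleftrightarrow> (\<exists>x y. x < y \<and> y < n \<and> p ! y < p ! x \<and> board k p y (p ! x))" for p
  have P: "length p = n" "distinct p" if "p \<in> ?P" for p
    using that by (auto simp: permutations_of_set_def distinct_card[symmetric])
  have "(\<exists>q\<in>A_patterns k. contains_pattern p q) \<longleftrightarrow> up p" if "p \<in> ?P" for p
    using contains_A_patterns_iff[OF k P(2)[OF that]] P(1)[OF that] by (simp add: up_def)
  then have A: "Av n (A_patterns k) = {p \<in> ?P. \<not> up p}" unfolding Av_def by blast
  have "(\<exists>q\<in>B_patterns k. contains_pattern p q) \<longleftrightarrow> dn p" if "p \<in> ?P" for p
    using contains_B_patterns_iff[OF k P(2)[OF that]] P(1)[OF that] by (simp add: dn_def)
  then have B: "Av n (B_patterns k) = {p \<in> ?P. \<not> dn p}" unfolding Av_def by blast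
  have uniq: "p = q" if "p \<in> ?P" "q \<in> ?P" "same_board k p q" "\<not> up p \<and> \<not> up q \<or> \<not> dn p \<and> \<not> dn q" for p q
    using same_board_differ[OF that(1-3)] that(4) unfolding up_def dn_def by blast
  define C where "C p = {q \<in> ?P. same_board k p q}" for p
  define w where "w p = (\<Sum>r<n. r * p ! r)" for p :: "nat list"
  have fin: "finite (C p)" for p by (simp add: C_def)
  have mem: "p \<in> C p" if "p \<in> ?P" for p using that by (simp add: C_def same_board_refl)
  have closed: "swap_nth i j q \<in> C p"
    if "p \<in> ?P" "q \<in> C p" "i < j" "j < n" "board k q j (max (q ! i) (q ! j))" for p q i j
    using that swap_permutation[of q "{1..n}" i j] same_board_swap[OF k that(3) _ that(5)] P
    unfolding C_def by (auto intro: same_board_trans)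
  \<comment> \<open>A minimiser of \<open>w\<close> on the class: a 12 on the board could be
    exchanged without leaving the class, which would lower \<open>w\<close>.\<close>
  have ex_up: "\<exists>q. q \<in> C p \<and> \<not> up q" if p: "p \<in> ?P" for p
  proof -
    obtain q where q: "q \<in> C p" "\<And>r. r \<in> C p \<Longrightarrow> w q \<le> w r"
      using fin[of p] mem[OF p] by (metis arg_min_if_finite(1,2) empty_iff leI)
    have "\<not> up q"
    proof
      assume "up q"
      then obtain x y where xy: "x < y" "y < n" "q ! x < q ! y" "board k q y (q ! y)"
        by (auto simp: up_def)
      then have "swap_nth x y q \<in> C p" using closed[OF p q(1), of x y] by (simp add: max_def)
      then have "w q \<le> w (swap_nth x y q)" by (rule q(2))
      moreover have "length q = n" using q(1) P by (simp add: C_def)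
      ultimately show False using sum_nth_swap_less[of x y q] xy by (simp add: w_def)
    qed
    then show ?thesis using q by blast
  qed
  \<comment> \<open>Dually a maximiser of \<open>w\<close>; \<open>sum_nth_swap_less\<close> is
    applied to the exchanged list, whose second exchange returns \<open>q\<close>.\<close>
  have ex_dn: "\<exists>q. q \<in> C p \<and> \<not> dn q" if p: "p \<in> ?P" for p
  proof -
    have "Max (w ` C p) \<in> w ` C p" using fin[of p] mem[OF p] by (intro Max_in) auto
    then obtain q where q: "q \<in> C p" "w q = Max (w ` C p)" by (metis imageE)
    have q': "w r \<le> w q" if "r \<in> C p" for r using fin that unfolding q(2) by (intro Max_ge) auto
    have lq: "length q = n" using q(1) P by (simp add: C_def)
    have "\<not> dn q"
    proof
      assume "dn q"
      then obtain x y where xy: "x < y" "y < n" "q ! y < q ! x" "board k q y (q ! x)"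
        by (auto simp: dn_def)
      let ?q = "swap_nth x y q"
      have "?q \<in> C p" using closed[OF p q(1), of x y] xy by (simp add: max_def)
      then have "w ?q \<le> w q" by (rule q')
      moreover have "(\<Sum>r<length ?q. r * swap_nth x y ?q ! r) < (\<Sum>r<length ?q. r * ?q ! r)"
        by (rule sum_nth_swap_less) (use xy lq in \<open>auto simp: nth_list_update\<close>)
      moreover have "swap_nth x y ?q = q" using xy lq by (intro swap_nth_swap_nth) auto
      ultimately show False using lq by (simp add: w_def)
    qed
    then show ?thesis using q by blast
  qed
  have two: "same_board k q r"
    if "p \<in> ?P" "q \<in> ?P" "same_board k p q" "same_board k p r" for p q r
    using that P same_board_sym[of p q k] same_board_trans[of q p k r] by simp
  show ?thesis
    unfolding A B
  proof (rule card_eq_of_ex1[where R = "same_board k"])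
    show "\<exists>!q. q \<in> {p \<in> ?P. \<not> dn p} \<and> same_board k p q" if p: "p \<in> {p \<in> ?P. \<not> up p}" for p
    proof -
      obtain q where q: "q \<in> C p" "\<not> dn q" using ex_dn p by blast
      show ?thesis
      proof (rule ex1I[of _ q])
        show "q \<in> {p \<in> ?P. \<not> dn p} \<and> same_board k p q"
          using p q P by (auto simp: C_def intro: same_board_sym)
        fix r assume "r \<in> {p \<in> ?P. \<not> dn p} \<and> same_board k p r"
        then show "r = q"
          using p q two[of p r q] uniq[of r q] by (simp add: C_def)
      qed
    qed
    show "\<exists>!p. p \<in> {p \<in> ?P. \<not> up p} \<and> same_board k p q" if q: "q \<in> {p \<in> ?P. \<not> dn p}" for q
    proof -
      obtain p where p: "p \<in> C q" "\<not> up p" using ex_up q by blast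
      show ?thesis
      proof (rule ex1I[of _ p])
        show "p \<in> {p \<in> ?P. \<not> up p} \<and> same_board k p q"
          using q p P by (auto simp: C_def intro: same_board_sym)
        fix r assume "r \<in> {p \<in> ?P. \<not> up p} \<and> same_board k r q"
        then show "r = p"
          using q p two[of q r p] uniq[of r p] P same_board_sym[of r q k] by (simp add: C_def)
      qed
    qed
  qed auto
qed

section \<open>Increasing subsequences and the sets A\<close>

definition inc_free :: "nat \<Rightarrow> nat list \<Rightarrow> bool" where
  "inc_free d p \<longleftrightarrow> (\<forall>s. subseq s p \<longrightarrow> sorted_wrt (<) s \<longrightarrow> length s \<le> d)"

lemma subseq_of_indices:
  assumes "strict_mono_on {..<k} i" "\<forall>r<k. i r < length p"
  shows "subseq (map (\<lambda>r. p ! i r) [0..<k]) p"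
proof -
  \<comment> \<open>The induction needs prefixes: letter number \<open>m\<close> sits at position
    \<open>i m\<close>, and the earlier ones lie in \<open>take (i m) p\<close>.\<close>
  have "subseq (map (\<lambda>r. p ! i r) [0..<m]) (take l p)"
    if "m \<le> k" "\<forall>r<m. i r < l" "l \<le> length p" for m l
    using that
  proof (induction m arbitrary: l)
    case (Suc m)
    have "i r < i m" if "r < m" for r
      using assms(1) that Suc.prems by (auto dest: strict_mono_onD[of _ i r m])
    then have "subseq (map (\<lambda>r. p ! i r) [0..<m]) (take (i m) p)"
      using Suc.prems assms(2) by (intro Suc.IH) (auto simp: less_imp_le)
    moreover have "take (Suc (i m)) p = take (i m) p @ [p ! i m]"
      using Suc.prems assms(2) by (intro take_Suc_conv_app_nth) auto
    ultimately have "subseq (map (\<lambda>r. p ! i r) [0..<Suc m]) (take (Suc (i m)) p)"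
      by (simp add: list_emb_append_mono)
    moreover have "prefix (take (Suc (i m)) p) (take l p)"
      using take_is_prefix[of "Suc (i m)" "take l p"] Suc.prems by (simp add: min_absorb1 Suc_le_eq)
    ultimately show ?case by (meson prefix_imp_subseq subseq_order.order_trans)
  qed simp
  from this[of k "length p"] assms show ?thesis by simp
qed

lemma subseq_indicesE:
  assumes "subseq s p"
  obtains i where "strict_mono_on {..<length s} i" "\<forall>r<length s. i r < length p"
    "\<forall>r<length s. s ! r = p ! i r"
proof -
  from assms have "\<exists>i. strict_mono_on {..<length s} i \<and>
      (\<forall>r<length s. i r < length p \<and> s ! r = p ! i r)"
  proof (induction rule: list_emb.induct)
    case (list_emb_Cons xs ys y)
    then obtain i where "strict_mono_on {..<length xs} i"
      "\<forall>r<length xs. i r < length ys \<and> xs ! r = ys ! i r" by blast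
    then show ?case by (intro exI[of _ "Suc \<circ> i"]) (auto simp: strict_mono_on_def)
  next
    case (list_emb_Cons2 x y xs ys)
    then obtain i where "strict_mono_on {..<length xs} i"
      "\<forall>r<length xs. i r < length ys \<and> xs ! r = ys ! i r" by blast
    with \<open>x = y\<close> show ?case
      by (intro exI[of _ "case_nat 0 (Suc \<circ> i)"])
        (auto simp: strict_mono_on_def nth_Cons split: nat.splits)
  qed (auto simp: strict_mono_on_def)
  then show thesis using that by blast
qed

lemma sorted_wrt_subseq:
  assumes "subseq s p" "sorted_wrt P p"
  shows "sorted_wrt P s"
proof -
  from subseq_indicesE[OF assms(1)] obtain i where i: "strict_mono_on {..<length s} i"
    "\<forall>r<length s. i r < length p" "\<forall>r<length s. s ! r = p ! i r" by blast
  have "P (s ! r) (s ! t)" if "r < t" "t < length s" for r t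
    using i assms(2) that strict_mono_onD[OF i(1), of r t]
    by (simp add: sorted_wrt_iff_nth_less)
  then show ?thesis by (simp add: sorted_wrt_iff_nth_less)
qed

text \<open>Together the patterns forbid exactly an increasing subsequence of length
  \<open>k - 1\<close> followed by a letter below its last one. From here on subsequences replace
  index embeddings.\<close>

lemma Av_A_iff:
  assumes k: "k \<ge> 2"
  shows "p \<in> Av n (A_patterns k) \<longleftrightarrow> p \<in> permutations_of_set {1..n} \<and>
    (\<forall>s x. subseq (s @ [x]) p \<longrightarrow> sorted_wrt (<) s \<longrightarrow> length s = k - 1 \<longrightarrow> last s \<le> x)"
proof (cases "p \<in> permutations_of_set {1..n}")
  case True
  then have p: "distinct p" by (auto simp: permutations_of_set_def)
  have "(\<exists>q\<in>A_patterns k. contains_pattern p q) \<longleftrightarrow>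
    (\<exists>i. occurs_at i k p \<and> (\<forall>r<k-1. \<forall>s<k-1. p ! i r < p ! i s \<longleftrightarrow> [1..<k] ! r < [1..<k] ! s) \<and>
       p ! i (k - 1) < p ! i (k - 2))"
    using contains_patterns_over[of p k "[1..<k]"] A_patterns_eq[of k] k p by simp
  also have "\<dots> \<longleftrightarrow>
    (\<exists>s x. subseq (s @ [x]) p \<and> sorted_wrt (<) s \<and> length s = k - 1 \<and> x < last s)"
  proof (intro iffI; elim exE conjE)
    fix i assume i: "occurs_at i k p"
      "\<forall>r<k-1. \<forall>s<k-1. p ! i r < p ! i s \<longleftrightarrow> [1..<k] ! r < [1..<k] ! s"
      "p ! i (k - 1) < p ! i (k - 2)"
    let ?s = "map (\<lambda>r. p ! i r) [0..<k-1]"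
    have "[0..<k] = [0..<k-1] @ [k-1]" using k upt_Suc_append[of 0 "k - 1"] by simp
    then have "?s @ [p ! i (k - 1)] = map (\<lambda>r. p ! i r) [0..<k]" by simp
    then have "subseq (?s @ [p ! i (k - 1)]) p"
      using subseq_of_indices[of k i p] i(1) unfolding occurs_at_def by metis
    moreover have "sorted_wrt (<) ?s" using i(2) by (auto simp: sorted_wrt_iff_nth_less)
    moreover have "last ?s = p ! i (k - 2)"
      using k by (subst last_map) (auto simp: last_upt numeral_2_eq_2)
    ultimately show "\<exists>s x. subseq (s @ [x]) p \<and> sorted_wrt (<) s \<and> length s = k - 1 \<and> x < last s"
      using i(3) by (intro exI[of _ ?s] exI[of _ "p ! i (k - 1)"]) simp
  next
    fix s x assume s: "subseq (s @ [x]) p" "sorted_wrt (<) s" "length s = k - 1" "x < last s"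
    from subseq_indicesE[OF s(1)] obtain i where
      i: "strict_mono_on {..<length (s @ [x])} i" "\<forall>r<length (s @ [x]). i r < length p"
      "\<forall>r<length (s @ [x]). (s @ [x]) ! r = p ! i r" by blast
    have lk: "length (s @ [x]) = k" using s(3) k by simp
    have pi': "p ! i r = (s @ [x]) ! r" if "r < k" for r
      using i(3) lk that by metis
    have pi: "p ! i r = s ! r" if "r < k - 1" for r
      using pi'[of r] that s(3) by (simp add: nth_append)
    have px: "p ! i (k - 1) = x"
      using pi'[of "k - 1"] s(3) k by (simp add: nth_append)
    have lt: "s ! r < s ! t" if "r < t" "t < k - 1" for r t
      using s(2,3) that by (simp add: sorted_wrt_iff_nth_less)
    have "p ! i r < p ! i t \<longleftrightarrow> [1..<k] ! r < [1..<k] ! t" if "r < k - 1" "t < k - 1" for r t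
      using lt[of r t] lt[of t r] that pi by (cases r t rule: linorder_cases) auto
    moreover have "last s = s ! (k - 2)"
      using s(3) k by (subst last_conv_nth) (auto simp: numeral_2_eq_2)
    then have "p ! i (k - 1) < p ! i (k - 2)" using s(4) px pi[of "k - 2"] k by simp
    moreover have "occurs_at i k p" using i(1,2) unfolding lk by (simp add: occurs_at_def)
    ultimately show "\<exists>i. occurs_at i k p \<and>
        (\<forall>r<k-1. \<forall>s<k-1. p ! i r < p ! i s \<longleftrightarrow> [1..<k] ! r < [1..<k] ! s) \<and>
        p ! i (k - 1) < p ! i (k - 2)" by blast
  qed
  finally show ?thesis using True unfolding Av_def not_less[symmetric] by blast
qed (simp add: Av_def)

definition inc_free_words :: "nat \<Rightarrow> nat set \<Rightarrow> nat list set" where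
  "inc_free_words d X = {q. distinct q \<and> set q \<subseteq> X \<and> inc_free d q}"

lemma finite_inc_free_words: "finite X \<Longrightarrow> finite (inc_free_words d X)"
  by (rule finite_subset[OF _ finite_subset_distinct[of X]]) (auto simp: inc_free_words_def)

text \<open>
  After the first letter that ends an increasing subsequence of length \<open>d + 1\<close>, a permutation
  avoiding \<^term>\<open>A_patterns (d + 2)\<close> is increasing.
\<close>

lemma Av_A_le:
  assumes d: "d \<ge> 1"
  shows "card (Av n (A_patterns (d + 2))) \<le> card (inc_free_words d {1..n})"
proof -
  let ?f = "\<lambda>q. q @ sorted_list_of_set ({1..n} - set q)"
  have "Av n (A_patterns (d + 2)) \<subseteq> ?f ` inc_free_words d {1..n}"
  proof
    fix p assume "p \<in> Av n (A_patterns (d + 2))"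
    then have p: "distinct p" "set p = {1..n}"
      and av: "\<And>s x. subseq (s @ [x]) p \<Longrightarrow> sorted_wrt (<) s \<Longrightarrow> length s = d + 1 \<Longrightarrow> last s \<le> x"
      using Av_A_iff[of "d + 2" p n] by (simp_all add: permutations_of_set_def)
    \<comment> \<open>The longest prefix without an increasing subsequence of length
      \<open>d + 1\<close>; the next letter, if any, completes one.\<close>
    define m where "m = Max {m. m \<le> length p \<and> inc_free d (take m p)}"
    have "0 \<in> {m. m \<le> length p \<and> inc_free d (take m p)}"
      by (auto simp: inc_free_def dest: list_emb_length)
    moreover have fin: "finite {m. m \<le> length p \<and> inc_free d (take m p)}" by simp
    ultimately have "m \<in> {m. m \<le> length p \<and> inc_free d (take m p)}"
      unfolding m_def by (intro Max_in) auto
    then have m: "m \<le> length p" "inc_free d (take m p)" by auto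
    have mx: "\<not> inc_free d (take (Suc m) p)" if "m < length p"
      using Max_ge[OF fin, of "Suc m"] that unfolding m_def[symmetric] by auto
    have "sorted_wrt (<) (drop m p)"
    proof (cases "m < length p")
      case True
      have tk: "take (Suc m) p = take m p @ [p ! m]" using True by (rule take_Suc_conv_app_nth)
      from mx[OF True] obtain s where s: "subseq s (take m p @ [p ! m])" "sorted_wrt (<) s" "d < length s"
        unfolding tk inc_free_def by (auto simp: not_le)
      obtain s1 s2 where s12: "s = s1 @ s2" "subseq s1 (take m p)" "subseq s2 [p ! m]"
        using subseq_appendE[OF s(1)] by blast
      have "length s1 \<le> d" using m(2) s12(2) s(2) unfolding inc_free_def s12(1) sorted_wrt_append by blast
      moreover have "length s2 \<le> 1" using s12(3) list_emb_length by fastforce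
      ultimately have l: "length s1 = d" "length s2 = 1" using s(3) s12(1) by auto
      then have s2: "s2 = [p ! m]" using subseq_same_length[OF s12(3)] by simp
      have inc: "\<forall>y\<in>set s1. y < p ! m" "sorted_wrt (<) s1"
        using s(2) by (auto simp: s12(1) s2 sorted_wrt_append)
      have pd: "p = take m p @ p ! m # drop (Suc m) p" using True by (simp add: Cons_nth_drop_Suc)
      have sub: "subseq (s1 @ p ! m # t) p" if "subseq t (drop (Suc m) p)" for t
        using list_emb_append_mono[OF s12(2), of "p ! m # t" "p ! m # drop (Suc m) p"] that pd by auto
      \<comment> \<open>\<open>s1\<close> followed by \<open>p ! m\<close> is increasing of length
        \<open>d + 1\<close>, so avoidance keeps every later letter above
        \<open>p ! m\<close>.\<close>
      have gt: "p ! m < y" if "y \<in> set (drop (Suc m) p)" for y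
      proof -
        have "p ! m \<le> y"
          using av[of "s1 @ [p ! m]" y] sub[of "[y]"] inc l that
          by (auto simp: subseq_singleton_left sorted_wrt_append)
        moreover have "p ! m \<notin> set (drop (Suc m) p)"
          using p(1) pd distinct_append[of "take m p" "p ! m # drop (Suc m) p"] by simp
        then have "y \<noteq> p ! m" using that by blast
        ultimately show ?thesis by simp
      qed
      have "sorted_wrt (<) (drop (Suc m) p)"
        unfolding sorted_wrt_iff_nth_less
      proof (intro allI impI)
        fix i j assume ij: "i < j" "j < length (drop (Suc m) p)"
        let ?t = "drop (Suc m) p"
        \<comment> \<open>To compare two later letters, the first letter \<open>a\<close> of
          \<open>s1\<close> is dropped and \<open>?t ! i\<close> is appended, which restores the
          length \<open>d + 1\<close>; this uses \<open>d \<ge> 1\<close>.\<close>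
        obtain a s1' where s1: "s1 = a # s1'" using l(1) d by (cases s1) auto
        have "?t = take j ?t @ ?t ! j # drop (Suc j) ?t" using ij by (intro id_take_nth_drop)
        moreover have "?t ! i \<in> set (take j ?t)" using ij by (auto simp: in_set_conv_nth intro!: exI[of _ i])
        ultimately have "subseq ([?t ! i] @ [?t ! j]) ?t"
          using list_emb_append_mono[of "(=)" "[?t ! i]" "take j ?t" "[?t ! j]" "?t ! j # drop (Suc j) ?t"]
          by (simp add: subseq_singleton_left)
        then have "subseq (s1 @ p ! m # [?t ! i, ?t ! j]) p" by (intro sub) simp
        then have "subseq ((s1' @ [p ! m, ?t ! i]) @ [?t ! j]) p"
          unfolding s1 by (auto dest: subseq_Cons')
        moreover have "?t ! i \<in> set ?t" using ij by (intro nth_mem) simp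
        then have "p ! m < ?t ! i" by (rule gt)
        moreover from this have "sorted_wrt (<) (s1' @ [p ! m, ?t ! i])"
          using inc unfolding s1 by (force simp: sorted_wrt_append)
        moreover have "length (s1' @ [p ! m, ?t ! i]) = d + 1" using l(1) s1 by simp
        ultimately have "?t ! i \<le> ?t ! j" using av[of "s1' @ [p ! m, ?t ! i]" "?t ! j"] by simp
        moreover have "?t ! i \<noteq> ?t ! j" using p(1) ij by (simp add: nth_eq_iff_index_eq)
        ultimately show "?t ! i < ?t ! j" by simp
      qed
      moreover have "drop m p = p ! m # drop (Suc m) p" using True by (simp add: Cons_nth_drop_Suc)
      ultimately show ?thesis using gt by simp
    qed simp
    moreover have "set (drop m p) = {1..n} - set (take m p)"
    proof -
      have "set p = set (take m p) \<union> set (drop m p)" by (metis append_take_drop_id set_append)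
      moreover have "set (take m p) \<inter> set (drop m p) = {}"
        using p(1) distinct_append[of "take m p" "drop m p"] by simp
      ultimately show ?thesis using p(2) by blast
    qed
    ultimately have "sorted_list_of_set ({1..n} - set (take m p)) = drop m p"
      by (metis sorted_list_of_set.idem_if_sorted_distinct strict_sorted_iff)
    then have "p = ?f (take m p)" by simp
    moreover have "take m p \<in> inc_free_words d {1..n}"
      using m(2) p set_take_subset[of m p] by (auto simp: inc_free_words_def)
    ultimately show "p \<in> ?f ` inc_free_words d {1..n}" by blast
  qed
  then show ?thesis
    by (rule order_trans[OF card_mono card_image_le, rotated])
      (auto intro: finite_inc_free_words)
qed

text \<open>The word is continued by 1, ..., \<open>d\<close> and then by its missing letters, all
  in increasing order. An increasing subsequence of length \<open>d + 1\<close> does not fit into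
  the word, so it ends in this tail, where every later letter is larger.\<close>

lemma Av_A_ge:
  assumes d: "d \<ge> 1" "d \<le> n"
  shows "card (inc_free_words d {d+1..n}) \<le> card (Av n (A_patterns (d + 2)))"
proof (rule card_inj_on_le)
  let ?t = "\<lambda>r. [1..<d+1] @ sorted_list_of_set ({d+1..n} - set r)"
  let ?f = "\<lambda>r. r @ ?t r"
  show "finite (Av n (A_patterns (d + 2)))" by (simp add: Av_def)
  show "inj_on ?f (inc_free_words d {d+1..n})"
  proof (rule inj_onI)
    fix r r' assume r: "r \<in> inc_free_words d {d+1..n}" "r' \<in> inc_free_words d {d+1..n}" "?f r = ?f r'"
    \<comment> \<open>The letter 1 is outside \<open>{d+1..n}\<close>, so it marks where
      \<open>r\<close> ends.\<close>
    have "takeWhile (\<lambda>x. x \<noteq> 1) (?f r) = r" if "r \<in> inc_free_words d {d+1..n}" for r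
    proof -
      have "\<forall>x\<in>set r. x \<noteq> 1" using that d unfolding inc_free_words_def by fastforce
      moreover have "[1..<d+1] = 1 # [2..<d+1]" using d by (simp add: upt_conv_Cons numeral_2_eq_2)
      ultimately show ?thesis by (simp add: takeWhile_append2)
    qed
    note tw = this
    have "r = takeWhile (\<lambda>x. x \<noteq> 1) (?f r)" by (rule tw[OF r(1), symmetric])
    also have "\<dots> = takeWhile (\<lambda>x. x \<noteq> 1) (?f r')" by (simp only: r(3))
    also have "\<dots> = r'" by (rule tw[OF r(2)])
    finally show "r = r'" .
  qed
  show "?f ` inc_free_words d {d+1..n} \<subseteq> Av n (A_patterns (d + 2))"
  proof clarify
    fix r assume "r \<in> inc_free_words d {d+1..n}"
    then have r: "distinct r" "set r \<subseteq> {d+1..n}" "inc_free d r" by (auto simp: inc_free_words_def)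
    have st: "sorted_wrt (<) (?t r)"
      by (auto simp: sorted_wrt_append)
    have set_t: "set (?t r) = {1..d} \<union> ({d+1..n} - set r)" by auto
    have "distinct (?t r)" using st by (simp only: strict_sorted_iff)
    moreover have "set r \<inter> set (?t r) = {}" unfolding set_t using r(2) by auto
    ultimately have "distinct (?f r)" using r(1) by (simp only: distinct_append)
    moreover have "set (?f r) = {1..n}" unfolding set_append[of r] set_t using r(2) d by auto
    moreover have "last s \<le> x"
      if s: "subseq (s @ [x]) (r @ ?t r)" "sorted_wrt (<) s" "length s = d + 1" for s x
    proof (rule ccontr)
      assume x: "\<not> last s \<le> x"
      obtain u v where uv: "s @ [x] = u @ v" "subseq u r" "subseq v (?t r)"
        using subseq_appendE[OF s(1)] by blast
      have "\<not> subseq s r" using r(3) s(2,3) unfolding inc_free_def by force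
      then have "v \<noteq> []"
        using uv subseq_rev_drop_many[of s s "[x]"] subseq_order.order_trans[of s "s @ [x]" r] by auto
      then obtain v' where v: "v = v' @ [x]" "s = u @ v'"
        using uv(1) by (cases v rule: rev_cases) auto
      have "v' \<noteq> []" using \<open>\<not> subseq s r\<close> uv(2) v by auto
      have "sorted_wrt (<) v" using uv(3) st by (rule sorted_wrt_subseq)
      then have "last v' < x" using \<open>v' \<noteq> []\<close> v by (simp add: sorted_wrt_append)
      then show False using x \<open>v' \<noteq> []\<close> v by simp
    qed
    ultimately show "r @ ?t r \<in> Av n (A_patterns (d + 2))"
      using Av_A_iff[of "d + 2" "?f r" n] unfolding permutations_of_set_def by fastforce
  qed
qed

section \<open>Reflection over roots of unity\<close>

text \<open>
  The state of a partially read word: \<open>g z\<close> is the length of the longest increasing subsequence read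
  so far that the letter \<open>z\<close> can extend. Reading \<open>y\<close> turns \<open>g\<close> into \<open>bump g y\<close>.
\<close>

definition good :: "nat \<Rightarrow> (nat \<Rightarrow> nat) \<Rightarrow> nat list \<Rightarrow> bool" where
  "good d g p \<longleftrightarrow> (\<forall>s. subseq s p \<longrightarrow> s \<noteq> [] \<longrightarrow> sorted_wrt (<) s \<longrightarrow> g (hd s) + length s \<le> d)"

definition bump :: "(nat \<Rightarrow> nat) \<Rightarrow> nat \<Rightarrow> nat \<Rightarrow> nat" where
  "bump g y = (\<lambda>z. if y < z \<and> g z = g y then Suc (g y) else g z)"

lemma mono_bump: "mono g \<Longrightarrow> mono (bump g y)"
proof (rule monoI)
  fix z z' :: nat
  assume "mono g" "z \<le> z'"
  then have "g z \<le> g z'" by (rule monoD)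
  then show "bump g y z \<le> bump g y z'" using \<open>z \<le> z'\<close> by (auto simp: bump_def)
qed

text \<open>For \<open>z > y\<close> monotonicity gives \<open>g y \<le> g z\<close>, so
  \<open>bump g y z\<close> is the maximum of \<open>g z\<close> and \<open>g y + 1\<close>: the
  better of ignoring \<open>y\<close> and of placing \<open>y\<close> directly before
  \<open>z\<close>.\<close>

lemma good_Cons:
  assumes g: "mono g"
  shows "good d g (y # p) \<longleftrightarrow> g y < d \<and> good d (bump g y) p"
proof (intro iffI conjI)
  assume G: "good d g (y # p)"
  show "g y < d"
    using G[unfolded good_def, rule_format, of "[y]"] by (simp add: subseq_singleton_left)
  show "good d (bump g y) p"
    unfolding good_def
  proof (intro allI impI)
    fix s assume s: "subseq s p" "s \<noteq> []" "sorted_wrt (<) s"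
    show "bump g y (hd s) + length s \<le> d"
    proof (cases "y < hd s \<and> g (hd s) = g y")
      case True
      then have "sorted_wrt (<) (y # s)" using s(2,3) by (cases s) auto
      then show ?thesis
        using G[unfolded good_def, rule_format, of "y # s"] s True by (simp add: bump_def)
    next
      case False
      have "g (hd s) + length s \<le> d"
        using G[unfolded good_def, rule_format, of s] s list_emb_Cons[OF s(1)] by simp
      then show ?thesis using False by (auto simp: bump_def)
    qed
  qed
next
  assume A: "g y < d \<and> good d (bump g y) p"
  show "good d g (y # p)"
    unfolding good_def
  proof (intro allI impI)
    fix s assume s: "subseq s (y # p)" "s \<noteq> []" "sorted_wrt (<) s"
    show "g (hd s) + length s \<le> d"
    proof (cases "subseq s p")
      case True
      then have "bump g y (hd s) + length s \<le> d" using A s unfolding good_def by blast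
      then show ?thesis by (simp add: bump_def split: if_splits)
    next
      case False
      with s obtain t where t: "s = y # t" "subseq t p"
        by (cases s) (auto split: if_splits)
      show ?thesis
      proof (cases t)
        case (Cons z t')
        have "good d (bump g y) p" "sorted_wrt (<) t" using A s(3) t(1) by simp_all
        then have "bump g y z + length t \<le> d" using t(2) Cons unfolding good_def by fastforce
        moreover have "y < z" using s(3) t(1) Cons by simp
        moreover from this have "g y \<le> g z" using g by (simp add: mono_def)
        ultimately show ?thesis using t(1) by (auto simp: bump_def split: if_splits)
      qed (use A t in simp)
    qed
  qed
qed

lemma card_good_permutations_rec:
  assumes g: "mono g" and R: "finite R" "R \<noteq> {}"
  shows "card {p \<in> permutations_of_set R. good d g p} =
    (\<Sum>y | y \<in> R \<and> g y < d. card {p \<in> permutations_of_set (R - {y}). good d (bump g y) p})"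
proof -
  let ?A = "\<lambda>y. (#) y ` {p \<in> permutations_of_set (R - {y}). good d (bump g y) p}"
  have "{p \<in> permutations_of_set R. good d g p} = (\<Union>y\<in>{y \<in> R. g y < d}. ?A y)"
    unfolding permutations_of_set_nonempty[OF R(2)] by (auto simp: good_Cons[OF g])
  then have "card {p \<in> permutations_of_set R. good d g p} = card (\<Union>y\<in>{y \<in> R. g y < d}. ?A y)"
    by (rule arg_cong)
  also have "\<dots> = (\<Sum>y | y \<in> R \<and> g y < d. card (?A y))"
    using R by (intro card_UN_disjoint) auto
  also have "\<dots> = (\<Sum>y | y \<in> R \<and> g y < d. card {p \<in> permutations_of_set (R - {y}). good d (bump g y) p})"
    by (intro sum.cong refl card_image) auto
  finally show ?thesis .
qed

section \<open>Averages over the N-th roots of unity\<close>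

definition unity_roots :: "nat \<Rightarrow> complex set" where
  "unity_roots N = {z. z ^ N = 1}"

definition unity_words :: "nat \<Rightarrow> nat \<Rightarrow> complex list set" where
  "unity_words N d = {w. set w \<subseteq> unity_roots N \<and> length w = d}"

lemma finite_unity_roots: "N > 0 \<Longrightarrow> finite (unity_roots N)"
  unfolding unity_roots_def by (rule finite_roots_unity) simp

lemma card_unity_roots: "N > 0 \<Longrightarrow> card (unity_roots N) = N"
  unfolding unity_roots_def by (rule card_roots_unity_eq)

lemma unity_roots_nonzero: "z \<in> unity_roots N \<Longrightarrow> N > 0 \<Longrightarrow> z \<noteq> 0"
  by (auto simp: unity_roots_def zero_power)

lemma finite_unity_words: "N > 0 \<Longrightarrow> finite (unity_words N d)"
  unfolding unity_words_def by (rule finite_lists_length_eq[OF finite_unity_roots])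

lemma unity_words_0: "unity_words N 0 = {[]}"
  by (auto simp: unity_words_def)

lemma sum_unity_words_Suc:
  "(\<Sum>w\<in>unity_words N (Suc d). F w) = (\<Sum>l\<in>unity_words N d. \<Sum>a\<in>unity_roots N. F (a # l))"
proof -
  have "(\<Sum>w\<in>unity_words N (Suc d). F w) =
      (\<Sum>(l, a)\<in>unity_words N d \<times> unity_roots N. F (a # l))"
    by (rule sum.reindex_bij_witness[of _ "\<lambda>(l, a). a # l" "\<lambda>w. (tl w, hd w)"])
      (auto simp: unity_words_def length_Suc_conv)
  then show ?thesis by (simp add: sum.cartesian_product)
qed

text \<open>Multiplication by a root \<open>c\<close> permutes the roots and scales the sum by
  \<open>inverse c ^ i\<close>. Some \<open>c\<close> has \<open>c ^ i \<noteq> 1\<close>, because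
  \<open>z ^ i = 1\<close> has only \<open>i < N\<close> solutions.\<close>

lemma sum_unity_roots_power:
  assumes "0 < i" "i < N"
  shows "(\<Sum>a\<in>unity_roots N. inverse a ^ i) = 0"
proof -
  have N: "N > 0" using assms by simp
  have "\<exists>c\<in>unity_roots N. c ^ i \<noteq> 1"
  proof (rule ccontr)
    assume "\<not> (\<exists>c\<in>unity_roots N. c ^ i \<noteq> 1)"
    then have "unity_roots N \<subseteq> unity_roots i" by (auto simp: unity_roots_def)
    then have "card (unity_roots N) \<le> card (unity_roots i)"
      using assms by (intro card_mono finite_unity_roots)
    then show False using assms by (simp add: card_unity_roots)
  qed
  then obtain c where c: "c \<in> unity_roots N" "c ^ i \<noteq> 1" by blast
  then have c0: "c \<noteq> 0" using unity_roots_nonzero N by blast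
  have "(\<Sum>a\<in>unity_roots N. inverse a ^ i) = (\<Sum>a\<in>unity_roots N. inverse (c * a) ^ i)"
    by (rule sum.reindex_bij_witness[of _ "\<lambda>a. c * a" "\<lambda>a. a / c"])
      (use c c0 in \<open>auto simp: unity_roots_def power_mult_distrib power_divide\<close>)
  also have "\<dots> = inverse c ^ i * (\<Sum>a\<in>unity_roots N. inverse a ^ i)"
    by (simp add: sum_distrib_left power_mult_distrib)
  finally show ?thesis using c(2) by (simp add: power_inverse)
qed

text \<open>Extraction of the constant coefficient, the discrete substitute for a contour
  integral.\<close>

lemma sum_unity_roots_poly:
  assumes "degree q < N"
  shows "(\<Sum>a\<in>unity_roots N. poly q (inverse a)) = of_nat N * coeff q 0"
proof -
  have "(\<Sum>a\<in>unity_roots N. poly q (inverse a)) =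
      (\<Sum>i\<le>degree q. coeff q i * (\<Sum>a\<in>unity_roots N. inverse a ^ i))"
    unfolding poly_altdef by (subst sum.swap) (simp add: sum_distrib_left)
  also have "\<dots> = (\<Sum>i\<le>degree q. if i = 0 then of_nat N * coeff q 0 else 0)"
    using assms by (intro sum.cong) (auto simp: sum_unity_roots_power card_unity_roots)
  finally show ?thesis by simp
qed

text \<open>The Vandermonde product divided by the monomial that gives it constant term 1. Of the
  two factors \<open>1 - b / a\<close> and \<open>1 - a / b\<close> of a pair, the order of the list
  selects one.\<close>

fun half_vandermonde :: "complex list \<Rightarrow> complex" where
  "half_vandermonde [] = 1"
| "half_vandermonde (a # l) = (\<Prod>b\<leftarrow>l. 1 - b / a) * half_vandermonde l"

text \<open>Only the factor of the exchanged pair changes, and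
  \<open>(1 - b / a) / b = (a - b) / (a * b)\<close> is antisymmetric.\<close>

lemma half_vandermonde_swap:
  assumes "a \<noteq> 0" "b \<noteq> 0"
  shows "half_vandermonde (u @ a # b # v) / b = - (half_vandermonde (u @ b # a # v) / a)"
proof (induction u)
  case Nil
  define P where "P = (\<Prod>c\<leftarrow>v. 1 - c / a) * (\<Prod>c\<leftarrow>v. 1 - c / b) * half_vandermonde v"
  have ab: "half_vandermonde (a # b # v) / b = (1 - b / a) / b * P" by (simp add: P_def mult_ac)
  have ba: "half_vandermonde (b # a # v) / a = (1 - a / b) / a * P" by (simp add: P_def mult_ac)
  have "(1 - b / a) / b = - ((1 - a / b) / a)" using assms by (simp add: field_simps)
  then show ?case unfolding append_Nil ab ba by (simp only: mult_minus_left)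
next
  case (Cons x u)
  define P where "P = (\<Prod>c\<leftarrow>u @ a # b # v. 1 - c / x)"
  have ab: "half_vandermonde ((x # u) @ a # b # v) / b = P * (half_vandermonde (u @ a # b # v) / b)"
    by (simp add: P_def)
  have ba: "half_vandermonde ((x # u) @ b # a # v) / a = P * (half_vandermonde (u @ b # a # v) / a)"
    by (simp add: P_def mult_ac)
  show ?case unfolding ab ba Cons.IH by simp
qed

text \<open>The factor of the first letter \<open>a\<close> in
  \<open>half_vandermonde (a # l)\<close>, read as a polynomial in \<open>1 / a\<close>.\<close>

definition factor_poly :: "complex list \<Rightarrow> complex poly" where
  "factor_poly l = (\<Prod>b\<leftarrow>l. [:1, - b:])"

lemma factor_poly:
  "degree (factor_poly l) \<le> length l" "poly (factor_poly l) x = (\<Prod>b\<leftarrow>l. 1 - b * x)"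
proof -
  show "degree (factor_poly l) \<le> length l"
  proof (induction l)
    case (Cons b l)
    have "degree ([:1, - b:] * factor_poly l) \<le> degree [:1, - b:] + degree (factor_poly l)"
      by (rule degree_mult_le)
    also have "\<dots> \<le> 1 + length l" using Cons by (intro add_mono) auto
    finally show ?case by (simp add: factor_poly_def)
  qed (simp add: factor_poly_def)
  show "poly (factor_poly l) x = (\<Prod>b\<leftarrow>l. 1 - b * x)"
    by (induction l) (auto simp: factor_poly_def algebra_simps)
qed

lemma prod_list_one: "(\<Prod>b\<leftarrow>l. 1 :: 'a :: comm_monoid_mult) = 1"
  by (induction l) auto

text \<open>Summation over the first letter leaves the constant coefficient 1 of its factor, so
  letters can be removed one by one. This is the base case of the counting recursion.\<close>

lemma sum_half_vandermonde:
  "d \<le> N \<Longrightarrow> N > 0 \<Longrightarrow> (\<Sum>w\<in>unity_words N d. half_vandermonde w) = of_nat N ^ d"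
proof (induction d)
  case (Suc d)
  have "(\<Sum>w\<in>unity_words N (Suc d). half_vandermonde w) =
      (\<Sum>l\<in>unity_words N d. (\<Sum>a\<in>unity_roots N. poly (factor_poly l) (inverse a)) * half_vandermonde l)"
    by (simp add: sum_unity_words_Suc factor_poly sum_distrib_right divide_inverse)
  also have "\<dots> = (\<Sum>l\<in>unity_words N d. of_nat N * half_vandermonde l)"
  proof (rule sum.cong[OF refl])
    fix l assume "l \<in> unity_words N d"
    then have "degree (factor_poly l) < N"
      using factor_poly(1)[of l] Suc.prems by (simp add: unity_words_def)
    moreover have "coeff (factor_poly l) 0 = 1"
      by (simp add: poly_0_coeff_0[symmetric] factor_poly prod_list_one)
    ultimately show "(\<Sum>a\<in>unity_roots N. poly (factor_poly l) (inverse a)) * half_vandermonde l =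
        of_nat N * half_vandermonde l"
      by (simp add: sum_unity_roots_poly)
  qed
  also have "\<dots> = of_nat N ^ Suc d" using Suc by (simp add: sum_distrib_left[symmetric])
  finally show ?case .
qed (simp add: unity_words_0)

text \<open>
  The boundary terms of the reflection argument: for \<open>j = 0\<close> only negative powers of the first
  letter occur, and for \<open>j > 0\<close> exchanging the letters \<open>j - 1\<close> and \<open>j\<close> changes the sign.
\<close>

lemma boundary_sum_zero:
  assumes j: "j < d" and h: "\<forall>z\<in>R. h z \<noteq> j" and N: "n + d < N"
  shows "(\<Sum>w\<in>unity_words N d. (\<Sum>z\<leftarrow>w. inverse z) ^ n * half_vandermonde w / w ! j *
    (\<Prod>y\<in>R. sum_list (drop (h y) w))) = 0"
proof (cases j)
  case 0
  obtain d' where d: "d = Suc d'" using j by (cases d) auto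
  define C where "C l = half_vandermonde l * (\<Prod>y\<in>R. sum_list (drop (h y - 1) l))" for l
  \<comment> \<open>The dependence on the first letter \<open>a\<close>, as a polynomial in
    \<open>1 / a\<close>. Dividing by \<open>w ! 0\<close> makes its constant coefficient 0; its
    degree is at most \<open>n + d\<close>. The plane wave does not involve \<open>a\<close>,
    because \<open>h\<close> is never 0 on \<open>R\<close>.\<close>
  define q where "q l = [:0, 1:] * ([:\<Sum>z\<leftarrow>l. inverse z, 1:] ^ n * factor_poly l)" for l
  have "(\<Sum>a\<in>unity_roots N. (\<Sum>z\<leftarrow>a # l. inverse z) ^ n * half_vandermonde (a # l) / (a # l) ! j *
      (\<Prod>y\<in>R. sum_list (drop (h y) (a # l)))) = 0" if l: "l \<in> unity_words N d'" for l
  proof -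
    have "(\<Prod>y\<in>R. sum_list (drop (h y) (a # l))) = (\<Prod>y\<in>R. sum_list (drop (h y - 1) l))" for a
    proof (rule prod.cong[OF refl])
      fix y assume "y \<in> R"
      then obtain m where "h y = Suc m" using h 0 by (cases "h y") auto
      then show "sum_list (drop (h y) (a # l)) = sum_list (drop (h y - 1) l)" by simp
    qed
    then have "(\<Sum>a\<in>unity_roots N. (\<Sum>z\<leftarrow>a # l. inverse z) ^ n * half_vandermonde (a # l) / (a # l) ! j *
      (\<Prod>y\<in>R. sum_list (drop (h y) (a # l)))) = (\<Sum>a\<in>unity_roots N. poly (q l) (inverse a) * C l)"
      by (intro sum.cong refl) (simp add: q_def C_def 0 factor_poly poly_power divide_inverse ac_simps)
    also have "\<dots> = (\<Sum>a\<in>unity_roots N. poly (q l) (inverse a)) * C l" by (simp add: sum_distrib_right)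
    also have "(\<Sum>a\<in>unity_roots N. poly (q l) (inverse a)) = of_nat N * coeff (q l) 0"
    proof (rule sum_unity_roots_poly)
      have "degree (q l) \<le> degree [:0, 1 :: complex:] +
          (degree ([:\<Sum>z\<leftarrow>l. inverse z, 1:] ^ n) + degree (factor_poly l))"
        unfolding q_def by (intro order_trans[OF degree_mult_le] add_left_mono degree_mult_le)
      also have "\<dots> \<le> 1 + (n + d')"
        using factor_poly(1)[of l] l degree_power_le[of "[:\<Sum>z\<leftarrow>l. inverse z, 1:]" n]
        by (intro add_mono) (auto simp: unity_words_def)
      finally show "degree (q l) < N" using N d by simp
    qed
    also have "coeff (q l) 0 = 0" by (simp add: q_def)
    finally show ?thesis by simp
  qed
  then show ?thesis unfolding d sum_unity_words_Suc by simp
next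
  case (Suc i)
  define sw where "sw w = take i w @ w ! Suc i # w ! i # drop (Suc (Suc i)) w" for w :: "complex list"
  define F where "F w = (\<Sum>z\<leftarrow>w. inverse z) ^ n * half_vandermonde w / w ! j *
    (\<Prod>y\<in>R. sum_list (drop (h y) w))" for w
  have split: "\<exists>u a b v. w = u @ a # b # v \<and> length u = i" if "w \<in> unity_words N d" for w
  proof -
    have "i < length w" "Suc i < length w" using that j Suc by (auto simp: unity_words_def)
    then have "w = take i w @ w ! i # w ! Suc i # drop (Suc (Suc i)) w"
      by (metis Cons_nth_drop_Suc append_take_drop_id)
    then show ?thesis using \<open>i < length w\<close> by (metis length_take min.absorb4)
  qed
  have sw: "sw w \<in> unity_words N d \<and> sw (sw w) = w \<and> F (sw w) = - F w" if w: "w \<in> unity_words N d" for w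
  proof -
    from split[OF w] obtain u a b v where e: "w = u @ a # b # v" "length u = i" by blast
    have s: "sw w = u @ b # a # v" using e by (auto simp: sw_def nth_append)
    have nz: "a \<noteq> 0" "b \<noteq> 0" using w N e by (auto simp: unity_words_def unity_roots_def zero_power)
    \<comment> \<open>Dropping \<open>m\<close> letters separates the two exchanged ones only for
      \<open>m = j\<close>, the value that \<open>h\<close> avoids.\<close>
    have "sum_list (drop m (u @ b # a # v)) = sum_list (drop m (u @ a # b # v))" if m: "m \<noteq> j" for m
    proof (cases "m \<le> i")
      case False
      then have "m = Suc (Suc (i + (m - Suc (Suc i))))" using m Suc by simp
      then obtain r where "m = Suc (Suc (i + r))" by blast
      then show ?thesis using e(2) by simp
    qed (use e in simp)
    then have pr: "(\<Prod>y\<in>R. sum_list (drop (h y) (u @ b # a # v))) =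
        (\<Prod>y\<in>R. sum_list (drop (h y) (u @ a # b # v)))" (is "_ = ?P")
      using h by (intro prod.cong) auto
    have nth: "w ! j = b" "sw w ! j = a" using e Suc unfolding s by (auto simp: nth_append)
    have inv: "(\<Sum>z\<leftarrow>sw w. inverse z) = (\<Sum>z\<leftarrow>w. inverse z)" (is "_ = ?S")
      unfolding s unfolding e(1) by simp
    have "F (sw w) = ?S ^ n * half_vandermonde (sw w) / a * (\<Prod>y\<in>R. sum_list (drop (h y) (sw w)))"
      unfolding F_def inv nth by (rule refl)
    also have "\<dots> = ?S ^ n * (half_vandermonde (u @ b # a # v) / a) * ?P"
      unfolding s pr by simp
    also have "\<dots> = - (?S ^ n * (half_vandermonde (u @ a # b # v) / b) * ?P)"
      unfolding half_vandermonde_swap[OF nz] by simp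
    also have "?S ^ n * (half_vandermonde (u @ a # b # v) / b) * ?P = F w"
      unfolding F_def nth unfolding e(1) by simp
    finally have "F (sw w) = - F w" .
    moreover have "sw w \<in> unity_words N d"
      unfolding s using w unfolding e(1) by (auto simp: unity_words_def)
    moreover have "sw (sw w) = w" unfolding s using e by (auto simp: sw_def nth_append)
    ultimately show ?thesis by simp
  qed
  have "(\<Sum>w\<in>unity_words N d. F w) = (\<Sum>w\<in>unity_words N d. - F w)"
    by (rule sum.reindex_bij_witness[of _ sw sw]) (use sw in auto)
  then show ?thesis by (simp add: F_def sum_negf)
qed

text \<open>The factorization of \<open>A ^ m - B ^ m\<close>, each monomial of the cofactor being
  labelled by the element of \<open>X\<close> of the corresponding rank.\<close>

lemma sum_power_diff:
  fixes A B :: "'a :: comm_ring_1" and X :: "nat set"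
  assumes "finite X"
  shows "(A - B) * (\<Sum>y\<in>X. A ^ card {z \<in> X. z < y} * B ^ card {z \<in> X. y < z}) = A ^ card X - B ^ card X"
  using assms
proof (induction rule: finite_linorder_max_induct)
  case (insert b X)
  have top: "{z \<in> insert b X. z < b} = X" "{z \<in> insert b X. b < z} = {}" using insert by auto
  have "A ^ card {z \<in> insert b X. z < y} * B ^ card {z \<in> insert b X. y < z} =
      B * (A ^ card {z \<in> X. z < y} * B ^ card {z \<in> X. y < z})" if "y \<in> X" for y
  proof -
    have "{z \<in> insert b X. z < y} = {z \<in> X. z < y}" using insert that by (auto dest: less_asym)
    moreover have "{z \<in> insert b X. y < z} = insert b {z \<in> X. y < z}" using insert that by auto
    then have "card {z \<in> insert b X. y < z} = Suc (card {z \<in> X. y < z})" using insert by auto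
    ultimately show ?thesis by simp
  qed
  then have "(\<Sum>y\<in>X. A ^ card {z \<in> insert b X. z < y} * B ^ card {z \<in> insert b X. y < z}) =
      B * (\<Sum>y\<in>X. A ^ card {z \<in> X. z < y} * B ^ card {z \<in> X. y < z})"
    unfolding sum_distrib_left by (rule sum.cong[OF refl])
  moreover have "b \<notin> X" using insert.hyps by auto
  ultimately have "(\<Sum>y\<in>insert b X. A ^ card {z \<in> insert b X. z < y} * B ^ card {z \<in> insert b X. y < z}) =
      A ^ card X + B * (\<Sum>y\<in>X. A ^ card {z \<in> X. z < y} * B ^ card {z \<in> X. y < z})"
    unfolding sum.insert[OF insert.hyps(1) \<open>b \<notin> X\<close>] top by simp
  also have "(A - B) * \<dots> = (A - B) * A ^ card X + B * (A ^ card X - B ^ card X)"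
    unfolding insert.IH[symmetric] by (simp add: algebra_simps)
  also have "\<dots> = A ^ card (insert b X) - B ^ card (insert b X)"
    using insert by (subst (1 2) card_insert_disjoint) (auto simp: algebra_simps)
  finally show ?case .
qed simp

text \<open>Within the level \<open>g = j\<close>, reading \<open>y\<close> leaves the letters below
  \<open>y\<close> at the tail sum \<open>A\<close> and moves those above it to \<open>B\<close>.
  Summed over \<open>y\<close>, this is the cofactor of \<open>A - B\<close> in
  \<open>A ^ card X - B ^ card X\<close>, and \<open>A - B\<close> is \<open>w ! j\<close>.\<close>

lemma sum_bump_class:
  fixes w :: "complex list"
  assumes R: "finite R" and j: "j < length w" "w ! j \<noteq> 0"
  shows "(\<Sum>y | y \<in> R \<and> g y = j. \<Prod>z\<in>R - {y}. sum_list (drop (bump g y z) w)) =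
    ((\<Prod>z\<in>R. sum_list (drop (g z) w)) -
     (\<Prod>z\<in>R. sum_list (drop (if g z = j then Suc j else g z) w))) / w ! j"
proof -
  define X where "X = {y \<in> R. g y = j}"
  define A where "A = sum_list (drop j w)"
  define B where "B = sum_list (drop (Suc j) w)"
  define C where "C = (\<Prod>z\<in>R - X. sum_list (drop (g z) w))"
  have fX: "finite X" "X \<subseteq> R" using R by (auto simp: X_def)
  have AB: "A - B = w ! j"
    using j by (simp add: A_def B_def Cons_nth_drop_Suc[symmetric])
  have "(\<Prod>z\<in>R - {y}. sum_list (drop (bump g y z) w)) =
      C * (A ^ card {z \<in> X. z < y} * B ^ card {z \<in> X. y < z})" if y: "y \<in> X" for y
  proof -
    let ?f = "\<lambda>z. sum_list (drop (bump g y z) w)"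
    have "R - {y} = (R - X) \<union> ({z \<in> X. z < y} \<union> {z \<in> X. y < z})" using y fX by auto
    then have "prod ?f (R - {y}) = prod ?f (R - X) * (prod ?f {z \<in> X. z < y} * prod ?f {z \<in> X. y < z})"
      using R fX by (simp add: prod.union_disjoint disjoint_iff)
    also have "prod ?f (R - X) = C"
      unfolding C_def using y by (intro prod.cong) (auto simp: X_def bump_def)
    also have "prod ?f {z \<in> X. z < y} = (\<Prod>z\<in>{z \<in> X. z < y}. A)"
      using y by (intro prod.cong) (auto simp: X_def bump_def A_def)
    also have "prod ?f {z \<in> X. y < z} = (\<Prod>z\<in>{z \<in> X. y < z}. B)"
      using y by (intro prod.cong) (auto simp: X_def bump_def B_def)
    finally show ?thesis by simp
  qed
  then have "(\<Sum>y\<in>X. \<Prod>z\<in>R - {y}. sum_list (drop (bump g y z) w)) =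
      C * (\<Sum>y\<in>X. A ^ card {z \<in> X. z < y} * B ^ card {z \<in> X. y < z})"
    by (simp add: sum_distrib_left)
  also have "\<dots> = C * ((A ^ card X - B ^ card X) / w ! j)"
  proof -
    have "(\<Sum>y\<in>X. A ^ card {z \<in> X. z < y} * B ^ card {z \<in> X. y < z}) = (A ^ card X - B ^ card X) / w ! j"
      using sum_power_diff[OF fX(1), of A B] j(2) unfolding AB by (simp add: nonzero_eq_divide_eq mult.commute)
    then show ?thesis by (simp only:)
  qed
  also have "\<dots> = (C * A ^ card X - C * B ^ card X) / w ! j" by (simp add: algebra_simps)
  also have "C * A ^ card X = (\<Prod>z\<in>R. sum_list (drop (g z) w))"
  proof -
    have "(\<Prod>z\<in>X. sum_list (drop (g z) w)) = (\<Prod>z\<in>X. A)" by (intro prod.cong) (auto simp: X_def A_def)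
    then show ?thesis unfolding C_def by (subst prod.subset_diff[OF fX(2) R]) simp
  qed
  also have "C * B ^ card X = (\<Prod>z\<in>R. sum_list (drop (if g z = j then Suc j else g z) w))"
  proof -
    have "(\<Prod>z\<in>X. sum_list (drop (if g z = j then Suc j else g z) w)) = (\<Prod>z\<in>X. B)"
      by (intro prod.cong) (auto simp: X_def B_def)
    moreover have "(\<Prod>z\<in>R-X. sum_list (drop (if g z = j then Suc j else g z) w)) = C"
      unfolding C_def by (intro prod.cong) (auto simp: X_def)
    ultimately show ?thesis by (subst prod.subset_diff[OF fX(2) R]) (simp only: prod_constant)
  qed
  finally show ?thesis by (simp add: X_def)
qed

text \<open>
  Up to boundary terms, multiplication by the sum of the inverse letters acts on the plane wave
  \<open>\<Prod>y\<in>R. sum_list (drop (g y) w)\<close> as one step of the recursion.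
\<close>

lemma card_good_permutations:
  assumes "mono g" "finite R" "card R + d < N"
  shows "of_nat (N ^ d * card {p \<in> permutations_of_set R. good d g p}) =
    (\<Sum>w\<in>unity_words N d. (\<Sum>z\<leftarrow>w. inverse z) ^ card R * half_vandermonde w *
       (\<Prod>y\<in>R. sum_list (drop (g y) w)))"
  using assms
proof (induction "card R" arbitrary: R g)
  case 0
  then have "R = {}" by simp
  moreover have "{p \<in> {[]}. good d g p} = {[]}"
    by (auto simp: good_def dest: list_emb_length)
  ultimately show ?case using sum_half_vandermonde[of d N] 0 by simp
next
  case (Suc n)
  define S where "S w = (\<Sum>z\<leftarrow>w. inverse z)" for w :: "complex list"
  define \<Phi> where "\<Phi> h R w = (\<Prod>y\<in>R. sum_list (drop (h y) w))" for h :: "nat \<Rightarrow> nat" and R and w :: "complex list"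
  define h where "h j z = (if g z = j then Suc j else g z)" for j z
  let ?W = "unity_words N d"
  have R: "finite R" "R \<noteq> {}" using Suc by auto
  have "of_nat (N ^ d * card {p \<in> permutations_of_set R. good d g p}) =
    (\<Sum>y | y \<in> R \<and> g y < d. of_nat (N ^ d * card {p \<in> permutations_of_set (R - {y}). good d (bump g y) p}) :: complex)"
    unfolding card_good_permutations_rec[OF Suc.prems(1) R] by (simp add: sum_distrib_left)
  also have "\<dots> = (\<Sum>y | y \<in> R \<and> g y < d. \<Sum>w\<in>?W. S w ^ n * half_vandermonde w * \<Phi> (bump g y) (R - {y}) w)"
  proof (rule sum.cong[OF refl])
    fix y assume "y \<in> {y. y \<in> R \<and> g y < d}"
    then have "card (R - {y}) = n" using Suc.hyps(2) R by simp
    then show "of_nat (N ^ d * card {p \<in> permutations_of_set (R - {y}). good d (bump g y) p}) =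
        (\<Sum>w\<in>?W. S w ^ n * half_vandermonde w * \<Phi> (bump g y) (R - {y}) w)"
      using Suc.hyps(1)[of "R - {y}" "bump g y"] Suc.hyps(2) Suc.prems mono_bump R
      unfolding S_def \<Phi>_def by simp
  qed
  also have "\<dots> = (\<Sum>w\<in>?W. S w ^ n * half_vandermonde w * (\<Sum>y | y \<in> R \<and> g y < d. \<Phi> (bump g y) (R - {y}) w))"
    by (subst sum.swap) (simp add: sum_distrib_left)
  \<comment> \<open>The first letters are grouped by their level \<open>j = g y\<close>.\<close>
  also have "\<dots> = (\<Sum>w\<in>?W. S w ^ n * half_vandermonde w * (\<Sum>j<d. (\<Phi> g R w - \<Phi> (h j) R w) / w ! j))"
  proof (rule sum.cong[OF refl])
    fix w assume w: "w \<in> ?W"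
    have "(\<Sum>y | y \<in> R \<and> g y < d. \<Phi> (bump g y) (R - {y}) w) =
        (\<Sum>j<d. \<Sum>y | y \<in> {y. y \<in> R \<and> g y < d} \<and> g y = j. \<Phi> (bump g y) (R - {y}) w)"
      by (rule sum.group[symmetric]) (use R in auto)
    also have "\<dots> = (\<Sum>j<d. (\<Phi> g R w - \<Phi> (h j) R w) / w ! j)"
    proof (rule sum.cong[OF refl])
      fix j assume j: "j \<in> {..<d}"
      then have "{y. y \<in> {y. y \<in> R \<and> g y < d} \<and> g y = j} = {y. y \<in> R \<and> g y = j}" by auto
      moreover have "j < length w" using w j by (simp add: unity_words_def)
      moreover from this have "w ! j \<in> set w" by simp
      then have "w ! j \<noteq> 0" using w Suc.prems unity_roots_nonzero[of "w ! j" N] unfolding unity_words_def by auto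
      ultimately show "(\<Sum>y | y \<in> {y. y \<in> R \<and> g y < d} \<and> g y = j. \<Phi> (bump g y) (R - {y}) w) =
          (\<Phi> g R w - \<Phi> (h j) R w) / w ! j"
        using sum_bump_class[OF R(1), of j w g] unfolding \<Phi>_def h_def by simp
    qed
    finally show "S w ^ n * half_vandermonde w * (\<Sum>y | y \<in> R \<and> g y < d. \<Phi> (bump g y) (R - {y}) w) =
        S w ^ n * half_vandermonde w * (\<Sum>j<d. (\<Phi> g R w - \<Phi> (h j) R w) / w ! j)" by simp
  qed
  also have "\<dots> = (\<Sum>w\<in>?W. S w ^ n * half_vandermonde w * (\<Sum>j<d. 1 / w ! j) * \<Phi> g R w) -
      (\<Sum>j<d. \<Sum>w\<in>?W. S w ^ n * half_vandermonde w / w ! j * \<Phi> (h j) R w)"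
  proof -
    have "S w ^ n * half_vandermonde w * (\<Sum>j<d. (\<Phi> g R w - \<Phi> (h j) R w) / w ! j) =
        S w ^ n * half_vandermonde w * (\<Sum>j<d. 1 / w ! j) * \<Phi> g R w -
        (\<Sum>j<d. S w ^ n * half_vandermonde w / w ! j * \<Phi> (h j) R w)" for w
      unfolding sum_distrib_left sum_distrib_right sum_subtractf[symmetric]
      by (intro sum.cong refl) (simp add: divide_inverse algebra_simps)
    then have "(\<Sum>w\<in>?W. S w ^ n * half_vandermonde w * (\<Sum>j<d. (\<Phi> g R w - \<Phi> (h j) R w) / w ! j)) =
        (\<Sum>w\<in>?W. S w ^ n * half_vandermonde w * (\<Sum>j<d. 1 / w ! j) * \<Phi> g R w) -
        (\<Sum>w\<in>?W. \<Sum>j<d. S w ^ n * half_vandermonde w / w ! j * \<Phi> (h j) R w)"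
      by (simp only: sum_subtractf)
    also have "(\<Sum>w\<in>?W. \<Sum>j<d. S w ^ n * half_vandermonde w / w ! j * \<Phi> (h j) R w) =
        (\<Sum>j<d. \<Sum>w\<in>?W. S w ^ n * half_vandermonde w / w ! j * \<Phi> (h j) R w)"
      by (rule sum.swap)
    finally show ?thesis .
  qed
  \<comment> \<open>\<open>h j\<close> has emptied the level \<open>j\<close>, as
    \<open>boundary_sum_zero\<close> requires. In the other part the sum of the
    \<open>1 / w ! j\<close> supplies the missing power of \<open>S w\<close>.\<close>
  also have "(\<Sum>j<d. \<Sum>w\<in>?W. S w ^ n * half_vandermonde w / w ! j * \<Phi> (h j) R w) = 0"
    unfolding S_def \<Phi>_def
    by (intro sum.neutral ballI boundary_sum_zero) (use Suc in \<open>auto simp: h_def\<close>)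
  also have "(\<Sum>w\<in>?W. S w ^ n * half_vandermonde w * (\<Sum>j<d. 1 / w ! j) * \<Phi> g R w) =
      (\<Sum>w\<in>?W. S w ^ card R * half_vandermonde w * \<Phi> g R w)"
  proof (rule sum.cong[OF refl])
    fix w assume "w \<in> ?W"
    then have "(\<Sum>j<d. 1 / w ! j) = S w"
      by (simp add: S_def sum_list_sum_nth atLeast0LessThan unity_words_def divide_inverse)
    then show "S w ^ n * half_vandermonde w * (\<Sum>j<d. 1 / w ! j) * \<Phi> g R w =
        S w ^ card R * half_vandermonde w * \<Phi> g R w"
      by (simp add: Suc.hyps(2)[symmetric])
  qed
  finally show ?case by (simp add: S_def \<Phi>_def)
qed

section \<open>Symmetrization\<close>

lemma inc_free_iff_good: "inc_free d p \<longleftrightarrow> good d (\<lambda>_. 0) p"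
proof
  assume G: "good d (\<lambda>_. 0) p"
  show "inc_free d p"
    unfolding inc_free_def
  proof (intro allI impI)
    fix s assume "subseq s p" "sorted_wrt (<) s"
    then show "length s \<le> d" using G by (cases "s = []") (auto simp: good_def)
  qed
qed (simp add: inc_free_def good_def)

text \<open>The Lagrange interpolant of the constant 1 on \<open>T\<close> has degree below
  \<open>card T\<close>, hence equals 1; it is evaluated at 0.\<close>

lemma sum_lagrange_basis_at_0:
  fixes T :: "complex set"
  assumes T: "finite T" "T \<noteq> {}" "0 \<notin> T"
  shows "(\<Sum>a\<in>T. \<Prod>b\<in>T - {a}. 1 / (1 - a / b)) = 1"
proof -
  define q where "q = (\<Sum>a\<in>T. smult (\<Prod>b\<in>T - {a}. 1 / (a - b)) (\<Prod>b\<in>T - {a}. [:- b, 1:]))"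
  have ev: "poly q x = (\<Sum>a\<in>T. \<Prod>b\<in>T - {a}. (x - b) / (a - b))" for x
    unfolding q_def poly_sum
    by (intro sum.cong refl) (simp add: poly_prod prod.distrib[symmetric])
  have "poly q c = 1" if c: "c \<in> T" for c
  proof -
    have "(\<Prod>b\<in>T - {a}. (c - b) / (a - b)) = (if a = c then 1 else 0)" if "a \<in> T" for a
    proof (cases "a = c")
      case False
      then show ?thesis using c T by (auto intro!: prod_zero)
    next
      case True
      then have "(\<Prod>b\<in>T - {a}. (c - b) / (a - b)) = (\<Prod>b\<in>T - {a}. 1)"
        by (intro prod.cong) auto
      with True show ?thesis by simp
    qed
    then have "poly q c = (\<Sum>a\<in>T. if a = c then 1 else 0)" unfolding ev by (rule sum.cong[OF refl])
    then show ?thesis using c T by simp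
  qed
  then have sub: "T \<subseteq> {x. poly (q - 1) x = 0}" by auto
  have "degree q \<le> card T - 1"
    unfolding q_def
  proof (rule degree_sum_le)
    fix a assume a: "a \<in> T"
    have "degree (\<Prod>b\<in>T - {a}. [:- b, 1:]) \<le> (\<Sum>b\<in>T - {a}. degree [:- b, 1:])"
      using T degree_prod_sum_le[of "T - {a}" "\<lambda>b. [:- b, 1:]"] by (simp add: o_def)
    also have "\<dots> = card T - 1" using a T by simp
    finally show "degree (smult (\<Prod>b\<in>T - {a}. 1 / (a - b)) (\<Prod>b\<in>T - {a}. [:- b, 1:])) \<le> card T - 1"
      using degree_smult_le le_trans by blast
  qed (use T in auto)
  then have "degree (q - 1) \<le> card T - 1" by (intro degree_diff_le) auto
  moreover have "card T > 0" using T by (simp add: card_gt_0_iff)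
  moreover have "card T \<le> degree (q - 1)" if "q - 1 \<noteq> 0"
    using card_mono[OF poly_roots_finite[OF that] sub] card_poly_roots_bound[OF that] by linarith
  ultimately have "q = 1" by fastforce
  then have "1 = (\<Sum>a\<in>T. \<Prod>b\<in>T - {a}. (0 - b) / (a - b))" using ev[of 0] by simp
  also have "(\<Sum>a\<in>T. \<Prod>b\<in>T - {a}. (0 - b) / (a - b)) = (\<Sum>a\<in>T. \<Prod>b\<in>T - {a}. 1 / (1 - a / b))"
  proof (intro sum.cong prod.cong refl)
    fix a b assume "b \<in> T - {a}"
    then have "b \<noteq> 0" "a - b \<noteq> 0" "b - a \<noteq> 0" using T by auto
    then show "(0 - b) / (a - b) = 1 / (1 - a / b)" by (simp add: divide_simps) (simp add: algebra_simps)
  qed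
  finally show ?thesis by (rule sym)
qed

text \<open>Both factors of every pair are taken, so no listing of \<open>T\<close> is preferred; on
  the unit circle a pair contributes its squared distance.\<close>

definition full_vandermonde :: "complex set \<Rightarrow> complex" where
  "full_vandermonde T = (\<Prod>a\<in>T. \<Prod>b\<in>T - {a}. 1 - b / a)"

lemma full_vandermonde_remove:
  assumes "finite T" "a \<in> T"
  shows "full_vandermonde T =
    (\<Prod>b\<in>T - {a}. 1 - b / a) * (\<Prod>b\<in>T - {a}. 1 - a / b) * full_vandermonde (T - {a})"
proof -
  have "(\<Prod>c\<in>T - {a}. \<Prod>b\<in>T - {c}. 1 - b / c) =
      (\<Prod>c\<in>T - {a}. (1 - a / c) * (\<Prod>b\<in>T - {a} - {c}. 1 - b / c))"
  proof (rule prod.cong[OF refl])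
    fix c assume c: "c \<in> T - {a}"
    have "T - {c} - {a} = T - {a} - {c}" by auto
    then show "(\<Prod>b\<in>T - {c}. 1 - b / c) = (1 - a / c) * (\<Prod>b\<in>T - {a} - {c}. 1 - b / c)"
      using prod.remove[of "T - {c}" a "\<lambda>b. 1 - b / c"] assms c by auto
  qed
  then show ?thesis
    using assms by (simp add: full_vandermonde_def prod.remove[of T a] prod.distrib)
qed

lemma sum_permutations_of_set:
  assumes "finite T" "T \<noteq> {}"
  shows "(\<Sum>w\<in>permutations_of_set T. F w) = (\<Sum>a\<in>T. \<Sum>l\<in>permutations_of_set (T - {a}). F (a # l))"
proof -
  have "(\<Sum>w\<in>permutations_of_set T. F w) = (\<Sum>a\<in>T. \<Sum>w\<in>(#) a ` permutations_of_set (T - {a}). F w)"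
    unfolding permutations_of_set_nonempty[OF assms(2)]
    using assms by (intro sum.UNION_disjoint) auto
  then show ?thesis by (simp add: sum.reindex)
qed

text \<open>With first letter \<open>a\<close> the weight lacks the factors
  \<open>1 - a / b\<close>. Relative to \<open>full_vandermonde T\<close> their inverses remain,
  which are the Lagrange basis values at 0 and sum to 1.\<close>

lemma sum_half_vandermonde_permutations:
  assumes "finite T" "0 \<notin> T"
  shows "(\<Sum>w\<in>permutations_of_set T. half_vandermonde w) = full_vandermonde T"
  using assms
proof (induction "card T" arbitrary: T)
  case 0
  then show ?case by (simp add: full_vandermonde_def)
next
  case (Suc n)
  have T: "finite T" "T \<noteq> {}" "0 \<notin> T" using Suc by auto
  have "(\<Sum>w\<in>permutations_of_set T. half_vandermonde w) =
      (\<Sum>a\<in>T. \<Sum>l\<in>permutations_of_set (T - {a}). (\<Prod>b\<in>T - {a}. 1 - b / a) * half_vandermonde l)"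
    unfolding sum_permutations_of_set[OF T(1,2)]
    by (intro sum.cong refl) (auto simp: permutations_of_set_def prod.distinct_set_conv_list[symmetric])
  also have "\<dots> = (\<Sum>a\<in>T. (\<Prod>b\<in>T - {a}. 1 - b / a) * full_vandermonde (T - {a}))"
    using Suc by (intro sum.cong refl) (simp add: sum_distrib_left[symmetric])
  also have "\<dots> = (\<Sum>a\<in>T. full_vandermonde T * (\<Prod>b\<in>T - {a}. 1 / (1 - a / b)))"
  proof (rule sum.cong[OF refl])
    fix a assume a: "a \<in> T"
    have "(\<Prod>b\<in>T - {a}. 1 - a / b) * (\<Prod>b\<in>T - {a}. 1 / (1 - a / b)) = (\<Prod>b\<in>T - {a}. 1)"
      unfolding prod.distrib[symmetric] using T by (intro prod.cong) (auto simp: field_simps)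
    then show "(\<Prod>b\<in>T - {a}. 1 - b / a) * full_vandermonde (T - {a}) =
        full_vandermonde T * (\<Prod>b\<in>T - {a}. 1 / (1 - a / b))"
      unfolding full_vandermonde_remove[OF T(1) a] by (simp add: ac_simps)
  qed
  also have "\<dots> = full_vandermonde T"
    by (simp add: sum_distrib_left[symmetric] sum_lagrange_basis_at_0[OF T])
  finally show ?case .
qed

fun sq_vandermonde :: "complex list \<Rightarrow> real" where
  "sq_vandermonde [] = 1"
| "sq_vandermonde (a # l) = (\<Prod>b\<leftarrow>l. (cmod (a - b))\<^sup>2) * sq_vandermonde l"

lemma sq_vandermonde_nonneg: "sq_vandermonde w \<ge> 0"
proof (induction w)
  case (Cons a l)
  have "(\<Prod>b\<leftarrow>l. (cmod (a - b))\<^sup>2) \<ge> 0" by (induction l) auto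
  with Cons show ?case by simp
qed simp

lemma vandermonde_not_distinct:
  assumes "\<not> distinct w"
  shows "sq_vandermonde w = 0" "0 \<notin> set w \<Longrightarrow> half_vandermonde w = 0"
  using assms by (induction w) (auto simp: prod_list_zero_iff image_iff)

lemma cnj_eq_inverse: "cmod z = 1 \<Longrightarrow> cnj z = inverse z"
  using complex_norm_square[of z] by (intro inverse_unique[symmetric]) simp

lemma cmod_diff_unit:
  assumes "cmod a = 1" "cmod b = 1"
  shows "complex_of_real ((cmod (a - b))\<^sup>2) = (1 - b / a) * (1 - a / b)"
proof -
  have "cnj a = 1 / a" "cnj b = 1 / b" "a \<noteq> 0" "b \<noteq> 0"
    using assms cnj_eq_inverse by (auto simp: inverse_eq_divide)
  then show ?thesis unfolding complex_norm_square by (simp add: field_simps)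
qed

lemma sq_vandermonde_distinct:
  assumes "distinct w" "\<forall>z\<in>set w. cmod z = 1"
  shows "complex_of_real (sq_vandermonde w) = full_vandermonde (set w)"
  using assms
proof (induction w)
  case (Cons a l)
  have "complex_of_real (\<Prod>b\<leftarrow>l. (cmod (a - b))\<^sup>2) = (\<Prod>b\<in>set l. complex_of_real ((cmod (a - b))\<^sup>2))"
    using Cons.prems by (subst prod.distinct_set_conv_list[symmetric]) auto
  also have "\<dots> = (\<Prod>b\<in>set l. (1 - b / a) * (1 - a / b))"
    using Cons.prems by (intro prod.cong refl cmod_diff_unit) auto
  finally show ?case
    using Cons full_vandermonde_remove[of "set (a # l)" a] by (simp add: prod.distrib)
qed (simp add: full_vandermonde_def)

lemma unity_roots_norm: "z \<in> unity_roots N \<Longrightarrow> N > 0 \<Longrightarrow> cmod z = 1"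
  using power_eq_iff_eq_base[of N "cmod z" 1] by (simp add: unity_roots_def norm_power[symmetric])

lemma sum_unity_words_distinct:
  assumes N: "N > 0" and z: "\<And>w. w \<in> unity_words N d \<Longrightarrow> \<not> distinct w \<Longrightarrow> F w = 0"
  shows "(\<Sum>w\<in>unity_words N d. F w) =
    (\<Sum>T | T \<subseteq> unity_roots N \<and> card T = d. \<Sum>w\<in>permutations_of_set T. F w)"
proof -
  let ?TT = "{T. T \<subseteq> unity_roots N \<and> card T = d}"
  have fin: "finite ?TT" using finite_unity_roots[OF N] by simp
  have fT: "\<forall>T\<in>?TT. finite T" using finite_unity_roots[OF N] by (auto intro: finite_subset)
  have eq: "{w \<in> unity_words N d. distinct w} = (\<Union>T\<in>?TT. permutations_of_set T)"
    by (auto simp: unity_words_def permutations_of_set_def distinct_card)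
  have "(\<Sum>w\<in>unity_words N d. F w) = (\<Sum>w\<in>{w \<in> unity_words N d. distinct w}. F w)"
    using z by (intro sum.mono_neutral_right finite_unity_words N) auto
  also have "\<dots> = (\<Sum>T\<in>?TT. \<Sum>w\<in>permutations_of_set T. F w)"
    unfolding eq
  proof (intro sum.UNION_disjoint fin ballI impI)
    fix S T assume "S \<in> ?TT" "T \<in> ?TT" "S \<noteq> T"
    then show "permutations_of_set S \<inter> permutations_of_set T = {}"
      by (auto simp: permutations_of_set_def)
  qed simp
  finally show ?thesis .
qed

text \<open>\<open>f\<close> depends only on the set of letters and both weights vanish on repeated
  letters, so averaging over the \<open>fact d\<close> listings of each set turns the half product
  into the full one.\<close>

lemma symmetrize_half_vandermonde:
  assumes N: "N > 0" and f: "\<And>w. w \<in> unity_words N d \<Longrightarrow> distinct w \<Longrightarrow> f w = F (set w)"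
  shows "of_nat (fact d) * (\<Sum>w\<in>unity_words N d. f w * half_vandermonde w) =
    (\<Sum>w\<in>unity_words N d. f w * complex_of_real (sq_vandermonde w))"
proof -
  let ?TT = "{T. T \<subseteq> unity_roots N \<and> card T = d}"
  have T: "finite T" "0 \<notin> T" if "T \<in> ?TT" for T
    using that finite_unity_roots[OF N] unity_roots_nonzero[OF _ N] by (auto intro: finite_subset)
  have perm: "f w = F T" "distinct w" "set w = T" "\<forall>z\<in>set w. cmod z = 1"
    if "T \<in> ?TT" "w \<in> permutations_of_set T" for w T
    using that f[of w] unity_roots_norm[OF _ N]
    by (auto simp: permutations_of_set_def unity_words_def distinct_card)
  have "(\<Sum>w\<in>unity_words N d. f w * half_vandermonde w) =
      (\<Sum>T\<in>?TT. \<Sum>w\<in>permutations_of_set T. f w * half_vandermonde w)"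
  proof (intro sum_unity_words_distinct N)
    fix w assume "w \<in> unity_words N d" "\<not> distinct w"
    then have "half_vandermonde w = 0"
      using unity_roots_nonzero[OF _ N] by (intro vandermonde_not_distinct) (auto simp: unity_words_def)
    then show "f w * half_vandermonde w = 0" by simp
  qed
  also have "\<dots> = (\<Sum>T\<in>?TT. F T * full_vandermonde T)"
    by (intro sum.cong refl)
      (simp add: perm(1) sum_distrib_left[symmetric] sum_half_vandermonde_permutations[OF T])
  also have "of_nat (fact d) * \<dots> = (\<Sum>T\<in>?TT. \<Sum>w\<in>permutations_of_set T. F T * full_vandermonde T)"
    unfolding sum_distrib_left
  proof (rule sum.cong[OF refl])
    fix T assume t: "T \<in> ?TT"
    then have "card (permutations_of_set T) = fact d" using T(1)[OF t] by simp
    then show "of_nat (fact d) * (F T * full_vandermonde T) =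
        (\<Sum>w\<in>permutations_of_set T. F T * full_vandermonde T)" by simp
  qed
  also have "\<dots> = (\<Sum>T\<in>?TT. \<Sum>w\<in>permutations_of_set T. f w * complex_of_real (sq_vandermonde w))"
  proof (intro sum.cong refl)
    fix T w assume "T \<in> ?TT" "w \<in> permutations_of_set T"
    note p = perm[OF this]
    show "F T * full_vandermonde T = f w * complex_of_real (sq_vandermonde w)"
      using sq_vandermonde_distinct[OF p(2,4)] p(1,3) by simp
  qed
  also have "\<dots> = (\<Sum>w\<in>unity_words N d. f w * complex_of_real (sq_vandermonde w))"
    by (intro sum_unity_words_distinct[symmetric] N) (simp add: vandermonde_not_distinct)
  finally show ?thesis .
qed

text \<open>In the initial state 0 every tail sum is the full sum, and the sum of the inverse
  letters is its conjugate. This is a discrete form of the identity of Rains for moments of the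
  trace of a random unitary matrix, with the density of Weyl's integration formula.\<close>

lemma card_inc_free_permutations:
  assumes R: "finite R" and N: "card R + d < N"
  shows "fact d * real N ^ d * real (card {p \<in> permutations_of_set R. inc_free d p}) =
    (\<Sum>w\<in>unity_words N d. ((cmod (sum_list w))\<^sup>2) ^ card R * sq_vandermonde w)"
proof -
  define f where "f w = ((\<Sum>z\<leftarrow>w. inverse z) * sum_list w) ^ card R" for w :: "complex list"
  have f: "f w = of_real (((cmod (sum_list w))\<^sup>2) ^ card R)" if w: "w \<in> unity_words N d" for w
  proof -
    have "(\<Sum>z\<leftarrow>w. inverse z) = cnj (sum_list w)"
    proof -
      have "\<forall>z\<in>set w. cmod z = 1"
        using w N unity_roots_norm[of _ N] by (auto simp: unity_words_def)
      then show ?thesis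
      proof (induction w)
        case (Cons z w)
        then have "inverse z = cnj z" by (simp add: cnj_eq_inverse)
        with Cons show ?case by simp
      qed simp
    qed
    then have "f w = (complex_of_real ((cmod (sum_list w))\<^sup>2)) ^ card R"
      unfolding f_def complex_norm_square by (simp add: mult.commute)
    also have "\<dots> = of_real (((cmod (sum_list w))\<^sup>2) ^ card R)" by (rule of_real_power[symmetric])
    finally show ?thesis .
  qed
  have "of_nat (N ^ d * card {p \<in> permutations_of_set R. inc_free d p}) =
      (\<Sum>w\<in>unity_words N d. f w * half_vandermonde w)"
    unfolding inc_free_iff_good
    using card_good_permutations[of "\<lambda>_. 0" R d N] R N
    by (simp add: f_def monoI power_mult_distrib ac_simps)
  then have "complex_of_real (fact d * real N ^ d * real (card {p \<in> permutations_of_set R. inc_free d p})) =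
      of_nat (fact d) * (\<Sum>w\<in>unity_words N d. f w * half_vandermonde w)"
    by simp
  also have "\<dots> = (\<Sum>w\<in>unity_words N d. f w * complex_of_real (sq_vandermonde w))"
    by (rule symmetrize_half_vandermonde[where F = "\<lambda>T. ((\<Sum>z\<in>T. inverse z) * \<Sum>T) ^ card R"])
      (use N in \<open>auto simp: f_def sum.distinct_set_conv_list\<close>)
  also have "\<dots> = complex_of_real (\<Sum>w\<in>unity_words N d. ((cmod (sum_list w))\<^sup>2) ^ card R * sq_vandermonde w)"
    by (simp add: f)
  finally show ?thesis unfolding of_real_eq_iff .
qed

lemma sum_Pow_power_card:
  fixes x :: "'a :: comm_semiring_1"
  assumes "finite X"
  shows "(\<Sum>R\<in>Pow X. x ^ card R) = (1 + x) ^ card X"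
  using assms
proof -
  have "(\<Prod>a\<in>X. x + 1) = (\<Sum>R\<in>Pow X. (\<Prod>a\<in>R. x) * (\<Prod>a\<in>X-R. 1))"
    by (rule prod_add[OF assms])
  then show ?thesis by (simp add: add.commute)
qed

text \<open>Words are grouped by their set of letters \<open>R\<close>; the binomial sum over all
  \<open>R\<close> produces the summand 1 beside the squared modulus. One \<open>N\<close> serves
  all \<open>R\<close>.\<close>

lemma card_inc_free_words:
  assumes X: "finite X" and N: "card X + d < N"
  shows "fact d * real N ^ d * real (card (inc_free_words d X)) =
    (\<Sum>w\<in>unity_words N d. (1 + (cmod (sum_list w))\<^sup>2) ^ card X * sq_vandermonde w)"
proof -
  have "inc_free_words d X = (\<Union>R\<in>Pow X. {p \<in> permutations_of_set R. inc_free d p})"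
    by (auto simp: inc_free_words_def permutations_of_set_def)
  also have "card \<dots> = (\<Sum>R\<in>Pow X. card {p \<in> permutations_of_set R. inc_free d p})"
  proof (intro card_UN_disjoint ballI impI)
    fix R S assume "R \<in> Pow X" "S \<in> Pow X" "R \<noteq> S"
    then show "{p \<in> permutations_of_set R. inc_free d p} \<inter> {p \<in> permutations_of_set S. inc_free d p} = {}"
      by (auto simp: permutations_of_set_def)
  qed (use X in simp_all)
  finally have "fact d * real N ^ d * real (card (inc_free_words d X)) =
      (\<Sum>R\<in>Pow X. fact d * real N ^ d * real (card {p \<in> permutations_of_set R. inc_free d p}))"
    by (simp add: sum_distrib_left)
  also have "\<dots> = (\<Sum>R\<in>Pow X. \<Sum>w\<in>unity_words N d. ((cmod (sum_list w))\<^sup>2) ^ card R * sq_vandermonde w)"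
  proof (rule sum.cong[OF refl])
    fix R assume "R \<in> Pow X"
    then have "finite R" "card R + d < N"
      using X N card_mono[of X R] by (auto intro: finite_subset)
    then show "fact d * real N ^ d * real (card {p \<in> permutations_of_set R. inc_free d p}) =
        (\<Sum>w\<in>unity_words N d. ((cmod (sum_list w))\<^sup>2) ^ card R * sq_vandermonde w)"
      by (rule card_inc_free_permutations)
  qed
  also have "\<dots> = (\<Sum>w\<in>unity_words N d. (1 + (cmod (sum_list w))\<^sup>2) ^ card X * sq_vandermonde w)"
    by (subst sum.swap) (simp add: sum_distrib_right[symmetric] sum_Pow_power_card[OF X])
  finally show ?thesis .
qed

section \<open>Upper and lower bounds\<close>

lemma cmod_cis_diff: "(cmod (cis a - cis b))\<^sup>2 = 4 * (sin ((a - b) / 2))\<^sup>2"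
proof -
  have "(cmod (cis a - cis b))\<^sup>2 = 2 - 2 * cos (a - b)"
    using sin_cos_squared_add[of a] sin_cos_squared_add[of b]
    unfolding cmod_power2 by (simp add: cos_diff power2_diff algebra_simps)
  also have "cos (a - b) = 1 - 2 * (sin ((a - b) / 2))\<^sup>2"
  proof -
    have "2 * ((a - b) / 2) = a - b" by simp
    then show ?thesis using cos_double_sin[of "(a - b) / 2"] by (simp only:)
  qed
  finally show ?thesis by simp
qed

text \<open>At the half angle \<open>y\<close> one has \<open>sin x = 2 * sin y * cos y\<close> and
  \<open>y * cos y \<le> sin y\<close>, and \<open>(cos y)\<^sup>2 \<ge> 1 / 2\<close> because
  \<open>y \<le> pi / 4\<close>.\<close>

lemma sin_ge_half:
  fixes x :: real
  assumes "0 \<le> x" "x \<le> pi / 2"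
  shows "x / 2 \<le> sin x"
proof -
  define y where "y = x / 2"
  have y: "0 \<le> y" "y \<le> pi / 4" using assms by (auto simp: y_def)
  have "0 * cos 0 - sin 0 \<ge> y * cos y - sin y"
  proof (rule DERIV_nonpos_imp_nonincreasing[of 0 y "\<lambda>y. y * cos y - sin y"])
    fix t assume t: "0 \<le> t" "t \<le> y"
    have "((\<lambda>y. y * cos y - sin y) has_real_derivative - (t * sin t)) (at t)"
      by (auto intro!: derivative_eq_intros)
    moreover have "0 \<le> t * sin t" using t y pi_gt_zero by (intro mult_nonneg_nonneg sin_ge_zero) auto
    ultimately show "\<exists>D. ((\<lambda>y. y * cos y - sin y) has_real_derivative D) (at t) \<and> D \<le> 0" by force
  qed (use y in auto)
  then have "y * cos y \<le> sin y" by simp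
  moreover have "0 \<le> cos y" using y pi_gt_zero by (intro cos_ge_zero) auto
  ultimately have "y * cos y * cos y \<le> sin y * cos y" by (rule mult_right_mono)
  moreover have "sin x = 2 * sin y * cos y" using sin_double[of y] by (simp add: y_def)
  moreover have "(cos y)\<^sup>2 \<ge> 1 / 2"
  proof -
    have "0 \<le> cos x" using assms pi_gt_zero by (intro cos_ge_zero) auto
    then show ?thesis using cos_double_cos[of y] by (simp add: y_def)
  qed
  then have "y * (1 / 2) \<le> y * (cos y)\<^sup>2" using y by (intro mult_left_mono)
  ultimately show ?thesis by (simp add: y_def power2_eq_square)
qed

lemma cmod_cis_diff_bounds:
  "(cmod (cis a - cis b))\<^sup>2 \<le> (a - b)\<^sup>2"
  "\<bar>a - b\<bar> \<le> pi \<Longrightarrow> (a - b)\<^sup>2 / 4 \<le> (cmod (cis a - cis b))\<^sup>2"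
proof -
  have "\<bar>sin ((a - b) / 2)\<bar> \<le> \<bar>(a - b) / 2\<bar>" by (rule abs_sin_x_le_abs_x)
  then have "(sin ((a - b) / 2))\<^sup>2 \<le> ((a - b) / 2)\<^sup>2" by (rule abs_le_square_iff[THEN iffD1])
  then show "(cmod (cis a - cis b))\<^sup>2 \<le> (a - b)\<^sup>2"
    unfolding cmod_cis_diff by (simp add: power_divide)
  assume "\<bar>a - b\<bar> \<le> pi"
  then have "\<bar>a - b\<bar> / 2 / 2 \<le> sin (\<bar>a - b\<bar> / 2)" by (intro sin_ge_half) auto
  moreover have "(sin (\<bar>a - b\<bar> / 2))\<^sup>2 = (sin ((a - b) / 2))\<^sup>2"
  proof (cases "a \<ge> b")
    case False
    then have "\<bar>a - b\<bar> / 2 = - ((a - b) / 2)" by (simp add: field_simps)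
    then show ?thesis by (simp only: sin_minus power2_minus)
  qed simp
  ultimately have "(\<bar>a - b\<bar> / 4)\<^sup>2 \<le> (sin ((a - b) / 2))\<^sup>2"
    by (metis abs_ge_zero divide_divide_eq_left divide_nonneg_pos mult_2 numeral_Bit0 numeral_times_numeral power_mono zero_less_numeral mult_numeral_1)
  then show "(a - b)\<^sup>2 / 4 \<le> (cmod (cis a - cis b))\<^sup>2"
    unfolding cmod_cis_diff by (simp add: power_divide)
qed

lemma unity_roots_rotate:
  assumes "N > 0" "a \<in> unity_roots N"
  shows "bij_betw (\<lambda>k. a * cis (2 * pi * real k / real N)) {..<N} (unity_roots N)"
proof -
  have "bij_betw ((*) a) (unity_roots N) (unity_roots N)"
    by (rule bij_betw_byWitness[where f' = "\<lambda>z. z / a"])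
      (use assms unity_roots_nonzero[OF assms(2,1)] in \<open>auto simp: unity_roots_def power_mult_distrib power_divide\<close>)
  from bij_betw_trans[OF Complex.bij_betw_roots_unity[OF assms(1), folded unity_roots_def] this]
  show ?thesis by (simp add: o_def)
qed

text \<open>By \<open>(1 + t)^2 \<le> 2 * (1 + t^2)\<close> the terms compare with differences of
  consecutive \<open>1 / (1 + g * y)\<close>, which telescope; the bound is uniform in
  \<open>N\<close>.\<close>

lemma sum_inverse_square_le:
  fixes g :: real
  assumes g: "g > 0"
  shows "(\<Sum>y\<le>N. 1 / (1 + (g * real y)\<^sup>2)) \<le> 1 + 2 / g"
proof -
  have "(\<Sum>y\<le>N. 1 / (1 + (g * real y)\<^sup>2)) \<le> 1 + (2 / g) * (1 - 1 / (1 + g * real N))"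
  proof (induction N)
    case (Suc N)
    let ?u = "1 + g * real N" and ?v = "1 + g * real (Suc N)"
    have u: "?u > 0" "?v > 0" "?u \<le> ?v" using g by (auto simp: add_pos_nonneg)
    have "?v\<^sup>2 \<le> 2 * (1 + (g * real (Suc N))\<^sup>2)"
      using zero_le_power2[of "1 - g * real (Suc N)"] by (simp only: power2_sum power2_diff) simp
    then have "1 / (1 + (g * real (Suc N))\<^sup>2) \<le> 2 / ?v\<^sup>2"
      using u by (simp add: frac_le divide_simps) (smt (verit) zero_le_power2)
    also have "\<dots> \<le> 2 / (?u * ?v)"
      using u by (intro divide_left_mono) (auto simp: power2_eq_square)
    also have "\<dots> = (2 / g) * (1 / ?u - 1 / ?v)"
    proof -
      have "1 / ?u - 1 / ?v = g / (?u * ?v)" using u by (subst diff_frac_eq) (auto simp: algebra_simps)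
      then show ?thesis using g by simp
    qed
    finally have "(\<Sum>y\<le>Suc N. 1 / (1 + (g * real y)\<^sup>2)) \<le>
        1 + (2 / g) * (1 - 1 / ?u) + (2 / g) * (1 / ?u - 1 / ?v)"
      using Suc.IH unfolding sum.atMost_Suc by linarith
    also have "\<dots> = 1 + (2 / g) * (1 - 1 / ?v)"
      by (simp only: right_diff_distrib)
    finally show ?case .
  qed simp
  also have "\<dots> \<le> 1 + (2 / g) * 1" using g by (intro add_left_mono mult_left_mono) auto
  finally show ?thesis by simp
qed

text \<open>Each root is measured along its shorter arc from \<open>a\<close>: after
  \<open>y\<close> steps the chord is at least \<open>y / N\<close>. The two directions cost two
  copies of the one-sided sum with \<open>g = sqrt c / N\<close>.\<close>

lemma sum_unity_roots_inverse_le: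
  assumes N: "N > 0" and a: "a \<in> unity_roots N" and c: "c > 0"
  shows "(\<Sum>b\<in>unity_roots N. 1 / (1 + c * (cmod (a - b))\<^sup>2)) \<le> 2 + 4 * real N / sqrt c"
proof -
  define g where "g = sqrt c / real N"
  have g: "g > 0" using N c by (simp add: g_def)
  have na: "cmod a = 1" using unity_roots_norm[OF a N] .
  have *: "(g * real y)\<^sup>2 \<le> c * (cmod (1 - cis (2 * pi * real y / real N)))\<^sup>2"
    if "2 * y \<le> N" for y
  proof -
    let ?t = "2 * pi * real y / real N"
    have "real (2 * y) \<le> real N" using that by (simp only: of_nat_le_iff)
    then have "?t \<le> pi" using N by (simp add: field_simps)
    then have "(0 - ?t)\<^sup>2 / 4 \<le> (cmod (cis 0 - cis ?t))\<^sup>2"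
      using N by (intro cmod_cis_diff_bounds(2)) simp
    then have t: "(?t / 2)\<^sup>2 \<le> (cmod (1 - cis ?t))\<^sup>2"
      by (simp add: power_divide power_mult_distrib)
    have "real y / real N \<le> ?t / 2"
      using N pi_ge_two by (simp add: field_simps) (simp add: mult_le_cancel_right1)
    then have "(real y / real N)\<^sup>2 \<le> (?t / 2)\<^sup>2" by (intro power_mono) auto
    with t have "c * (real y / real N)\<^sup>2 \<le> c * (cmod (1 - cis ?t))\<^sup>2"
      using c by (intro mult_left_mono) auto
    then show ?thesis using c by (simp add: g_def power_mult_distrib power_divide)
  qed
  have summand: "1 / (1 + c * (cmod (a - a * cis (2 * pi * real y / real N)))\<^sup>2) \<le>
      1 / (1 + (g * real y)\<^sup>2) + 1 / (1 + (g * real (N - y))\<^sup>2)" (is "?L \<le> ?A + ?B")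
    if y: "y < N" for y
  proof -
    have "a - a * cis (2 * pi * real y / real N) = a * (1 - cis (2 * pi * real y / real N))"
      by (simp add: algebra_simps)
    then have eq: "cmod (a - a * cis (2 * pi * real y / real N)) = cmod (1 - cis (2 * pi * real y / real N))"
      by (simp add: norm_mult na)
    have pos: "?A \<ge> 0" "?B \<ge> 0" by (simp_all add: add_nonneg_nonneg)
    show ?thesis
    proof (cases "2 * y \<le> N")
      case True
      have "?L \<le> ?A" unfolding eq
        using *[OF True] by (intro divide_left_mono) (auto intro!: mult_pos_pos add_pos_nonneg simp: c less_imp_le)
      then show ?thesis using pos by linarith
    next
      case False
      then have N': "2 * (N - y) \<le> N" by simp
      have "2 * pi * real (N - y) / real N = 2 * pi - 2 * pi * real y / real N"
        using y N by (simp add: of_nat_diff field_simps)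
      then have "cis (2 * pi * real (N - y) / real N) = cnj (cis (2 * pi * real y / real N))"
        by (simp add: complex_eq_iff)
      then have "1 - cis (2 * pi * real (N - y) / real N) = cnj (1 - cis (2 * pi * real y / real N))"
        by simp
      then have eq2: "cmod (1 - cis (2 * pi * real (N - y) / real N)) = cmod (1 - cis (2 * pi * real y / real N))"
        by (simp only: complex_mod_cnj)
      have "?L \<le> ?B" unfolding eq
        using *[OF N', unfolded eq2] by (intro divide_left_mono) (auto intro!: mult_pos_pos add_pos_nonneg simp: c less_imp_le)
      then show ?thesis using pos by linarith
    qed
  qed
  have "(\<Sum>b\<in>unity_roots N. 1 / (1 + c * (cmod (a - b))\<^sup>2)) =
      (\<Sum>y<N. 1 / (1 + c * (cmod (a - a * cis (2 * pi * real y / real N)))\<^sup>2))"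
    by (rule sum.reindex_bij_betw[OF unity_roots_rotate[OF N a], symmetric])
  also have "\<dots> \<le> (\<Sum>y<N. 1 / (1 + (g * real y)\<^sup>2) + 1 / (1 + (g * real (N - y))\<^sup>2))"
    using summand by (intro sum_mono) auto
  also have "\<dots> = (\<Sum>y<N. 1 / (1 + (g * real y)\<^sup>2)) + (\<Sum>y\<in>{1..N}. 1 / (1 + (g * real y)\<^sup>2))"
    unfolding sum.distrib
    by (intro arg_cong2[of _ _ _ _ "(+)"] refl sum.reindex_bij_witness[of _ "\<lambda>y. N - y" "\<lambda>y. N - y"]) auto
  also have "\<dots> \<le> (\<Sum>y\<le>N. 1 / (1 + (g * real y)\<^sup>2)) + (\<Sum>y\<le>N. 1 / (1 + (g * real y)\<^sup>2))"
    by (intro add_mono sum_mono2) (auto simp: add_nonneg_nonneg)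
  also have "\<dots> \<le> (1 + 2 / g) + (1 + 2 / g)" by (intro add_mono sum_inverse_square_le g)
  also have "\<dots> = 2 + 4 * real N / sqrt c" using N c by (simp add: g_def)
  finally show ?thesis .
qed

fun sqdist_sum :: "complex list \<Rightarrow> real" where
  "sqdist_sum [] = 0"
| "sqdist_sum (a # l) = (\<Sum>b\<leftarrow>l. (cmod (a - b))\<^sup>2) + sqdist_sum l"

lemma sum_list_sq_nonneg: "0 \<le> (\<Sum>b\<leftarrow>l. (f b)\<^sup>2 :: real)"
  by (rule sum_list_nonneg) auto

lemma sqdist_sum_nonneg: "sqdist_sum w \<ge> 0"
  by (induction w) (auto simp: add_nonneg_nonneg sum_list_sq_nonneg)

text \<open>On the unit circle \<open>2 * Re (a * cnj b)\<close> is 2 minus the squared distance. So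
  \<open>sqdist_sum\<close> is the loss against the maximum, which is attained when all letters
  coincide.\<close>

lemma cmod_sum_list_unit:
  assumes "\<forall>z\<in>set w. cmod z = 1"
  shows "(cmod (sum_list w))\<^sup>2 = (real (length w))\<^sup>2 - sqdist_sum w"
  using assms
proof (induction w)
  case (Cons a l)
  have *: "(\<Sum>b\<leftarrow>l. (cmod (a - b))\<^sup>2) = 2 * real (length l) - 2 * Re (a * cnj (sum_list l))"
  proof -
    have "\<forall>z\<in>set l. cmod z = 1" using Cons.prems by simp
    then show ?thesis
    proof (induction l)
      case (Cons b l)
      have "(cmod a)\<^sup>2 = 1" "(cmod b)\<^sup>2 = 1" using \<open>\<forall>z\<in>set (a # _). cmod z = 1\<close> Cons.prems by auto
      then have "(cmod (a - b))\<^sup>2 = 2 - 2 * Re (a * cnj b)"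
        unfolding cmod_power2 by (simp add: power2_eq_square algebra_simps)
      then show ?case using Cons by (simp add: algebra_simps)
    qed simp
  qed
  have "(cmod a)\<^sup>2 = 1" using Cons.prems by simp
  then have "(cmod (a + sum_list l))\<^sup>2 = 1 + 2 * Re (a * cnj (sum_list l)) + (cmod (sum_list l))\<^sup>2"
    unfolding cmod_power2 by (simp add: power2_eq_square algebra_simps)
  with Cons * show ?case by (simp add: power2_eq_square algebra_simps)
qed simp

lemma prod_list_le_power:
  assumes "\<forall>x\<in>set xs. 0 \<le> f x \<and> f x \<le> (t::real)" "0 \<le> t"
  shows "(\<Prod>x\<leftarrow>xs. f x) \<le> t ^ length xs"
  using assms
proof (induction xs)
  case (Cons x xs)
  then show ?case by (auto intro!: mult_mono prod_list_nonneg)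
qed simp

text \<open>Every factor is also a summand of \<open>sqdist_sum\<close>, hence at most
  \<open>t\<close>.\<close>

lemma sq_vandermonde_le: "sqdist_sum w \<le> t \<Longrightarrow> sq_vandermonde w \<le> t ^ (length w choose 2)"
proof (induction w)
  case (Cons a l)
  have t: "0 \<le> t" using Cons.prems sqdist_sum_nonneg[of "a # l"] by linarith
  have "\<forall>b\<in>set l. (cmod (a - b))\<^sup>2 \<le> t"
  proof
    fix b assume "b \<in> set l"
    then have "(cmod (a - b))\<^sup>2 \<le> (\<Sum>b\<leftarrow>l. (cmod (a - b))\<^sup>2)"
      by (intro member_le_sum_list) auto
    then show "(cmod (a - b))\<^sup>2 \<le> t" using Cons.prems sqdist_sum_nonneg[of l] by simp
  qed
  then have "(\<Prod>b\<leftarrow>l. (cmod (a - b))\<^sup>2) \<le> t ^ length l"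
    using t by (intro prod_list_le_power) auto
  moreover have "sq_vandermonde l \<le> t ^ (length l choose 2)"
    using Cons.prems sum_list_sq_nonneg[of "\<lambda>b. cmod (a - b)" l] by (intro Cons.IH) auto
  ultimately have "sq_vandermonde (a # l) \<le> t ^ length l * t ^ (length l choose 2)"
    using t sq_vandermonde_nonneg by (simp add: mult_mono)
  also have "\<dots> = t ^ (length (a # l) choose 2)" by (simp add: numeral_2_eq_2 power_add)
  finally show ?case .
qed (simp add: numeral_2_eq_2)

lemma power_exp_minus_le:
  fixes x :: real
  assumes "x \<ge> 0"
  shows "x ^ D * exp (- x) \<le> real D ^ D"
proof (cases "D = 0")
  case False
  have "(x / real D) ^ D \<le> (1 + x / real D) ^ D" using assms by (intro power_mono) auto
  also have "\<dots> \<le> exp x" using assms False by (intro exp_ge_one_plus_x_over_n_power_n) auto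
  finally have "x ^ D / real D ^ D \<le> exp x" by (simp add: power_divide)
  then show ?thesis using False by (simp add: exp_minus divide_simps mult.commute)
qed (use assms in simp)

lemma exp_sum_list_le:
  assumes "c \<ge> 0"
  shows "exp (- (c * (\<Sum>b\<leftarrow>l. (f b)\<^sup>2))) \<le> (\<Prod>b\<leftarrow>l. 1 / (1 + c * (f b)\<^sup>2 :: real))"
proof (induction l)
  case (Cons b l)
  have pos: "c * (f b)\<^sup>2 \<ge> 0" using assms by simp
  have "exp (- (c * (f b)\<^sup>2)) \<le> 1 / (1 + c * (f b)\<^sup>2)"
    using exp_ge_add_one_self[of "c * (f b)\<^sup>2"] pos by (simp add: exp_minus divide_simps)
  then have "exp (- (c * (f b)\<^sup>2)) * exp (- (c * (\<Sum>b\<leftarrow>l. (f b)\<^sup>2))) \<le>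
      1 / (1 + c * (f b)\<^sup>2) * (\<Prod>b\<leftarrow>l. 1 / (1 + c * (f b)\<^sup>2))"
    using Cons.IH pos by (intro mult_mono) auto
  then show ?case by (simp add: exp_add[symmetric] algebra_simps)
qed simp

lemma sum_unity_words_prod:
  "(\<Sum>l\<in>unity_words N m. \<Prod>b\<leftarrow>l. f b) = ((\<Sum>b\<in>unity_roots N. f b) ^ m :: 'a :: comm_semiring_1)"
proof (induction m)
  case (Suc m)
  have "(\<Sum>l\<in>unity_words N (Suc m). \<Prod>b\<leftarrow>l. f b) =
      (\<Sum>l\<in>unity_words N m. (\<Sum>b\<in>unity_roots N. f b) * (\<Prod>b\<leftarrow>l. f b))"
    by (simp add: sum_unity_words_Suc sum_distrib_right)
  then show ?case by (simp add: sum_distrib_left[symmetric] Suc)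
qed (simp add: unity_words_0)

text \<open>With \<open>S = sqdist_sum w\<close> the base is
  \<open>\<beta> - S \<le> \<beta> * exp (- S / \<beta>)\<close>. Half of the decay absorbs the
  Vandermonde factor and yields \<open>n ^ -D\<close>. The other half, kept only for pairs with the
  first letter, lets each of the other \<open>d - 1\<close> letters contribute order
  \<open>N / sqrt n\<close>, while the first runs over all \<open>N\<close> roots.\<close>

lemma sum_unity_words_upper:
  assumes d: "d \<ge> 2"
  shows "\<exists>C>0. \<forall>n\<ge>1. \<forall>N\<ge>n.
    (\<Sum>w\<in>unity_words N d. (1 + (cmod (sum_list w))\<^sup>2) ^ n * sq_vandermonde w) \<le>
    C * (real d ^ 2 + 1) ^ n * real N ^ d / (real n ^ (d choose 2) * sqrt (real n) ^ (d - 1))"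
proof -
  define \<beta> where "\<beta> = real d ^ 2 + 1"
  define D where "D = d choose 2"
  obtain m where m: "d = Suc m" using d by (cases d) auto
  have \<beta>: "\<beta> > 0" by (simp add: \<beta>_def add_nonneg_pos)
  define C1 where "C1 = (2 * \<beta> * real D) ^ D"
  define C2 where "C2 = 2 + 4 * sqrt (2 * \<beta>)"
  have "D > 0" using d by (simp add: D_def)
  then have C: "C1 > 0" "C2 > 0" using \<beta> by (auto simp: C1_def C2_def add_pos_nonneg)
  have main: "(\<Sum>w\<in>unity_words N d. (1 + (cmod (sum_list w))\<^sup>2) ^ n * sq_vandermonde w) \<le>
      C1 * C2 ^ m * \<beta> ^ n * real N ^ d / (real n ^ D * sqrt (real n) ^ m)"
    if n: "n \<ge> 1" and N: "N \<ge> n" for n N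
  proof -
    \<comment> \<open>The factor 2 splits \<open>exp (- n * S / \<beta>)\<close> into two equal
      exponentials \<open>exp (- (c * S))\<close>.\<close>
    define c where "c = real n / (2 * \<beta>)"
    have c: "c > 0" using n \<beta> by (simp add: c_def)
    have "N > 0" using n N by simp
    define E where "E = \<beta> ^ n * (C1 / real n ^ D)"
    have E: "E \<ge> 0" using \<beta> C by (simp add: E_def)
    have pt: "(1 + (cmod (sum_list w))\<^sup>2) ^ n * sq_vandermonde w \<le>
        E * (\<Prod>b\<leftarrow>l. 1 / (1 + c * (cmod (a - b))\<^sup>2))"
      if l: "l \<in> unity_words N m" and a: "a \<in> unity_roots N" and w: "w = a # l" for a l w
    proof -
      define S where "S = sqdist_sum w"
      have lw: "length w = d" using l w m by (simp add: unity_words_def)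
      have "\<forall>z\<in>set w. cmod z = 1"
        using l a w unity_roots_norm[OF _ \<open>N > 0\<close>] by (auto simp: unity_words_def)
      then have sum: "1 + (cmod (sum_list w))\<^sup>2 = \<beta> - S"
        using cmod_sum_list_unit[of w] lw by (simp add: S_def \<beta>_def)
      have S0: "S \<ge> 0" by (simp add: S_def sqdist_sum_nonneg)
      have "0 \<le> \<beta> - S" unfolding sum[symmetric] by (simp add: add_nonneg_nonneg)
      moreover have "\<beta> - S \<le> \<beta> * exp (- S / \<beta>)"
        using exp_ge_add_one_self[of "- S / \<beta>"] \<beta> by (simp add: field_simps)
      ultimately have "(\<beta> - S) ^ n \<le> (\<beta> * exp (- S / \<beta>)) ^ n" by (intro power_mono)
      also have "\<dots> = \<beta> ^ n * (exp (- (c * S)) * exp (- (c * S)))"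
      proof -
        have "real n * (- S / \<beta>) = - (c * S) + - (c * S)" using \<beta> by (simp add: c_def field_simps)
        then show ?thesis
          by (simp only: power_mult_distrib exp_of_nat_mult[symmetric] exp_add[symmetric])
      qed
      finally have "(1 + (cmod (sum_list w))\<^sup>2) ^ n \<le> \<beta> ^ n * (exp (- (c * S)) * exp (- (c * S)))"
        unfolding sum .
      moreover have "sq_vandermonde w \<le> S ^ D"
        using sq_vandermonde_le[of w S] by (simp add: S_def D_def lw)
      ultimately have "(1 + (cmod (sum_list w))\<^sup>2) ^ n * sq_vandermonde w \<le>
          \<beta> ^ n * (exp (- (c * S)) * exp (- (c * S))) * S ^ D"
        using \<beta> sq_vandermonde_nonneg by (intro mult_mono) auto
      also have "\<dots> = \<beta> ^ n * (S ^ D * exp (- (c * S))) * exp (- (c * S))" by (simp add: mult_ac)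
      also have "\<dots> \<le> \<beta> ^ n * (C1 / real n ^ D) * exp (- (c * S))"
      proof -
        have "(c * S) ^ D * exp (- (c * S)) \<le> real D ^ D"
          using c S0 by (intro power_exp_minus_le) simp
        then have "(1 / c ^ D) * ((c * S) ^ D * exp (- (c * S))) \<le> (1 / c ^ D) * real D ^ D"
          using c by (intro mult_left_mono) auto
        moreover have "(1 / c ^ D) * real D ^ D = C1 / real n ^ D"
          using \<beta> n by (simp add: c_def C1_def power_mult_distrib power_divide)
        moreover have "(1 / c ^ D) * ((c * S) ^ D * exp (- (c * S))) = S ^ D * exp (- (c * S))"
          using c by (simp add: power_mult_distrib)
        ultimately show ?thesis using \<beta> by (intro mult_right_mono mult_left_mono) auto
      qed
      also have "\<dots> \<le> E * (\<Prod>b\<leftarrow>l. 1 / (1 + c * (cmod (a - b))\<^sup>2))"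
        unfolding E_def[symmetric]
      proof (rule mult_left_mono[OF _ E])
        have "exp (- (c * S)) \<le> exp (- (c * (\<Sum>b\<leftarrow>l. (cmod (a - b))\<^sup>2)))"
          using c sqdist_sum_nonneg[of l] by (simp add: S_def w)
        also have "\<dots> \<le> (\<Prod>b\<leftarrow>l. 1 / (1 + c * (cmod (a - b))\<^sup>2))"
          using c by (intro exp_sum_list_le) simp
        finally show "exp (- (c * S)) \<le> (\<Prod>b\<leftarrow>l. 1 / (1 + c * (cmod (a - b))\<^sup>2))" .
      qed
      finally show ?thesis .
    qed
    have sqn: "sqrt (real n) > 0" using n by simp
    have one: "(\<Sum>b\<in>unity_roots N. 1 / (1 + c * (cmod (a - b))\<^sup>2)) \<le> C2 * real N / sqrt (real n)"
      if a: "a \<in> unity_roots N" for a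
    proof -
      have "(\<Sum>b\<in>unity_roots N. 1 / (1 + c * (cmod (a - b))\<^sup>2)) \<le> 2 + 4 * real N / sqrt c"
        by (rule sum_unity_roots_inverse_le[OF \<open>N > 0\<close> a c])
      also have "4 * real N / sqrt c = 4 * sqrt (2 * \<beta>) * real N / sqrt (real n)"
        using n \<beta> by (simp add: c_def real_sqrt_divide)
      \<comment> \<open>The constant 2 is absorbed because
        \<open>N \<ge> n \<ge> sqrt n\<close>.\<close>
      also have "2 + \<dots> \<le> 2 * real N / sqrt (real n) + 4 * sqrt (2 * \<beta>) * real N / sqrt (real n)"
      proof (rule add_right_mono)
        have "sqrt (real n) \<le> real n" using n by (intro real_le_lsqrt) (auto simp: power2_eq_square)
        then have "sqrt (real n) \<le> real N" using N by linarith
        then show "2 \<le> 2 * real N / sqrt (real n)" using sqn by (simp add: field_simps)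
      qed
      also have "\<dots> = C2 * real N / sqrt (real n)"
        by (simp only: C2_def add_divide_distrib distrib_right)
      finally show ?thesis .
    qed
    have "(\<Sum>w\<in>unity_words N d. (1 + (cmod (sum_list w))\<^sup>2) ^ n * sq_vandermonde w) \<le>
        (\<Sum>l\<in>unity_words N m. \<Sum>a\<in>unity_roots N. E * (\<Prod>b\<leftarrow>l. 1 / (1 + c * (cmod (a - b))\<^sup>2)))"
      unfolding m sum_unity_words_Suc by (intro sum_mono pt) auto
    also have "\<dots> = (\<Sum>a\<in>unity_roots N. E * (\<Sum>b\<in>unity_roots N. 1 / (1 + c * (cmod (a - b))\<^sup>2)) ^ m)"
      by (subst sum.swap) (simp add: sum_distrib_left[symmetric] sum_unity_words_prod)
    also have "\<dots> \<le> (\<Sum>a\<in>unity_roots N. E * (C2 * real N / sqrt (real n)) ^ m)"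
      using one E c by (intro sum_mono mult_left_mono power_mono sum_nonneg) auto
    also have "\<dots> = real N * (E * (C2 * real N / sqrt (real n)) ^ m)"
      using card_unity_roots[OF \<open>N > 0\<close>] by simp
    also have "\<dots> = C1 * C2 ^ m * \<beta> ^ n * real N ^ d / (real n ^ D * sqrt (real n) ^ m)"
      by (simp add: E_def m power_divide power_mult_distrib)
    finally show ?thesis .
  qed
  show ?thesis
    by (rule exI[of _ "C1 * C2 ^ m"]) (use C main in \<open>simp add: \<beta>_def D_def m\<close>)
qed

section \<open>Lower bound from separated words in a short arc\<close>

lemma sq_vandermonde_ge:
  assumes "sorted_wrt (\<lambda>u v. \<delta> \<le> (cmod (u - v))\<^sup>2) w" "\<delta> \<ge> 0"
  shows "\<delta> ^ (length w choose 2) \<le> sq_vandermonde w"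
  using assms
proof (induction w)
  case (Cons a l)
  have "\<delta> ^ length l \<le> (\<Prod>b\<leftarrow>l. (cmod (a - b))\<^sup>2)"
    using Cons.prems
  proof (induction l)
    case (Cons b l)
    then show ?case by (auto intro!: mult_mono)
  qed simp
  then have "\<delta> ^ length l * \<delta> ^ (length l choose 2) \<le> sq_vandermonde (a # l)"
    using Cons by (auto intro!: mult_mono prod_list_nonneg)
  then show ?case by (simp add: numeral_2_eq_2 power_add)
qed (simp add: numeral_2_eq_2)

lemma sqdist_sum_le:
  assumes "sorted_wrt (\<lambda>u v. (cmod (u - v))\<^sup>2 \<le> \<Gamma>) w"
  shows "sqdist_sum w \<le> real (length w choose 2) * \<Gamma>"
  using assms
proof (induction w)
  case (Cons a l)
  have "(\<Sum>b\<leftarrow>l. (cmod (a - b))\<^sup>2) \<le> real (length l) * \<Gamma>"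
    using Cons.prems
  proof (induction l)
    case (Cons b l)
    then show ?case by (auto simp: algebra_simps)
  qed simp
  then have "sqdist_sum (a # l) \<le> real (length l) * \<Gamma> + real (length l choose 2) * \<Gamma>"
    using Cons by auto
  then show ?case by (simp add: numeral_2_eq_2 algebra_simps)
qed (simp add: numeral_2_eq_2)

lemma listset_mem: "l \<in> listset As \<Longrightarrow> v \<in> set l \<Longrightarrow> \<exists>B\<in>set As. v \<in> B"
proof (induction As arbitrary: l)
  case (Cons A As)
  then show ?case by (fastforce simp: set_Cons_def)
qed simp

lemma listset_length: "l \<in> listset As \<Longrightarrow> length l = length As"
  by (induction As arbitrary: l) (auto simp: set_Cons_def)

lemma listset_sorted_wrt:
  assumes "l \<in> listset As" "sorted_wrt (\<lambda>A B. \<forall>u\<in>A. \<forall>v\<in>B. R u v) As"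
  shows "sorted_wrt R l"
  using assms
proof (induction As arbitrary: l)
  case (Cons A As)
  then obtain u l' where l: "l = u # l'" "u \<in> A" "l' \<in> listset As" by (auto simp: set_Cons_def)
  have "R u v" if "v \<in> set l'" for v
    using listset_mem[OF l(3) that] Cons.prems(2) l(2) by auto
  then show ?case using Cons l by auto
qed simp

lemma card_listset: "card (listset As) = (\<Prod>A\<leftarrow>As. card A)"
proof (induction As)
  case (Cons A As)
  have "set_Cons A (listset As) = (\<lambda>(a, l). a # l) ` (A \<times> listset As)"
    by (auto simp: set_Cons_def)
  then have "card (set_Cons A (listset As)) = card (A \<times> listset As)"
    by (simp add: card_image inj_on_def)
  then show ?case using Cons by (simp add: card_cartesian_product)
qed simp

text \<open>Only words with letters in \<open>d\<close> separated blocks at scale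
  \<open>1 / sqrt n\<close> are kept. There the Vandermonde factor has order at least
  \<open>n ^ -D\<close>, the \<open>n\<close>-th power of the base loses at most a factor 2 against
  its maximum, and \<open>N * q ^ (d - 1)\<close> words remain.\<close>

lemma sum_unity_words_lower:
  assumes d: "d \<ge> 2"
  shows "\<exists>c>0. \<forall>n\<ge>1. \<exists>N>n+d.
    c * (real d ^ 2 + 1) ^ n * real N ^ d / (real n ^ (d choose 2) * sqrt (real n) ^ (d - 1)) \<le>
    (\<Sum>w\<in>unity_words N d. (1 + (cmod (sum_list w))\<^sup>2) ^ n * sq_vandermonde w)"
proof -
  define \<beta> where "\<beta> = real d ^ 2 + 1"
  define D where "D = d choose 2"
  obtain m where m: "d = Suc m" using d by (cases d) auto
  have \<beta>: "\<beta> \<ge> 1" by (simp add: \<beta>_def)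
  have D: "D > 0" using d by (simp add: D_def)
  \<comment> \<open>Chosen so that \<open>D * \<Gamma> = (M / 2) / s^2\<close>, which is at most
    \<open>1 / (2 * n)\<close> once \<open>s^2 \<ge> M * n\<close>.\<close>
  define M where "M = 512 * real D * (real d)\<^sup>2"
  have M: "M \<ge> 512 * (real d)\<^sup>2" "M > 0" using D d unfolding M_def
    by (simp_all add: mult_le_cancel_right1)
  define c where "c = 1 / (2 * (2 * sqrt M) ^ m * (4 * M) ^ D)"
  have c: "c > 0" using M by (simp add: c_def)
  have main: "\<exists>N>n+d. c * \<beta> ^ n * real N ^ d / (real n ^ D * sqrt (real n) ^ m) \<le>
    (\<Sum>w\<in>unity_words N d. (1 + (cmod (sum_list w))\<^sup>2) ^ n * sq_vandermonde w)" if n: "n \<ge> 1" for n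
  proof -
    define s where "s = nat \<lceil>sqrt (M * real n)\<rceil>"
    have Mn: "M * real n \<ge> M" using M n by simp
    have "sqrt (M * real n) \<le> real s" unfolding s_def by (rule real_nat_ceiling_ge)
    then have s1: "M * real n \<le> (real s)\<^sup>2" by (rule sqrt_le_D)
    have "1 \<le> (real d)\<^sup>2" using d by (intro one_le_power) simp
    then have "M * real n \<ge> 1" using Mn M by linarith
    then have "1 \<le> sqrt (M * real n)" by simp
    then have s2: "real s \<le> 2 * sqrt (M * real n)"
      unfolding s_def by linarith
    then have "(real s)\<^sup>2 \<le> (2 * sqrt (M * real n))\<^sup>2" by (intro power_mono) auto
    then have s3: "(real s)\<^sup>2 \<le> 4 * M * real n" using M by (simp add: power_mult_distrib)
    have "16 * (real d)\<^sup>2 \<le> (real s)\<^sup>2" using s1 Mn M zero_le_power2[of "real d"] by linarith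
    then have "(4 * real d)\<^sup>2 \<le> (real s)\<^sup>2" by (simp add: power_mult_distrib)
    then have "4 * real d \<le> real s" by (rule power2_le_imp_le) simp
    then have s4: "4 * d \<le> s" by linarith
    then have s0: "s > 0" using d by simp
    \<comment> \<open>The number of roots in a block, spanning the angle \<open>2 * pi / s\<close>.
      Exceeding \<open>n + d\<close> makes \<open>N = q * s\<close> admissible in the counting
      formula.\<close>
    define q where "q = n + d + 1"
    define N where "N = q * s"
    have q0: "q > 0" by (simp add: q_def)
    have "q * 1 \<le> q * s" using s0 by (intro mult_le_mono2) simp
    then have N: "N > n + d" by (simp add: N_def q_def)
    then have N0: "N > 0" by simp
    \<comment> \<open>Letters of different blocks are between \<open>q\<close> and
      \<open>2 * d * q\<close> steps apart, so their angle lies between \<open>2 * pi / s\<close>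
      and \<open>4 * pi * d / s\<close>. Then \<open>pi < 4\<close> gives the constant 256, and
      \<open>4 * d \<le> s\<close> keeps the angle within \<open>pi\<close>.\<close>
    define \<delta> where "\<delta> = 1 / (real s)\<^sup>2"
    define \<Gamma> where "\<Gamma> = 256 * (real d)\<^sup>2 / (real s)\<^sup>2"
    \<comment> \<open>Block 0 is a single point, so the head of each word is \<open>a\<close> and
      the families for different \<open>a\<close> are disjoint. Between blocks, stretches of
      \<open>q\<close> roots stay empty.\<close>
    define I where "I i = (if i = 0 then {0} else {2 * i * q..<(2 * i + 1) * q})" for i
    have I: "2 * i * q \<le> y \<and> y < (2 * i + 1) * q" if "y \<in> I i" for i y
      using that by (auto simp: I_def q_def split: if_splits)
    have Iq: "y < N" if "y \<in> I i" "i < d" for i y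
    proof -
      have "y < (2 * i + 1) * q" using I[OF that(1)] by simp
      also have "\<dots> \<le> s * q" using that(2) s4 by (intro mult_le_mono1) simp
      finally show ?thesis by (simp add: N_def mult.commute)
    qed
    define \<phi> where "\<phi> a k = a * cis (2 * pi * real k / real N)" for a and k :: nat
    define As where "As a = map (\<lambda>i. \<phi> a ` I i) [0..<d]" for a
    have pair: "\<delta> \<le> (cmod (\<phi> a y - \<phi> a y'))\<^sup>2 \<and> (cmod (\<phi> a y - \<phi> a y'))\<^sup>2 \<le> \<Gamma>"
      if a: "a \<in> unity_roots N" and ij: "i < j" "j < d" and y: "y \<in> I i" "y' \<in> I j" for a i j y y'
    proof -
      have "(2 * i + 1) * q + q \<le> 2 * j * q" using mult_le_mono1[of "2 * i + 2" "2 * j" q] ij by simp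
      then have lo: "y + q \<le> y'" using I[OF y(1)] I[OF y(2)] by linarith
      have "(2 * j + 1) * q \<le> 2 * d * q" using ij by (intro mult_le_mono1) simp
      then have hi: "y' \<le> y + 2 * d * q" using I[OF y(2)] by linarith
      define \<alpha> where "\<alpha> = 2 * pi * real y' / real N - 2 * pi * real y / real N"
      have \<alpha>: "\<alpha> = 2 * pi * (real y' - real y) / real N"
        by (simp add: \<alpha>_def right_diff_distrib diff_divide_distrib)
      have "real q \<le> real y' - real y" using lo by linarith
      then have "2 * pi * real q / real N \<le> \<alpha>" unfolding \<alpha> by (intro divide_right_mono mult_left_mono) auto
      moreover have "2 * pi * real q / real N = 2 * pi / real s" using q0 by (simp add: N_def)
      ultimately have \<alpha>1: "2 * pi / real s \<le> \<alpha>" by simp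
      have "real y' - real y \<le> real (2 * d * q)" using hi by linarith
      then have "\<alpha> \<le> 2 * pi * real (2 * d * q) / real N" unfolding \<alpha> by (intro divide_right_mono mult_left_mono) auto
      also have "\<dots> = 4 * pi * real d / real s" using q0 by (simp add: N_def)
      finally have \<alpha>2: "\<alpha> \<le> 4 * pi * real d / real s" .
      also have "\<dots> = pi * (4 * real d / real s)" by simp
      also have "\<dots> \<le> pi * 1" using s0 \<open>4 * real d \<le> real s\<close> by (intro mult_left_mono) auto
      finally have \<alpha>3: "\<alpha> \<le> pi" by simp
      have \<alpha>0: "0 \<le> \<alpha>" using \<alpha>1 by (rule order_trans[rotated]) simp
      have "\<phi> a y - \<phi> a y' = a * (cis (2 * pi * real y / real N) - cis (2 * pi * real y' / real N))"
        by (simp add: \<phi>_def right_diff_distrib)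
      then have e: "cmod (\<phi> a y - \<phi> a y') = cmod (cis (2 * pi * real y / real N) - cis (2 * pi * real y' / real N))"
        using unity_roots_norm[OF a N0] by (simp add: norm_mult)
      have diff: "2 * pi * real y / real N - 2 * pi * real y' / real N = - \<alpha>" by (simp add: \<alpha>_def)
      have "\<alpha>\<^sup>2 / 4 \<le> (cmod (\<phi> a y - \<phi> a y'))\<^sup>2"
        using cmod_cis_diff_bounds(2)[of "2 * pi * real y / real N" "2 * pi * real y' / real N"] \<alpha>0 \<alpha>3
        unfolding e diff by simp
      moreover have "(cmod (\<phi> a y - \<phi> a y'))\<^sup>2 \<le> \<alpha>\<^sup>2"
        using cmod_cis_diff_bounds(1)[of "2 * pi * real y / real N" "2 * pi * real y' / real N"]
        unfolding e diff by simp
      moreover have "\<delta> \<le> \<alpha>\<^sup>2 / 4"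
      proof -
        have "2 * 1 / real s \<le> 2 * pi / real s" using pi_ge_two s0 by (intro divide_right_mono mult_left_mono) auto
        then have "(2 / real s)\<^sup>2 \<le> \<alpha>\<^sup>2" using \<alpha>1 by (intro power_mono) auto
        then show ?thesis by (simp add: \<delta>_def power_divide)
      qed
      moreover have "\<alpha>\<^sup>2 \<le> \<Gamma>"
      proof -
        have "4 * pi * real d / real s \<le> 4 * 4 * real d / real s"
          using pi_less_4 by (intro divide_right_mono mult_right_mono mult_left_mono) auto
        then have "\<alpha>\<^sup>2 \<le> (16 * real d / real s)\<^sup>2" using \<alpha>0 \<alpha>2 by (intro power_mono) auto
        then show ?thesis by (simp add: \<Gamma>_def power_divide power_mult_distrib)
      qed
      ultimately show ?thesis by linarith
    qed
    define val where "val = \<beta> ^ n / 2 * \<delta> ^ D"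
    have val: "val \<le> (1 + (cmod (sum_list w))\<^sup>2) ^ n * sq_vandermonde w"
      if a: "a \<in> unity_roots N" and w: "w \<in> listset (As a)" "w \<in> unity_words N d" for a w
    proof -
      have "sorted_wrt (\<lambda>A B. \<forall>u\<in>A. \<forall>v\<in>B. \<delta> \<le> (cmod (u - v))\<^sup>2 \<and> (cmod (u - v))\<^sup>2 \<le> \<Gamma>) (As a)"
        unfolding As_def sorted_wrt_map using pair[OF a]
        by (auto simp: sorted_wrt_iff_nth_less)
      then have sw: "sorted_wrt (\<lambda>u v. \<delta> \<le> (cmod (u - v))\<^sup>2 \<and> (cmod (u - v))\<^sup>2 \<le> \<Gamma>) w"
        by (rule listset_sorted_wrt[OF w(1)])
      have lw: "length w = d" using w(2) by (simp add: unity_words_def)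
      have "\<delta> ^ D \<le> sq_vandermonde w"
        using sq_vandermonde_ge[of \<delta> w] sorted_wrt_mono_rel[OF _ sw] lw by (auto simp: D_def \<delta>_def)
      moreover have "\<beta> ^ n / 2 \<le> (1 + (cmod (sum_list w))\<^sup>2) ^ n"
      proof -
        define S where "S = sqdist_sum w"
        have "\<forall>z\<in>set w. cmod z = 1"
          using w(2) unity_roots_norm[OF _ N0] by (auto simp: unity_words_def)
        then have sum: "1 + (cmod (sum_list w))\<^sup>2 = \<beta> - S"
          using cmod_sum_list_unit[of w] lw by (simp add: S_def \<beta>_def)
        have "S \<le> real D * \<Gamma>"
          using sqdist_sum_le[of \<Gamma> w] sorted_wrt_mono_rel[OF _ sw] lw by (auto simp: D_def S_def)
        also have "\<dots> = (M / 2) / (real s)\<^sup>2" by (simp add: \<Gamma>_def M_def)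
        also have "\<dots> \<le> (M / 2) / (M * real n)" using s1 M n s0 by (intro divide_left_mono) auto
        also have "\<dots> = 1 / (2 * real n)" using M by simp
        finally have S: "real n * S \<le> 1 / 2" using n by (simp add: field_simps)
        have S0: "S \<ge> 0" by (simp add: S_def sqdist_sum_nonneg)
        have "S * 1 \<le> S * real n" using n S0 by (intro mult_left_mono) auto
        then have "S / \<beta> \<le> 1" using S \<beta> by (simp add: field_simps)
        \<comment> \<open>Bernoulli's inequality with \<open>n * S \<le> 1 / 2\<close> preserves at
          least half of \<open>\<beta> ^ n\<close>.\<close>
        then have "1 + real n * (- (S / \<beta>)) \<le> (1 + - (S / \<beta>)) ^ n"
          by (intro Bernoulli_inequality) simp
        moreover have "real n * (S / \<beta>) \<le> 1 / 2"
        proof -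
          have "real n * S / \<beta> \<le> real n * S / 1" using \<beta> S0 by (intro divide_left_mono) auto
          then have "real n * S / \<beta> \<le> 1 / 2" using S by linarith
          then show ?thesis by (simp only: times_divide_eq_right)
        qed
        ultimately have "1 / 2 \<le> (1 - S / \<beta>) ^ n" by simp
        then have "\<beta> ^ n * (1 / 2) \<le> \<beta> ^ n * (1 - S / \<beta>) ^ n" using \<beta> by (intro mult_left_mono) auto
        also have "\<dots> = (\<beta> - S) ^ n"
        proof -
          have "\<beta> * (1 - S / \<beta>) = \<beta> - S" using \<beta> by (simp add: field_simps)
          then show ?thesis by (metis power_mult_distrib)
        qed
        finally show ?thesis unfolding sum by simp
      qed
      ultimately show ?thesis
        unfolding val_def using \<beta> by (intro mult_mono) (auto simp: \<delta>_def add_nonneg_nonneg)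
    qed
    have inj: "inj_on (\<phi> a) {..<N}" and im: "\<phi> a ` {..<N} = unity_roots N" if "a \<in> unity_roots N" for a
      using unity_roots_rotate[OF N0 that] by (simp_all add: bij_betw_def \<phi>_def[abs_def])
    have subU: "\<phi> a ` I i \<subseteq> unity_roots N" if "a \<in> unity_roots N" "i < d" for a i
      using Iq[OF _ that(2)] im[OF that(1)] by auto
    have As_words: "listset (As a) \<subseteq> unity_words N d" if a: "a \<in> unity_roots N" for a
    proof
      fix w assume w: "w \<in> listset (As a)"
      have "set w \<subseteq> unity_roots N"
      proof
        fix v assume "v \<in> set w"
        then obtain B where "B \<in> set (As a)" "v \<in> B" using listset_mem[OF w] by blast
        then show "v \<in> unity_roots N" using subU[OF a] by (fastforce simp: As_def)
      qed
      moreover have "length w = d" using listset_length[OF w] by (simp add: As_def)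
      ultimately show "w \<in> unity_words N d" by (simp add: unity_words_def)
    qed
    have upt: "[0..<d] = 0 # [1..<d]" using d by (simp add: upt_conv_Cons)
    have card_As: "card (listset (As a)) = q ^ m" if a: "a \<in> unity_roots N" for a
    proof -
      have "card (\<phi> a ` I i) = (if i = 0 then 1 else q)" if "i < d" for i
      proof -
        have "I i \<subseteq> {..<N}" using Iq[OF _ that] by auto
        then have "card (\<phi> a ` I i) = card (I i)" by (intro card_image inj_on_subset[OF inj[OF a]])
        then show ?thesis by (auto simp: I_def algebra_simps)
      qed
      then have "map card (As a) = map (\<lambda>i. if i = 0 then 1 else q) [0..<d]" by (simp add: As_def)
      also have "\<dots> = 1 # map (\<lambda>i. q) [1..<d]" unfolding upt by simp
      also have "map (\<lambda>i. q) [1..<d] = replicate m q" by (simp add: map_replicate_const m del: upt_Suc)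
      finally show ?thesis unfolding card_listset by simp
    qed
    have hd_As: "hd w = a" if "w \<in> listset (As a)" for w a
      using that unfolding As_def upt by (auto simp: set_Cons_def I_def \<phi>_def)
    define G where "G = (\<Union>a\<in>unity_roots N. listset (As a))"
    have G: "G \<subseteq> unity_words N d" using As_words by (auto simp: G_def)
    have "card G = (\<Sum>a\<in>unity_roots N. card (listset (As a)))"
      unfolding G_def
    proof (intro card_UN_disjoint ballI impI finite_unity_roots N0)
      fix a assume "a \<in> unity_roots N"
      then show "finite (listset (As a))" using As_words finite_unity_words[OF N0] finite_subset by blast
    next
      fix a b :: complex assume "a \<noteq> b"
      then show "listset (As a) \<inter> listset (As b) = {}" using hd_As by auto
    qed
    also have "\<dots> = N * q ^ m" using card_As card_unity_roots[OF N0] by simp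
    finally have cG: "card G = N * q ^ m" .
    have "real (card G) * val \<le> (\<Sum>w\<in>G. (1 + (cmod (sum_list w))\<^sup>2) ^ n * sq_vandermonde w)"
      by (rule sum_bounded_below) (use val G in \<open>auto simp: G_def\<close>)
    also have "\<dots> \<le> (\<Sum>w\<in>unity_words N d. (1 + (cmod (sum_list w))\<^sup>2) ^ n * sq_vandermonde w)"
      using G finite_unity_words[OF N0]
      by (intro sum_mono2) (auto intro!: mult_nonneg_nonneg add_nonneg_nonneg zero_le_power sq_vandermonde_nonneg)
    finally have low: "real (card G) * val \<le> \<dots>" .
    have "real (card G) * val = \<beta> ^ n * real N ^ d / (2 * real s ^ m * ((real s)\<^sup>2) ^ D)"
    proof -
      have "real q = real N / real s" using s0 by (simp add: N_def)
      then have "real (card G) = real N * (real N / real s) ^ m" unfolding cG by simp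
      then show ?thesis by (simp add: val_def \<delta>_def m power_divide mult_ac)
    qed
    moreover have "\<beta> ^ n * real N ^ d / (2 * (2 * sqrt (M * real n)) ^ m * (4 * M * real n) ^ D) \<le>
        \<beta> ^ n * real N ^ d / (2 * real s ^ m * ((real s)\<^sup>2) ^ D)"
      using s2 s3 s0 \<beta> M n
      by (intro divide_left_mono mult_mono power_mono mult_pos_pos) auto
    moreover have "\<beta> ^ n * real N ^ d / (2 * (2 * sqrt (M * real n)) ^ m * (4 * M * real n) ^ D) =
        c * \<beta> ^ n * real N ^ d / (real n ^ D * sqrt (real n) ^ m)"
      by (simp add: c_def real_sqrt_mult power_mult_distrib mult_ac)
    ultimately show ?thesis using low N by (intro exI[of _ N]) simp
  qed
  show ?thesis
    by (rule exI[of _ c]) (use c main in \<open>simp add: \<beta>_def D_def m\<close>)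
qed

text \<open>The lower sum bound holds for some \<open>N\<close>, the upper one for all
  \<open>N \<ge> n\<close>; after division by \<open>fact d * N ^ d\<close> both concern the same
  count. Odd \<open>d\<close> makes \<open>sqrt n ^ (d - 1)\<close> an integral power of
  \<open>n\<close>, and \<open>r\<close> equals \<open>(d^2 - 1) / 2\<close>.\<close>

lemma card_inc_free_words_bounds:
  assumes d: "odd d" "d \<ge> 3"
  defines "r \<equiv> (d choose 2) + (d - 1) div 2"
  shows "\<exists>c>0. \<exists>C>0. \<forall>X :: nat set. finite X \<longrightarrow> X \<noteq> {} \<longrightarrow>
    c * (real d ^ 2 + 1) ^ card X / real (card X) ^ r \<le> real (card (inc_free_words d X)) \<and>
    real (card (inc_free_words d X)) \<le> C * (real d ^ 2 + 1) ^ card X / real (card X) ^ r"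
proof -
  define \<beta> where "\<beta> = real d ^ 2 + 1"
  obtain h where h: "d = 2 * h + 1" using d(1) by (elim oddE)
  have sq: "real n ^ (d choose 2) * sqrt (real n) ^ (d - 1) = real n ^ r" for n
    by (simp add: h r_def power_add power_mult)
  obtain c where c: "c > 0" "\<And>n. n \<ge> 1 \<Longrightarrow> \<exists>N>n+d. c * \<beta> ^ n * real N ^ d / real n ^ r \<le>
    (\<Sum>w\<in>unity_words N d. (1 + (cmod (sum_list w))\<^sup>2) ^ n * sq_vandermonde w)"
    using sum_unity_words_lower[of d] d(2) unfolding sq \<beta>_def by auto
  obtain C where C: "C > 0" "\<And>n N. n \<ge> 1 \<Longrightarrow> N \<ge> n \<Longrightarrow>
    (\<Sum>w\<in>unity_words N d. (1 + (cmod (sum_list w))\<^sup>2) ^ n * sq_vandermonde w) \<le>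
    C * \<beta> ^ n * real N ^ d / real n ^ r"
    using sum_unity_words_upper[of d] d(2) unfolding sq \<beta>_def by auto
  show ?thesis
  proof (rule exI[of _ "c / fact d"], rule conjI, simp add: c, rule exI[of _ "C / fact d"],
      rule conjI, simp add: C, intro allI impI)
    fix X :: "nat set" assume X: "finite X" "X \<noteq> {}"
    define n where "n = card X"
    have n: "n \<ge> 1" using X by (simp add: n_def Suc_le_eq card_gt_0_iff)
    obtain N where N: "N > n + d" "c * \<beta> ^ n * real N ^ d / real n ^ r \<le>
      (\<Sum>w\<in>unity_words N d. (1 + (cmod (sum_list w))\<^sup>2) ^ n * sq_vandermonde w)"
      using c(2)[OF n] by blast
    have eq: "(\<Sum>w\<in>unity_words N d. (1 + (cmod (sum_list w))\<^sup>2) ^ n * sq_vandermonde w) =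
        fact d * real N ^ d * real (card (inc_free_words d X))"
      using card_inc_free_words[OF X(1), of d N] N(1) by (simp add: n_def)
    have "c * \<beta> ^ n * real N ^ d / real n ^ r \<le> fact d * real N ^ d * real (card (inc_free_words d X))"
      using N(2) unfolding eq .
    moreover have "fact d * real N ^ d * real (card (inc_free_words d X)) \<le> C * \<beta> ^ n * real N ^ d / real n ^ r"
      using C(2)[OF n, of N] N(1) unfolding eq by simp
    moreover have "real N ^ d > 0" "real n ^ r > 0" using N(1) n by auto
    ultimately show "c / fact d * (real d ^ 2 + 1) ^ card X / real (card X) ^ r \<le> real (card (inc_free_words d X)) \<and>
      real (card (inc_free_words d X)) \<le> C / fact d * (real d ^ 2 + 1) ^ card X / real (card X) ^ r"
      unfolding \<beta>_def[symmetric] n_def[symmetric] by (simp add: field_simps)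
  qed
qed

section \<open>Algebraic power series\<close>

text \<open>Equations become polynomials over polynomials, which makes composition and division of
  all coefficients by a common factor available.\<close>

definition fps_eval_poly2 :: "complex poly poly \<Rightarrow> complex fps \<Rightarrow> complex fps" where
  "fps_eval_poly2 r A = poly (map_poly fps_of_poly r) A"

lemma fps_eval_poly2_simps:
  "fps_eval_poly2 0 A = 0"
  "fps_eval_poly2 (pCons p r) A = fps_of_poly p + A * fps_eval_poly2 r A"
  "fps_eval_poly2 (r + s) A = fps_eval_poly2 r A + fps_eval_poly2 s A"
  "fps_eval_poly2 (smult p r) A = fps_of_poly p * fps_eval_poly2 r A"
proof -
  show "fps_eval_poly2 0 A = 0" by (simp add: fps_eval_poly2_def)
  show "fps_eval_poly2 (pCons p r) A = fps_of_poly p + A * fps_eval_poly2 r A"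
    by (simp add: fps_eval_poly2_def map_poly_pCons)
  have "map_poly fps_of_poly (r + s) = map_poly fps_of_poly r + map_poly fps_of_poly s"
    by (intro poly_eqI) (simp add: coeff_map_poly fps_of_poly_add)
  then show "fps_eval_poly2 (r + s) A = fps_eval_poly2 r A + fps_eval_poly2 s A"
    by (simp add: fps_eval_poly2_def)
  show "fps_eval_poly2 (smult p r) A = fps_of_poly p * fps_eval_poly2 r A"
    by (simp add: fps_eval_poly2_def map_poly_smult fps_of_poly_mult)
qed

lemma fps_eval_poly2_altdef:
  "fps_eval_poly2 r A = (\<Sum>j\<le>degree r. fps_of_poly (coeff r j) * A ^ j)"
proof -
  have "degree (map_poly fps_of_poly r) = degree r"
    by (rule degree_map_poly) (metis fps_of_poly_0 fps_of_poly_eq_iff)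
  then show ?thesis by (simp add: fps_eval_poly2_def poly_altdef coeff_map_poly)
qed

lemma algebraic_fps_iff: "algebraic_fps A \<longleftrightarrow> (\<exists>r. r \<noteq> 0 \<and> fps_eval_poly2 r A = 0)"
proof
  assume "algebraic_fps A"
  then obtain d P where P: "\<exists>j\<le>d. P j \<noteq> 0" "(\<Sum>j\<le>d. fps_of_poly (P j) * A ^ j) = 0"
    unfolding algebraic_fps_def by blast
  define r where "r = (\<Sum>j\<le>d. monom (P j) j)"
  have c: "coeff r j = (if j \<le> d then P j else 0)" for j
    by (simp add: r_def coeff_sum)
  have "r \<noteq> 0" using P(1) c by (metis coeff_0)
  moreover have "fps_eval_poly2 r A = (\<Sum>j\<le>d. fps_of_poly (coeff r j) * A ^ j)"
    unfolding fps_eval_poly2_altdef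
  proof (rule sum.mono_neutral_left)
    show "{..degree r} \<subseteq> {..d}" by (auto simp: c intro!: degree_le)
    show "\<forall>i\<in>{..d} - {..degree r}. fps_of_poly (coeff r i) * A ^ i = 0"
      by (auto simp: coeff_eq_0 not_le)
  qed simp
  then have "fps_eval_poly2 r A = 0" using P(2) by (simp add: c)
  ultimately show "\<exists>r. r \<noteq> 0 \<and> fps_eval_poly2 r A = 0" by blast
next
  assume "\<exists>r. r \<noteq> 0 \<and> fps_eval_poly2 r A = 0"
  then obtain r where r: "r \<noteq> 0" "fps_eval_poly2 r A = 0" by blast
  then have "coeff r (degree r) \<noteq> 0" by simp
  then show "algebraic_fps A"
    unfolding algebraic_fps_def using r(2)[unfolded fps_eval_poly2_altdef]
    by (intro exI[of _ "degree r"] exI[of _ "coeff r"]) auto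
qed

lemma fps_eval_poly2_pcompose_linear:
  "fps_eval_poly2 (pcompose r [:p, q:]) A = fps_eval_poly2 r (fps_of_poly p + fps_of_poly q * A)"
proof (induction r)
  case (pCons a r)
  have "fps_eval_poly2 (pcompose (pCons a r) [:p, q:]) A =
      fps_of_poly a + fps_of_poly p * fps_eval_poly2 (pcompose r [:p, q:]) A +
      A * (fps_of_poly q * fps_eval_poly2 (pcompose r [:p, q:]) A)"
    by (simp add: pcompose_pCons fps_eval_poly2_simps)
  also have "\<dots> = fps_of_poly a + (fps_of_poly p + fps_of_poly q * A) * fps_eval_poly2 (pcompose r [:p, q:]) A"
    by (simp add: algebra_simps)
  finally show ?case by (simp add: pCons.IH fps_eval_poly2_simps)
qed (simp add: fps_eval_poly2_simps)

text \<open>The linear form is substituted into the equation; as \<open>q \<noteq> 0\<close>, the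
  composed polynomial is again nonzero.\<close>

lemma algebraic_fps_of_linear:
  assumes "algebraic_fps (fps_of_poly p + fps_of_poly q * A)" "q \<noteq> 0"
  shows "algebraic_fps A"
proof -
  obtain r where r: "r \<noteq> 0" "fps_eval_poly2 r (fps_of_poly p + fps_of_poly q * A) = 0"
    using assms(1) algebraic_fps_iff by blast
  have "pcompose r [:p, q:] \<noteq> 0" using r(1) assms(2) by (simp add: pcompose_eq_0_iff)
  moreover have "fps_eval_poly2 (pcompose r [:p, q:]) A = 0"
    using r(2) by (simp add: fps_eval_poly2_pcompose_linear)
  ultimately show ?thesis using algebraic_fps_iff by blast
qed

text \<open>While all coefficients vanish at \<open>\<rho>\<close>, the common factor
  \<open>[:- \<rho>, 1:]\<close> is divided out; the degree of the leading coefficient bounds the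
  number of divisions.\<close>

lemma algebraic_fps_nonvanishing:
  assumes "algebraic_fps A"
  obtains r where "fps_eval_poly2 r A = 0" "\<exists>j. poly (coeff r j) \<rho> \<noteq> 0"
proof -
  have "\<exists>r'. fps_eval_poly2 r' A = 0 \<and> (\<exists>j. poly (coeff r' j) \<rho> \<noteq> 0)"
    if "r \<noteq> 0" "fps_eval_poly2 r A = 0" for r
    using that
  proof (induction "degree (lead_coeff r)" arbitrary: r rule: less_induct)
    case less
    show ?case
    proof (cases "\<exists>j. poly (coeff r j) \<rho> \<noteq> 0")
      case False
      define l where "l = [:- \<rho>, 1:]"
      have l: "l \<noteq> 0" "degree l = 1" by (simp_all add: l_def)
      define s where "s = map_poly (\<lambda>p. p div l) r"
      have "l dvd coeff r j" for j using False by (simp add: l_def poly_eq_0_iff_dvd)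
      then have r: "r = smult l s"
        by (intro poly_eqI) (simp add: s_def coeff_map_poly)
      then have "s \<noteq> 0" using less.prems(1) by auto
      moreover have "fps_of_poly l \<noteq> 0" using l(1) by (metis fps_of_poly_0 fps_of_poly_eq_iff)
      then have "fps_eval_poly2 s A = 0"
        using less.prems(2) unfolding r fps_eval_poly2_simps by simp
      moreover have "lead_coeff r = l * lead_coeff s" unfolding r using l(1) by simp
      then have "degree (lead_coeff r) = 1 + degree (lead_coeff s)"
        using l \<open>s \<noteq> 0\<close> by (simp add: degree_mult_eq)
      ultimately show ?thesis using less.hyps[of s] by simp
    qed (use less.prems in blast)
  qed
  then show thesis using assms that algebraic_fps_iff by blast
qed

text \<open>
  At a point \<open>\<rho>\<close> where not all coefficients of an algebraic equation vanish, the term of largest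
  degree with nonvanishing coefficient dominates a solution that grows logarithmically.
\<close>

lemma not_algebraic_log_growth:
  fixes b :: "nat \<Rightarrow> real"
  assumes \<beta>: "\<beta> > 0" and c: "c > 0"
    and b: "\<And>n. n \<ge> 1 \<Longrightarrow> c / real n \<le> b n \<and> b n \<le> C / real n"
  shows "\<not> algebraic_fps (Abs_fps (\<lambda>n. complex_of_real (\<beta> ^ n * b n)))"
proof
  define A where "A = Abs_fps (\<lambda>n. complex_of_real (\<beta> ^ n * b n))"
  define \<rho> where "\<rho> = complex_of_real (1 / \<beta>)"
  assume "algebraic_fps (Abs_fps (\<lambda>n. complex_of_real (\<beta> ^ n * b n)))"
  then have "algebraic_fps A" by (simp add: A_def)
  then obtain r where r: "fps_eval_poly2 r A = 0" "\<exists>j. poly (coeff r j) \<rho> \<noteq> 0"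
    by (rule algebraic_fps_nonvanishing)
  define L where "L x = - ln (1 - x)" for x :: real
  \<comment> \<open>At \<open>n = 0\<close> the summand is \<open>1 / 0 = 0\<close>, so this is the
    usual logarithmic series; \<open>b 0\<close> is treated apart.\<close>
  have L: "(\<lambda>n. x ^ n / real n) sums L x" if "0 < x" "x < 1" for x
    using ln_series'[of "- x"] that sums_minus[of "\<lambda>n. - (x ^ n) / real n"] by (simp add: L_def)
  define f where "f x = (\<Sum>n. b n * x ^ n)" for x
  have bC: "\<bar>b n\<bar> \<le> C / real n" if "n \<ge> 1" for n
    using b[OF that] c by (auto simp: abs_le_iff) (smt (verit) divide_nonneg_nonneg of_nat_0_le_iff)
  have smb: "summable (\<lambda>n. b n * x ^ n)" if x: "0 < x" "x < 1" for x
  proof (rule summable_comparison_test')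
    show "summable (\<lambda>n. C * (x ^ n / real n))" using L[OF x] by (intro summable_mult) (rule sums_summable)
    show "norm (b n * x ^ n) \<le> C * (x ^ n / real n)" if "n \<ge> 1" for n
      using mult_right_mono[OF bC[OF that], of "x ^ n"] x by (simp add: abs_mult)
  qed
  have fb: "b 0 + c * L x \<le> f x \<and> f x \<le> b 0 + C * L x" if x: "0 < x" "x < 1" for x
  proof -
    have sf: "(\<lambda>n. b n * x ^ n) sums f x" unfolding f_def using smb[OF x] by (rule summable_sums)
    have s0: "(\<lambda>n. if n = 0 then b 0 else 0) sums b 0" using sums_single[of 0 "\<lambda>_. b 0"] by simp
    have "(\<lambda>n. (if n = 0 then b 0 else 0) + c * (x ^ n / real n)) sums (b 0 + c * L x)"
      by (intro sums_add s0 sums_mult L x)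
    then have "b 0 + c * L x \<le> f x"
    proof (rule sums_le[rotated, OF _ sf])
      fix n show "(if n = 0 then b 0 else 0) + c * (x ^ n / real n) \<le> b n * x ^ n"
        using b[of n] x by (cases "n = 0") (auto simp: mult_right_mono dest: mult_right_mono[of _ _ "x ^ n"])
    qed
    moreover have "(\<lambda>n. (if n = 0 then b 0 else 0) + C * (x ^ n / real n)) sums (b 0 + C * L x)"
      by (intro sums_add s0 sums_mult L x)
    then have "f x \<le> b 0 + C * L x"
    proof (rule sums_le[rotated, OF sf])
      fix n show "b n * x ^ n \<le> (if n = 0 then b 0 else 0) + C * (x ^ n / real n)"
        using b[of n] x by (cases "n = 0") (auto dest: mult_right_mono[of _ _ "x ^ n"])
    qed
    ultimately show ?thesis by blast
  qed
  have C: "C > 0" using b[of 1] c by simp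
  have ev: "\<forall>\<^sub>F x in at_left 1. 0 < x \<and> x < (1::real)"
    using eventually_at_left_real[of 0 1] by (auto elim: eventually_mono)
  have Linf: "filterlim L at_top (at_left 1)"
    unfolding L_def by real_asymp
  have finf: "filterlim f at_top (at_left 1)"
  proof (rule filterlim_at_top_mono)
    show "filterlim (\<lambda>x. b 0 + c * L x) at_top (at_left 1)"
      by (intro filterlim_tendsto_add_at_top[OF tendsto_const] filterlim_tendsto_pos_mult_at_top[OF tendsto_const c Linf])
    show "\<forall>\<^sub>F x in at_left 1. b 0 + c * L x \<le> f x" using ev by eventually_elim (use fb in blast)
  qed
  \<comment> \<open>\<open>1 - x = exp (- L x)\<close>, and near 1 \<open>f\<close> is at most a
    constant times \<open>L\<close>, so powers of \<open>f\<close> lose against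
    \<open>1 - x\<close>.\<close>
  have small: "((\<lambda>x. (1 - x) * f x ^ j) \<longlongrightarrow> 0) (at_left 1)" for j
  proof -
    define K where "K = \<bar>b 0\<bar> + C"
    have "((\<lambda>x. L x ^ j / exp (L x)) \<longlongrightarrow> 0) (at_left 1)"
      by (rule filterlim_compose[OF tendsto_power_div_exp_0 Linf])
    then have "((\<lambda>x. K ^ j * (L x ^ j / exp (L x))) \<longlongrightarrow> K ^ j * 0) (at_left 1)"
      by (intro tendsto_mult tendsto_const)
    then have lim: "((\<lambda>x. K ^ j * (L x ^ j / exp (L x))) \<longlongrightarrow> 0) (at_left 1)" by simp
    show ?thesis
    proof (rule tendsto_sandwich[OF _ _ tendsto_const lim])
      have L1: "\<forall>\<^sub>F x in at_left 1. 1 \<le> L x" using Linf by (simp add: filterlim_at_top)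
      have f0: "\<forall>\<^sub>F x in at_left 1. 0 \<le> f x" using finf by (simp add: filterlim_at_top)
      show "\<forall>\<^sub>F x in at_left 1. 0 \<le> (1 - x) * f x ^ j"
        using ev f0 by eventually_elim auto
      show "\<forall>\<^sub>F x in at_left 1. (1 - x) * f x ^ j \<le> K ^ j * (L x ^ j / exp (L x))"
        using ev f0 L1
      proof eventually_elim
        case (elim x)
        have "f x \<le> b 0 + C * L x" using fb elim by blast
        also have "\<dots> \<le> \<bar>b 0\<bar> * L x + C * L x"
          using elim mult_left_mono[of 1 "L x" "\<bar>b 0\<bar>"] by simp
        finally have "f x ^ j \<le> (K * L x) ^ j"
          using elim by (intro power_mono) (simp_all add: K_def algebra_simps)
        moreover have "exp (L x) = 1 / (1 - x)" using elim by (simp add: L_def exp_minus divide_inverse)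
        ultimately show ?case using elim by (simp add: power_mult_distrib mult.commute mult_left_mono)
      qed
    qed
  qed
  define z where "z x = complex_of_real (x / \<beta>)" for x
  have rad: "fps_conv_radius A \<ge> ereal (1 / \<beta>)"
    unfolding fps_conv_radius_def
  proof (rule conv_radius_geI_ex)
    fix t assume t: "0 < t" "ereal t < ereal (1 / \<beta>)"
    then have x: "0 < \<beta> * t" "\<beta> * t < 1" using \<beta> by (auto simp: field_simps)
    have "summable (\<lambda>n. complex_of_real (b n * (\<beta> * t) ^ n))" using smb[OF x] by (rule summable_of_real)
    then have "summable (\<lambda>n. fps_nth A n * complex_of_real t ^ n)"
      by (simp add: A_def power_mult_distrib mult_ac)
    then show "\<exists>z. norm z = t \<and> summable (\<lambda>n. fps_nth A n * z ^ n)"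
      using t by (intro exI[of _ "complex_of_real t"]) auto
  qed
  \<comment> \<open>Comparison with \<open>L\<close> gives radius of convergence at least
    \<open>1 / \<beta>\<close>, so the formal equation may be evaluated at
    \<open>z x\<close>.\<close>
  have root: "(\<Sum>j\<le>degree r. poly (coeff r j) (z x) * complex_of_real (f x) ^ j) = 0"
    if x: "0 < x" "x < 1" for x
  proof -
    have "norm (z x) < 1 / \<beta>" using x \<beta> by (simp add: z_def norm_divide field_simps)
    then have nz: "norm (z x) < fps_conv_radius A" using rad by (meson ereal_less_eq(3) less_le_trans ereal_less(2) less_ereal.simps(1))
    have Az: "eval_fps A (z x) = complex_of_real (f x)"
    proof -
      have "(\<lambda>n. fps_nth A n * z x ^ n) sums eval_fps A (z x)" by (rule sums_eval_fps[OF nz])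
      moreover have "fps_nth A n * z x ^ n = complex_of_real (b n * x ^ n)" for n
        using \<beta> by (simp add: A_def z_def power_divide)
      moreover have "(\<lambda>n. complex_of_real (b n * x ^ n)) sums complex_of_real (f x)"
        unfolding f_def using smb[OF x] by (intro sums_of_real summable_sums)
      ultimately show ?thesis using sums_unique2 by fastforce
    qed
    have radp: "norm (z x) < fps_conv_radius (fps_of_poly (coeff r j) * A ^ j)" for j
    proof -
      have "norm (z x) < fps_conv_radius (A ^ j)" using nz fps_conv_radius_power[of A j] by (rule less_le_trans)
      then show ?thesis
        using fps_conv_radius_mult[of "fps_of_poly (coeff r j)" "A ^ j"] by (simp add: less_le_trans)
    qed
    have "norm (z x) < fps_conv_radius (\<Sum>j\<in>J. fps_of_poly (coeff r j) * A ^ j) \<and>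
        eval_fps (\<Sum>j\<in>J. fps_of_poly (coeff r j) * A ^ j) (z x) =
        (\<Sum>j\<in>J. poly (coeff r j) (z x) * complex_of_real (f x) ^ j)" if "finite J" for J
      using that
    proof (induction J rule: finite_induct)
      case (insert i J)
      have "eval_fps (fps_of_poly (coeff r i) * A ^ i) (z x) = poly (coeff r i) (z x) * complex_of_real (f x) ^ i"
        using nz fps_conv_radius_power[of A i]
        by (subst eval_fps_mult) (auto simp: eval_fps_power Az intro: less_le_trans)
      moreover have "norm (z x) < fps_conv_radius (fps_of_poly (coeff r i) * A ^ i + (\<Sum>j\<in>J. fps_of_poly (coeff r j) * A ^ j))"
        using insert.IH radp[of i] by (intro less_le_trans[OF _ fps_conv_radius_add]) simp
      ultimately show ?case using insert radp[of i] by (simp add: eval_fps_add)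
    qed simp
    from this[of "{..degree r}"] show ?thesis
      using r(1) unfolding fps_eval_poly2_altdef by simp
  qed
  define J where "J = Max {j. poly (coeff r j) \<rho> \<noteq> 0}"
  have fin: "finite {j. poly (coeff r j) \<rho> \<noteq> 0}"
    by (rule finite_subset[of _ "{..degree r}"]) (auto intro: le_degree)
  then have J: "poly (coeff r J) \<rho> \<noteq> 0" using Max_in[OF fin] r(2) by (auto simp: J_def)
  have Jmax: "poly (coeff r j) \<rho> = 0" if "j > J" for j
    using Max_ge[OF fin, of j] that unfolding J_def[symmetric] by auto
  have J_le: "J \<le> degree r" using J by (intro le_degree) auto
  have zlim: "(z \<longlongrightarrow> \<rho>) (at_left 1)"
    unfolding z_def \<rho>_def by (intro tendsto_intros) (use \<beta> in auto)
  have plim: "((\<lambda>x. poly p (z x)) \<longlongrightarrow> poly p \<rho>) (at_left 1)" for p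
    using zlim by (rule tendsto_poly)
  have inv0: "((\<lambda>x. inverse (complex_of_real (f x))) \<longlongrightarrow> 0) (at_left 1)"
  proof -
    have "((\<lambda>x. inverse (f x)) \<longlongrightarrow> 0) (at_left 1)" by (rule tendsto_inverse_0_at_top[OF finf])
    then have "((\<lambda>x. complex_of_real (inverse (f x))) \<longlongrightarrow> complex_of_real 0) (at_left 1)" by (rule tendsto_of_real)
    then show ?thesis by simp
  qed
  \<comment> \<open>After division by \<open>f x ^ J\<close>: for \<open>j < J\<close> a negative
    power of \<open>f\<close> is left; for \<open>j > J\<close> the zero of the coefficient at
    \<open>\<rho>\<close> supplies a factor \<open>1 - x\<close> that beats the positive
    power.\<close>
  have lims: "((\<lambda>x. poly (coeff r j) (z x) * complex_of_real (f x) ^ j * inverse (complex_of_real (f x)) ^ J) \<longlongrightarrow>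
      (if j = J then poly (coeff r J) \<rho> else 0)) (at_left 1)" for j
  proof -
    have fne: "\<forall>\<^sub>F x in at_left 1. f x > 0" using finf by (simp add: filterlim_at_top_dense)
    consider "j = J" | "j < J" | "j > J" by linarith
    then show ?thesis
    proof cases
      case 1
      have "\<forall>\<^sub>F x in at_left 1. poly (coeff r J) (z x) =
          poly (coeff r j) (z x) * complex_of_real (f x) ^ j * inverse (complex_of_real (f x)) ^ J"
        using fne by eventually_elim (simp add: 1 power_inverse)
      from Lim_transform_eventually[OF plim this] show ?thesis using 1 by simp
    next
      case 2
      have "\<forall>\<^sub>F x in at_left 1. poly (coeff r j) (z x) * inverse (complex_of_real (f x)) ^ (J - j) =
          poly (coeff r j) (z x) * complex_of_real (f x) ^ j * inverse (complex_of_real (f x)) ^ J"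
        using fne
      proof eventually_elim
        case (elim x)
        have "J = j + (J - j)" using 2 by simp
        then have "inverse (complex_of_real (f x)) ^ J =
            inverse (complex_of_real (f x)) ^ j * inverse (complex_of_real (f x)) ^ (J - j)"
          by (metis power_add)
        then show ?case using elim by (simp add: power_inverse)
      qed
      moreover have "((\<lambda>x. poly (coeff r j) (z x) * inverse (complex_of_real (f x)) ^ (J - j)) \<longlongrightarrow>
          poly (coeff r j) \<rho> * 0 ^ (J - j)) (at_left 1)"
        by (intro tendsto_mult plim tendsto_power inv0)
      ultimately have "((\<lambda>x. poly (coeff r j) (z x) * complex_of_real (f x) ^ j * inverse (complex_of_real (f x)) ^ J) \<longlongrightarrow>
          poly (coeff r j) \<rho> * 0 ^ (J - j)) (at_left 1)" by (rule Lim_transform_eventually[rotated])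
      then show ?thesis using 2 by (simp add: zero_power)
    next
      case 3
      obtain p where p: "coeff r j = [:- \<rho>, 1:] * p"
        using Jmax[OF 3] by (auto simp: poly_eq_0_iff_dvd)
      have "\<forall>\<^sub>F x in at_left 1. - (poly p (z x) / of_real \<beta> * complex_of_real ((1 - x) * f x ^ (j - J))) =
          poly (coeff r j) (z x) * complex_of_real (f x) ^ j * inverse (complex_of_real (f x)) ^ J"
        using fne
      proof eventually_elim
        case (elim x)
        have "j = J + (j - J)" using 3 by simp
        then have "complex_of_real (f x) ^ j = complex_of_real (f x) ^ J * complex_of_real (f x) ^ (j - J)"
          by (metis power_add)
        then have "complex_of_real (f x) ^ j * inverse (complex_of_real (f x)) ^ J = complex_of_real (f x) ^ (j - J)"
          using elim by (simp add: power_inverse)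
        moreover have zr: "z x - \<rho> = - (complex_of_real (1 - x) / of_real \<beta>)"
          using \<beta> by (simp add: z_def \<rho>_def diff_divide_distrib)
        have "poly (coeff r j) (z x) = (z x - \<rho>) * poly p (z x)" by (simp add: p algebra_simps)
        then have "poly (coeff r j) (z x) = - (complex_of_real (1 - x) / of_real \<beta>) * poly p (z x)"
          by (simp only: zr)
        ultimately show ?case by (simp add: mult_ac)
      qed
      moreover have "((\<lambda>x. - (poly p (z x) / of_real \<beta> * complex_of_real ((1 - x) * f x ^ (j - J)))) \<longlongrightarrow>
          - (poly p \<rho> / of_real \<beta> * complex_of_real 0)) (at_left 1)"
        using \<beta> by (intro tendsto_minus tendsto_mult tendsto_divide plim tendsto_const tendsto_of_real small) auto
      ultimately have "((\<lambda>x. poly (coeff r j) (z x) * complex_of_real (f x) ^ j * inverse (complex_of_real (f x)) ^ J) \<longlongrightarrow>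
          - (poly p \<rho> / of_real \<beta> * complex_of_real 0)) (at_left 1)" by (rule Lim_transform_eventually[rotated])
      then show ?thesis using 3 by simp
    qed
  qed
  have "(\<Sum>j\<le>degree r. if j = J then poly (coeff r J) \<rho> else 0) = poly (coeff r J) \<rho>"
    using J_le by simp
  moreover have "((\<lambda>x. \<Sum>j\<le>degree r. poly (coeff r j) (z x) * complex_of_real (f x) ^ j *
      inverse (complex_of_real (f x)) ^ J) \<longlongrightarrow> (\<Sum>j\<le>degree r. if j = J then poly (coeff r J) \<rho> else 0)) (at_left 1)"
    by (intro tendsto_sum lims)
  ultimately have "((\<lambda>x. \<Sum>j\<le>degree r. poly (coeff r j) (z x) * complex_of_real (f x) ^ j *
      inverse (complex_of_real (f x)) ^ J) \<longlongrightarrow> poly (coeff r J) \<rho>) (at_left 1)"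
    by (simp only:)
  moreover have "\<forall>\<^sub>F x in at_left 1. (\<Sum>j\<le>degree r. poly (coeff r j) (z x) * complex_of_real (f x) ^ j *
      inverse (complex_of_real (f x)) ^ J) = 0"
    using ev by eventually_elim (simp add: sum_distrib_right[symmetric] root)
  ultimately have "((\<lambda>x. 0) \<longlongrightarrow> poly (coeff r J) \<rho>) (at_left (1::real))"
    by (rule Lim_transform_eventually)
  then have "poly (coeff r J) \<rho> = 0"
    by (intro tendsto_unique[OF _ _ tendsto_const]) auto
  with J show False by simp
qed

text \<open>
  Subtracting the value at \<open>1 / \<beta>\<close> and dividing by \<open>1 - \<beta> X\<close> replaces the coefficients by tail sums
  and thus lowers \<open>r\<close> by one.
\<close>

lemma inverse_power_tail_bounds:
  fixes b :: "nat \<Rightarrow> real"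
  assumes c: "c > 0" and r: "r \<ge> 1"
    and b: "\<And>n. n \<ge> 1 \<Longrightarrow> c / real n ^ Suc r \<le> b n \<and> b n \<le> C / real n ^ Suc r"
    and n: "n \<ge> 1"
  shows "summable b" "c / 2 ^ Suc r / real n ^ r \<le> (\<Sum>i. b (i + Suc n))"
    "(\<Sum>i. b (i + Suc n)) \<le> C / real n ^ r"
proof -
  have C: "C > 0" using b[of 1] c by simp
  have b0: "b k \<ge> 0" if "k \<ge> 1" for k
    using b[OF that] c by (auto intro: order_trans[rotated])
  \<comment> \<open>Of the \<open>r + 1\<close> factors \<open>k\<close> in a denominator,
    \<open>r - 1\<close> are bounded below by \<open>n\<close> and two by
    \<open>(k - 1) * k\<close>, whose reciprocals telescope.\<close>
  have tel: "(\<lambda>i. 1 / real (i + n) - 1 / real (Suc i + n)) sums (1 / real (0 + n) - 0)"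
    by (rule telescope_sums') real_asymp
  have up: "b (i + Suc n) \<le> C / real n ^ (r - 1) * (1 / real (i + n) - 1 / real (Suc i + n))" for i
  proof -
    let ?k = "real (i + Suc n)"
    have k: "real n \<le> ?k" "?k > 0" "real (i + n) > 0" using n by auto
    obtain s where s: "r = Suc s" using r by (cases r) auto
    have "real n ^ s * (real (i + n) * ?k) \<le> ?k ^ s * (?k * ?k)"
      using k by (intro mult_mono power_mono) auto
    also have "\<dots> = ?k ^ Suc r" by (simp add: s)
    finally have "C / ?k ^ Suc r \<le> C / (real n ^ s * (real (i + n) * ?k))"
      using k C n by (intro divide_left_mono) auto
    also have "\<dots> = C / real n ^ (r - 1) * (1 / real (i + n) - 1 / real (Suc i + n))"
    proof -
      have "1 / real (i + n) - 1 / real (Suc i + n) = 1 / (real (i + n) * ?k)"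
        using k by (simp add: field_simps)
      then show ?thesis by (simp add: s)
    qed
    finally show ?thesis using b[of "i + Suc n"] by simp
  qed
  have smt: "summable (\<lambda>i. b (i + Suc n))"
  proof (rule summable_comparison_test')
    show "summable (\<lambda>i. C / real n ^ (r - 1) * (1 / real (i + n) - 1 / real (Suc i + n)))"
      using tel by (intro summable_mult sums_summable)
    show "norm (b (i + Suc n)) \<le> C / real n ^ (r - 1) * (1 / real (i + n) - 1 / real (Suc i + n))" for i
      using up[of i] b0[of "i + Suc n"] by simp
  qed
  then show "summable b" using summable_iff_shift[of b "Suc n"] by blast
  have "(\<Sum>i. b (i + Suc n)) \<le> (\<Sum>i. C / real n ^ (r - 1) * (1 / real (i + n) - 1 / real (Suc i + n)))"
    using tel by (intro suminf_le up smt summable_mult sums_summable)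
  also have "\<dots> = C / real n ^ (r - 1) * (1 / real n)"
    using sums_unique[OF sums_mult[OF tel, of "C / real n ^ (r - 1)"]] by simp
  also have "\<dots> = C / real n ^ r" using r by (cases r) (auto simp: mult.commute)
  finally show "(\<Sum>i. b (i + Suc n)) \<le> C / real n ^ r" .
  \<comment> \<open>The first \<open>n\<close> terms of the tail have indices from
    \<open>n + 1\<close> to \<open>2 * n\<close>, which already gives the order
    \<open>1 / n ^ r\<close>.\<close>
  have "c / 2 ^ Suc r / real n ^ r = (\<Sum>i<n. c / (2 * real n) ^ Suc r)"
    using n by (simp add: power_mult_distrib)
  also have "\<dots> \<le> (\<Sum>i<n. b (i + Suc n))"
  proof (rule sum_mono)
    fix i assume "i \<in> {..<n}"
    then have "real (i + Suc n) \<le> 2 * real n" by (simp add: Suc_le_eq[symmetric])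
    then have "c / (2 * real n) ^ Suc r \<le> c / real (i + Suc n) ^ Suc r"
      using c n by (intro divide_left_mono power_mono mult_pos_pos zero_less_power) auto
    also have "\<dots> \<le> b (i + Suc n)" using b[of "i + Suc n"] by simp
    finally show "c / (2 * real n) ^ Suc r \<le> b (i + Suc n)" .
  qed
  also have "\<dots> \<le> (\<Sum>i. b (i + Suc n))"
    by (intro sum_le_suminf smt) (auto intro!: b0)
  finally show "c / 2 ^ Suc r / real n ^ r \<le> (\<Sum>i. b (i + Suc n))" .
qed

text \<open>For the tail sums \<open>t\<close>, the relation
  \<open>b (n + 1) = t n - t (n + 1)\<close> expresses \<open>A\<close> as a constant plus
  \<open>\<beta> X - 1\<close> times the series \<open>H\<close> of the tails, so an equation for
  \<open>A\<close> yields one for \<open>H\<close>. The induction starts at \<open>r = 1\<close>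
  with logarithmic growth.\<close>

lemma not_algebraic_power_decay:
  fixes b :: "nat \<Rightarrow> real"
  assumes "r \<ge> 1" and \<beta>: "\<beta> > 0" and "c > 0"
    and "\<And>n. n \<ge> 1 \<Longrightarrow> c / real n ^ r \<le> b n \<and> b n \<le> C / real n ^ r"
  shows "\<not> algebraic_fps (Abs_fps (\<lambda>n. complex_of_real (\<beta> ^ n * b n)))"
  using assms(1,3,4)
proof (induction r arbitrary: b c rule: nat_induct_at_least)
  case base
  then show ?case using not_algebraic_log_growth[OF \<beta>, of c b C] by simp
next
  case (Suc r)
  define A where "A = Abs_fps (\<lambda>n. complex_of_real (\<beta> ^ n * b n))"
  define t where "t n = (\<Sum>i. b (i + Suc n))" for n
  define H where "H = Abs_fps (\<lambda>n. complex_of_real (\<beta> ^ n * t n))"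
  note tail = inverse_power_tail_bounds[OF Suc.prems(1) Suc.hyps Suc.prems(2)]
  have sm: "summable b" using tail(1)[of 1] by simp
  have t: "t n = b (Suc n) + t (Suc n)" for n
    using suminf_split_head[of "\<lambda>i. b (i + Suc n)"] summable_iff_shift[of b "Suc n"] sm by (simp add: t_def)
  have "\<not> algebraic_fps H"
    unfolding H_def
    by (rule Suc.IH[of "c / 2 ^ Suc r"]) (use tail(2,3) Suc.prems(1) in \<open>auto simp: t_def\<close>)
  moreover have "A = fps_of_poly [:complex_of_real (b 0 + t 0):] + fps_of_poly [:- 1, of_real \<beta>:] * H"
  proof (rule fps_ext)
    fix n
    show "fps_nth A n = fps_nth (fps_of_poly [:complex_of_real (b 0 + t 0):] + fps_of_poly [:- 1, of_real \<beta>:] * H) n"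
    proof (cases n)
      case 0
      then show ?thesis by (simp add: A_def H_def fps_of_poly_pCons)
    next
      case (Suc m)
      then show ?thesis using t[of m]
        by (simp add: A_def H_def fps_of_poly_pCons ring_distribs fps_of_poly_const mult.assoc)
    qed
  qed
  ultimately show ?case
    using algebraic_fps_of_linear[of "[:complex_of_real (b 0 + t 0):]" "[:- 1, of_real \<beta>:]" H]
    unfolding A_def by auto
qed

section \<open>Growth of the number of A-avoiding permutations and conclusion\<close>

lemma Av_A_nonempty:
  assumes k: "k \<ge> 3"
  shows "card (Av n (A_patterns k)) \<ge> 1"
proof -
  have "[1..<n+1] \<in> Av n (A_patterns k)"
    unfolding Av_A_iff[OF order_trans[OF _ k, of 2, simplified]]
  proof (intro conjI allI impI)
    show "[1..<n+1] \<in> permutations_of_set {1..n}" by (auto simp: permutations_of_set_def)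
    fix s x assume s: "subseq (s @ [x]) [1..<n+1]" "length s = k - 1"
    have "sorted_wrt (<) (s @ [x])" using sorted_wrt_subseq[OF s(1) sorted_wrt_upt] .
    moreover have "s \<noteq> []" using s(2) k by auto
    ultimately show "last s \<le> x" by (auto simp: sorted_wrt_append less_imp_le)
  qed
  then show ?thesis by (auto simp: Suc_le_eq card_gt_0_iff Av_def)
qed

lemma card_Av_A_bounds:
  assumes k: "k \<ge> 5" "odd k"
  obtains \<beta> c C :: real and r :: nat where "\<beta> > 0" "c > 0" "r \<ge> 1"
    "\<And>n. n \<ge> 1 \<Longrightarrow> c * \<beta> ^ n / real n ^ r \<le> real (card (Av n (A_patterns k))) \<and>
       real (card (Av n (A_patterns k))) \<le> C * \<beta> ^ n / real n ^ r"
proof -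
  define d where "d = k - 2"
  have d: "odd d" "d \<ge> 3" "k = d + 2" using k by (auto simp: d_def)
  define \<beta> where "\<beta> = real d ^ 2 + 1"
  define r where "r = (d choose 2) + (d - 1) div 2"
  have \<beta>: "\<beta> \<ge> 1" by (simp add: \<beta>_def)
  have r: "r \<ge> 1" using d(2) by (simp add: r_def)
  obtain c C where cC: "c > 0" "\<And>X :: nat set. finite X \<Longrightarrow> X \<noteq> {} \<Longrightarrow>
      c * \<beta> ^ card X / real (card X) ^ r \<le> real (card (inc_free_words d X)) \<and>
      real (card (inc_free_words d X)) \<le> C * \<beta> ^ card X / real (card X) ^ r"
    using card_inc_free_words_bounds[OF d(1,2)] unfolding \<beta>_def[symmetric] r_def[symmetric] by blast
  \<comment> \<open>\<open>\<beta> ^ d\<close> pays for the shift from \<open>n\<close> to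
    \<open>n - d\<close>; the minimum with 1 covers \<open>n \<le> d\<close>, where only the
    existence of an avoiding permutation is used.\<close>
  define c' where "c' = min c 1 / \<beta> ^ d"
  have c': "c' > 0" using cC(1) \<beta> by (simp add: c'_def)
  have "c' * \<beta> ^ n / real n ^ r \<le> real (card (Av n (A_patterns k)))"
    "real (card (Av n (A_patterns k))) \<le> C * \<beta> ^ n / real n ^ r" if n: "n \<ge> 1" for n
  proof -
    have "real (card (Av n (A_patterns k))) \<le> real (card (inc_free_words d {1..n}))"
      using Av_A_le[of d n] d by simp
    also have "\<dots> \<le> C * \<beta> ^ n / real n ^ r" using cC(2)[of "{1..n}"] n by simp
    finally show "real (card (Av n (A_patterns k))) \<le> C * \<beta> ^ n / real n ^ r" .
    show "c' * \<beta> ^ n / real n ^ r \<le> real (card (Av n (A_patterns k)))"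
    proof (cases "n \<le> d")
      case True
      have "c' * \<beta> ^ n / real n ^ r \<le> c' * \<beta> ^ n / 1"
        using c' \<beta> n by (intro divide_left_mono) auto
      also have "\<dots> \<le> c' * \<beta> ^ d" using c' \<beta> True by (simp add: power_increasing)
      also have "\<dots> \<le> 1" using \<beta> by (simp add: c'_def)
      also have "\<dots> \<le> real (card (Av n (A_patterns k)))"
        using Av_A_nonempty[of k n] k by simp
      finally show ?thesis .
    next
      case False
      then have e: "\<beta> ^ n = \<beta> ^ d * \<beta> ^ (n - d)" by (simp add: power_add[symmetric])
      have "c' * \<beta> ^ n / real n ^ r = min c 1 * \<beta> ^ (n - d) / real n ^ r"
        using \<beta> by (simp add: c'_def e)
      also have "\<dots> \<le> c * \<beta> ^ (n - d) / real (n - d) ^ r"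
        using False cC(1) \<beta> by (intro frac_le mult_right_mono power_mono) auto
      also have "\<dots> \<le> real (card (inc_free_words d {d+1..n}))"
        using cC(2)[of "{d+1..n}"] False by simp
      also have "\<dots> \<le> real (card (Av n (A_patterns k)))"
        using Av_A_ge[of d n] d False by simp
      finally show ?thesis .
    qed
  qed
  then show thesis using that[of \<beta> c' r C] \<beta> c' r by auto
qed

theorem theorem13:
  "(\<forall>k\<ge>4. \<forall>n. card (Av n (A_patterns k)) = card (Av n (B_patterns k))) \<and>
   (\<forall>k\<ge>5. odd k \<longrightarrow>
      \<not> algebraic_fps (Abs_fps (\<lambda>n. of_nat (card (Av n (B_patterns k))))))"
proof (intro conjI allI impI)
  show "card (Av n (A_patterns k)) = card (Av n (B_patterns k))" if "k \<ge> 4" for k n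
    using that by (rule Av_A_Av_B_card)
next
  fix k :: nat assume k: "k \<ge> 5" "odd k"
  define a where "a n = real (card (Av n (A_patterns k)))" for n
  obtain \<beta> c C :: real and r :: nat where \<beta>: "\<beta> > 0" and c: "c > 0" and r: "r \<ge> 1"
    and a: "\<And>n. n \<ge> 1 \<Longrightarrow> c * \<beta> ^ n / real n ^ r \<le> real (card (Av n (A_patterns k))) \<and>
      real (card (Av n (A_patterns k))) \<le> C * \<beta> ^ n / real n ^ r"
    using card_Av_A_bounds[OF k, of thesis] by fast
  have "c / real n ^ r \<le> a n / \<beta> ^ n \<and> a n / \<beta> ^ n \<le> C / real n ^ r" if "n \<ge> 1" for n
    using a[OF that] \<beta> by (simp add: a_def field_simps)
  then have "\<not> algebraic_fps (Abs_fps (\<lambda>n. complex_of_real (\<beta> ^ n * (a n / \<beta> ^ n))))"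
    by (rule not_algebraic_power_decay[OF r \<beta> c])
  moreover have "complex_of_real (\<beta> ^ n * (a n / \<beta> ^ n)) = of_nat (card (Av n (B_patterns k)))" for n
    using \<beta> Av_A_Av_B_card[of k n] k by (simp add: a_def)
  ultimately show "\<not> algebraic_fps (Abs_fps (\<lambda>n. of_nat (card (Av n (B_patterns k)))))" by simp
qed

end
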